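(* Let $\mathcal{A}$ be a real (linear or affine) hyperplane arrangement with face poset $\mathcal{F}$. Define a diagram of spaces $\mathcal{E}$ on the opposite poset $\mathcal{F}^{op}$ by $$\mathcal{E}(F):=Sal(\mathcal{A}_{|F|}),$$ and let $\mathcal{E}(F_1>F_2)$ be the natural map of complexes $Sal(\mathcal{A}_{|F_1|})\hookrightarrow Sal(\mathcal{A}_{|F_2|})$ induced by the inclusion $\mathcal{A}_{|F_1|}\hookrightarrow\mathcal{A}_{|F_2|}$ (where $F_1>F_2$ in $\mathcal{F}^{op}$). Then $$\mathrm{hocolim}\,\mathcal{E}\simeq\mathrm{hocolim}\,\mathscr{D}_{id}\simeq\mathcal{M}(\mathcal{A}).$$
   Context: **Arrangements.** $\mathcal{A}$ is a finite set of linear or affine hyperplanes in $\mathbb{R}^d$. $\mathcal{M}(\mathcal{A})=\mathbb{C}^d\setminus\bigcup\mathcal{A}_{\mathbb{C}}$ is the complement of its complexification (the same defining equations in $\mathbb{C}^d$). $\mathcal{F}=\mathcal{F}(\mathcal{A})$ is the face poset: the set of all relatively open polyhedral cells of the stratification of $\mathbb{R}^d$ induced by $\mathcal{A}$, ordered by $F_1\ge F_2 \iff \overline{F_1}\subseteq\overline{F_2}$. The chambers $\mathcal{C}(\mathcal{A})$ are the minimal elements. $|F|$ is the affine hull of $F$, and $\mathcal{A}_{|F|}=\{H\in\mathcal{A}: |F|\subseteq H\}$. For a face $F$ and chamber $C$, $C_F$ is the unique chamber of $\mathcal{A}$ whose closure contains $F$ and which lies in the same chamber of $\mathcal{A}_{|F|}$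 as $C$. **Salvetti complex.** Choose a point $w(F)$ in every face $F$ and put $w(F,C)=w(F)\oplus[w(F)-w(C_F)]\in\mathbb{R}^d\oplus\mathbb{R}^d=\mathbb{C}^d$ (it depends only on $F$ and $C_F$). $Sal(\mathcal{A})$ is the simplicial complex with vertices $w(F,C)$, $F\in\mathcal{F}$, $C\in\mathcal{C}(\mathcal{A})$, in which the convex hull of $w(F_0,C_0),\dots,w(F_k,C_k)$ is a simplex iff (up to ordering) $F_0>\dots>F_k$ is a chain in $\mathcal{F}$ and $(C_0)_{F_i}=(C_i)_{F_i}$ for all $i$. **Natural maps.** For $F\in\mathcal{F}$, the map sending a face of $\mathcal{A}$ to the face of $\mathcal{A}_{|F|}$ containing it restricts to an isomorphism $\mathcal{F}_{\le F}\cong\mathcal{F}(\mathcal{A}_{|F|})$, by which these posets are identified. Thereby $Sal(\mathcal{A}_{|F|})$ is identified with the subcomplex of $Sal(\mathcal{A})$ spanned by the vertices $w(G,C)$ with $C\le G\le F$. If $F_1>F_2$ in $\mathcal{F}^{op}$ (i.e. $F_1<F_2$ in $\mathcal{F}$), then $\mathcal{A}_{|F_1|}\subseteq\mathcal{A}_{|F_2|}$ and the natural map $Sal(\mathcal{A}_{|F_1|})\hookrightarrow Sal(\mathcal{A}_{|F_2|})$ is the corresponding inclusion of subcomplexes. **Diagrams.** A diagram of spaces over a poset $\mathcal{P}$ is a covariant functor $\mathcal{P}\to Top$, where $\mathcal{P}$ is a category with an arrow $p\to q$ iff $p\ge q$. $\mathscr{D}_{id}$ is the diagram over $\mathcal{F}$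 with discrete spaces $\mathscr{D}_{id}(F)=\{C\in\mathcal{C}(\mathcal{A}): C\le F\}$ and maps $\mathscr{D}_{id}(F_1>F_2): C\mapsto C_{F_2}$. For a diagram $\mathscr{D}$ over $\mathcal{P}$ with spaces $D_p$ and maps $f_{p>q}$, $\mathrm{hocolim}\,\mathscr{D}=\bigsqcup_{p} D_p\times\Delta(\mathcal{P}_{\le p})/\!\sim$, where for $p>q$ each point $(x,t)\in D_p\times\Delta(\mathcal{P}_{\le q})\subseteq D_p\times\Delta(\mathcal{P}_{\le p})$ is identified with $(f_{p>q}(x),t)\in D_q\times\Delta(\mathcal{P}_{\le q})$; $\Delta(\cdot)$ is the order complex. *)

theory Defs
  imports "HOL-Analysis.Analysis"
begin

section \<open>Real hyperplane arrangements\<close>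

definition arrangement :: "(real ^ 'n) set set \<Rightarrow> bool" where
  "arrangement A \<longleftrightarrow> finite A \<and> (\<forall>H\<in>A. \<exists>a b. a \<noteq> 0 \<and> H = {x. a \<bullet> x = b})"

text \<open>A hyperplane has many defining equations, which differ by a nonzero real factor. We keep all
  of them: neither the complement nor the faces depend on which one is used.\<close>

definition equations :: "(real ^ 'n) set set \<Rightarrow> ((real ^ 'n) \<times> real) set" where
  "equations A = {(a, b). a \<noteq> 0 \<and> {x. a \<bullet> x = b} \<in> A}"

definition complexified_complement :: "(real ^ 'n) set set \<Rightarrow> (complex ^ 'n) set" where
  "complexified_complement A =
     {z. \<forall>(a, b) \<in> equations A. (\<Sum>i\<in>UNIV. complex_of_real (a $ i) * z $ i) \<noteq> complex_of_real b}"

definition faces :: "(real ^ 'n) set set \<Rightarrow> (real ^ 'n) set set" where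
  "faces A = range (\<lambda>x. {y. \<forall>(a, b) \<in> equations A. sgn (a \<bullet> y - b) = sgn (a \<bullet> x - b)})"

text \<open>The order on faces is reverse inclusion of closures, so chambers are minimal.\<close>

definition face_le :: "(real ^ 'n) set \<Rightarrow> (real ^ 'n) set \<Rightarrow> bool" where
  "face_le F G \<longleftrightarrow> closure G \<subseteq> closure F"

definition chambers :: "(real ^ 'n) set set \<Rightarrow> (real ^ 'n) set set" where
  "chambers A = {C \<in> faces A. \<forall>F \<in> faces A. face_le F C \<longrightarrow> F = C}"

definition localization :: "(real ^ 'n) set set \<Rightarrow> (real ^ 'n) set \<Rightarrow> (real ^ 'n) set set" where
  "localization A F = {H \<in> A. affine hull F \<subseteq> H}"

text \<open>The chamber \<open>C\<^sub>F\<close>.\<close>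

definition chamber_at ::
  "(real ^ 'n) set set \<Rightarrow> (real ^ 'n) set \<Rightarrow> (real ^ 'n) set \<Rightarrow> (real ^ 'n) set" where
  "chamber_at A F C =
     (THE D. D \<in> chambers A \<and> F \<subseteq> closure D \<and>
             (\<exists>K \<in> chambers (localization A F). C \<subseteq> K \<and> D \<subseteq> K))"

section \<open>The Salvetti complex\<close>

definition complex_vec :: "real ^ 'n \<Rightarrow> real ^ 'n \<Rightarrow> complex ^ 'n" where
  "complex_vec x y = (\<chi> i. Complex (x $ i) (y $ i))"

definition sal_vertex ::
  "(real ^ 'n) set set \<Rightarrow> ((real ^ 'n) set \<Rightarrow> real ^ 'n) \<Rightarrow>
   (real ^ 'n) set \<Rightarrow> (real ^ 'n) set \<Rightarrow> complex ^ 'n" where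
  "sal_vertex A w F C = complex_vec (w F) (w F - w (chamber_at A F C))"

definition sal_simplices ::
  "(real ^ 'n) set set \<Rightarrow> ((real ^ 'n) set \<Rightarrow> real ^ 'n) \<Rightarrow> (complex ^ 'n) set set" where
  "sal_simplices A w =
     {convex hull ((\<lambda>i. sal_vertex A w (F i) (C i)) ` {..k}) | (k::nat) F C.
        (\<forall>i\<le>k. F i \<in> faces A \<and> C i \<in> chambers A) \<and>
        (\<forall>i<k. face_le (F (Suc i)) (F i) \<and> F (Suc i) \<noteq> F i) \<and>
        (\<forall>i\<le>k. chamber_at A (F i) (C 0) = chamber_at A (F i) (C i))}"

definition Sal ::
  "(real ^ 'n) set set \<Rightarrow> ((real ^ 'n) set \<Rightarrow> real ^ 'n) \<Rightarrow> (complex ^ 'n) set" where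
  "Sal A w = \<Union> (sal_simplices A w)"

section \<open>Homotopy colimits of diagrams over finite posets\<close>

definition generated_equiv :: "'a set \<Rightarrow> ('a \<Rightarrow> 'a \<Rightarrow> bool) \<Rightarrow> ('a \<times> 'a) set" where
  "generated_equiv X g = {(x, y). x \<in> X \<and> y \<in> X \<and> equivclp g x y}"

lemma equiv_generated_equiv: "equiv X (generated_equiv X g)"
proof (rule equivI)
  show "generated_equiv X g \<subseteq> X \<times> X"
    by (auto simp: generated_equiv_def)
  show "refl_on X (generated_equiv X g)"
    by (auto simp: generated_equiv_def refl_on_def)
  show "sym (generated_equiv X g)"
    by (auto simp: generated_equiv_def sym_def intro: equivclp_sym)
  show "trans (generated_equiv X g)"
    by (auto simp: generated_equiv_def trans_def intro: equivclp_trans)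
qed

definition quotient_topology :: "'a topology \<Rightarrow> ('a \<times> 'a) set \<Rightarrow> 'a set topology" where
  "quotient_topology X r = topology (\<lambda>U. U \<subseteq> topspace X // r \<and> openin X (\<Union>U))"

lemma openin_quotient_topology:
  assumes "equiv (topspace X) r"
  shows "openin (quotient_topology X r) U \<longleftrightarrow> U \<subseteq> topspace X // r \<and> openin X (\<Union>U)"
proof -
  have Int: "\<Union>(U \<inter> V) = \<Union>U \<inter> \<Union>V" if "U \<subseteq> topspace X // r" "V \<subseteq> topspace X // r" for U V
    using that quotient_disj[OF assms] by blast
  have "istopology (\<lambda>U. U \<subseteq> topspace X // r \<and> openin X (\<Union>U))"
    unfolding istopology_def
  proof (intro conjI allI impI; (elim conjE)?)
    fix S T assume "S \<subseteq> topspace X // r" "T \<subseteq> topspace X // r" "openin X (\<Union>S)" "openin X (\<Union>T)"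
    then show "openin X (\<Union>(S \<inter> T))" by (simp add: Int openin_Int)
  next
    fix K assume K: "\<forall>S\<in>K. S \<subseteq> topspace X // r \<and> openin X (\<Union>S)"
    have "\<Union>(\<Union>K) = (\<Union>S\<in>K. \<Union>S)" by blast
    with K show "openin X (\<Union>(\<Union>K))" by auto
  qed auto
  then show ?thesis
    by (simp add: quotient_topology_def)
qed

text \<open>The points of the order complex of \<open>P\<close> are given by their barycentric coordinates. For finite
  \<open>P\<close>, the only case used here, the topology of pointwise convergence is the usual topology of
  the geometric realization.\<close>

definition order_complex :: "'p set \<Rightarrow> ('p \<Rightarrow> 'p \<Rightarrow> bool) \<Rightarrow> ('p \<Rightarrow> real) set" where
  "order_complex P le =
     {t. (\<forall>p. 0 \<le> t p) \<and> finite {p. t p \<noteq> 0} \<and> {p. t p \<noteq> 0} \<subseteq> P \<and>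
         Complete_Partial_Order.chain le {p. t p \<noteq> 0} \<and> (\<Sum>p | t p \<noteq> 0. t p) = 1}"

text \<open>A diagram over the poset \<open>(P, le)\<close> has spaces \<open>D p\<close> and maps \<open>f p q\<close> from \<open>D p\<close> to \<open>D q\<close>
  whenever \<open>q\<close> is strictly below \<open>p\<close>.\<close>

definition hocolim ::
  "'p set \<Rightarrow> ('p \<Rightarrow> 'p \<Rightarrow> bool) \<Rightarrow> ('p \<Rightarrow> 'a topology) \<Rightarrow> ('p \<Rightarrow> 'p \<Rightarrow> 'a \<Rightarrow> 'a) \<Rightarrow>
   ('p \<times> 'a \<times> ('p \<Rightarrow> real)) set topology" where
  "hocolim P le D f =
     (let X = sum_topology
                (\<lambda>p. prod_topology (D p) (top_of_set (order_complex {q \<in> P. le q p} le))) P;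
          glue = (\<lambda>u v. \<exists>p\<in>P. \<exists>q\<in>P. le q p \<and> q \<noteq> p \<and>
                    (\<exists>x \<in> topspace (D p). \<exists>t \<in> order_complex {r \<in> P. le r q} le.
                       u = (p, x, t) \<and> v = (q, f p q x, t)))
      in quotient_topology X (generated_equiv (topspace X) glue))"

section \<open>The two diagrams\<close>

definition hocolim_Did :: "(real ^ 'n) set set \<Rightarrow>
    ((real ^ 'n) set \<times> (real ^ 'n) set \<times> ((real ^ 'n) set \<Rightarrow> real)) set topology" where
  "hocolim_Did A =
     hocolim (faces A) face_le
       (\<lambda>F. discrete_topology {C \<in> chambers A. face_le C F})
       (\<lambda>F1 F2 C. chamber_at A F2 C)"

definition containing_face ::
  "(real ^ 'n) set set \<Rightarrow> (real ^ 'n) set \<Rightarrow> (real ^ 'n) set" where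
  "containing_face B G = (THE G'. G' \<in> faces B \<and> G \<subseteq> G')"

text \<open>The inverse of the isomorphism from the faces of \<open>A\<close> below \<open>F\<close> to the faces of the localization
  at \<open>F\<close>.\<close>

definition local_face ::
  "(real ^ 'n) set set \<Rightarrow> (real ^ 'n) set \<Rightarrow> (real ^ 'n) set \<Rightarrow> (real ^ 'n) set" where
  "local_face A F =
     the_inv_into {G \<in> faces A. face_le G F} (containing_face (localization A F))"

text \<open>The identification of the two face posets makes the chosen points \<open>w G\<close>, for \<open>G\<close> below
  \<open>F\<close>, a choice of points for the localization at \<open>F\<close>. With this choice the Salvetti complex of the
  localization is, as a subset of complex space, the subcomplex of \<open>Sal A w\<close> spanned by the vertices
  \<open>w(G, C)\<close> with \<open>C \<le> G \<le> F\<close>, and the natural maps are inclusions of subsets.\<close>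

definition E_space ::
  "(real ^ 'n) set set \<Rightarrow> ((real ^ 'n) set \<Rightarrow> real ^ 'n) \<Rightarrow> (real ^ 'n) set \<Rightarrow> (complex ^ 'n) topology"
  where
  "E_space A w F = top_of_set (Sal (localization A F) (w \<circ> local_face A F))"

text \<open>The index poset is the opposite of the face poset.\<close>

definition hocolim_E :: "(real ^ 'n) set set \<Rightarrow> ((real ^ 'n) set \<Rightarrow> real ^ 'n) \<Rightarrow>
    ((real ^ 'n) set \<times> (complex ^ 'n) \<times> ((real ^ 'n) set \<Rightarrow> real)) set topology" where
  "hocolim_E A w = hocolim (faces A) (\<lambda>F G. face_le G F) (E_space A w) (\<lambda>F1 F2 z. z)"

end

theory Submission
  imports Defs
begin

text \<open>All spaces are compared with the realization of the finite poset of pairs \<open>(F, C)\<close> with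
  \<open>C \<le> F\<close>, whose chains are the simplices of the Salvetti complex.

  Sending \<open>x + iy\<close> to the face of \<open>x\<close> and the chamber of \<open>x - \<epsilon>y\<close> defines a continuous map from the
  complement to this poset, considered as a finite space, and the preimages of its principal lower
  sets are star-shaped about the points \<open>w(F, C)\<close>. A partition of unity with supports in chains
  yields a map from the complement to the realization, which is inverse to the Salvetti embedding:
  on the complement the homotopy is linear, and on the realization every self-map that moves
  supports upwards is homotopic to the identity. The same stratification shows that the embedding is
  injective.

  Both homotopy colimits are quotients of compact spaces, so it suffices to find continuous maps to
  Hausdorff spaces with the right fibres. The one of \<open>\<D>\<^sub>i\<^sub>d\<close> becomes the realization itself, while the
  one of \<open>\<E>\<close> becomes the space of pairs \<open>(t, s)\<close>, where \<open>s\<close> is a point of the order complex of the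
  faces and \<open>t\<close> lies in all subcomplexes indexed by the support of \<open>s\<close>; it is homotopy equivalent
  to the realization through the projection to \<open>t\<close>.\<close>

section \<open>Order complexes\<close>

text \<open>The sign in \<open>x - \<epsilon>y\<close> comes from the vertices:
  \<open>w(F, C)\<close> has imaginary part \<open>w(F) - w(C\<^sub>F)\<close>, which points away
  from the chamber. The pairs carry the order in which \<open>(F, C) \<le> (G, D)\<close> means
  \<open>F \<le> G\<close> and \<open>C = D\<^sub>F\<close>. The obstacle is comparability. A
  straight-line homotopy stays in a realization only if the two supports form a chain together. This
  fails for the self-maps that occur, and for the same reason the projection of the pairs
  \<open>(t, s)\<close> to \<open>t\<close> has no evident section. Laying out a point along its
  supporting chain and cutting it at half of its mass gives two points, every support element of the
  first being below or equal to every one of the second. The homotopies that are not linear pass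
  through these two halves. Injectivity of the embedding matters because the spaces of the larger
  diagram are subsets of complex space, while the comparison takes place in barycentric coordinates.
  It is not checked simplex by simplex: the stratum of a point reveals the least vertex of its
  support, and mass can be peeled off there.\<close>

lemma in_order_complex_iff:
  assumes "finite P"
  shows "t \<in> order_complex P le \<longleftrightarrow>
    (\<forall>p. 0 \<le> t p) \<and> (\<forall>p. t p \<noteq> 0 \<longrightarrow> p \<in> P) \<and>
    (\<forall>p q. t p \<noteq> 0 \<longrightarrow> t q \<noteq> 0 \<longrightarrow> le p q \<or> le q p) \<and> sum t P = 1"
proof (cases "{p. t p \<noteq> 0} \<subseteq> P")
  case True
  then have "finite {p. t p \<noteq> 0}" "(\<Sum>p | t p \<noteq> 0. t p) = sum t P"
    using assms by (auto intro: finite_subset sum.mono_neutral_left)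
  then show ?thesis
    using True by (auto simp: order_complex_def Complete_Partial_Order.chain_def)
qed (auto simp: order_complex_def)

lemma order_complexD:
  assumes "t \<in> order_complex P le"
  shows "0 \<le> t p" "t p \<noteq> 0 \<Longrightarrow> p \<in> P" "t p \<noteq> 0 \<Longrightarrow> t q \<noteq> 0 \<Longrightarrow> le p q \<or> le q p"
  using assms by (auto simp: order_complex_def Complete_Partial_Order.chain_def)

lemma order_complex_sum:
  "t \<in> order_complex P le \<Longrightarrow> finite P \<Longrightarrow> sum t P = 1"
  by (simp add: in_order_complex_iff)

lemma order_complex_nonzero:
  assumes "t \<in> order_complex P le"
  obtains p where "p \<in> P" "t p \<noteq> 0"
proof -
  have "(\<Sum>p | t p \<noteq> 0. t p) \<noteq> 0"
    using assms by (auto simp: order_complex_def)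
  then obtain p where "t p \<noteq> 0"
    by (metis (mono_tags) sum.not_neutral_contains_not_neutral)
  then show thesis using that order_complexD(2)[OF assms] by blast
qed

lemma order_complex_mono: "P \<subseteq> P' \<Longrightarrow> order_complex P le \<subseteq> order_complex P' le"
  by (auto simp: order_complex_def)

lemma order_complex_restrict:
  assumes "t \<in> order_complex P le" "\<And>p. t p \<noteq> 0 \<Longrightarrow> p \<in> P'"
  shows "t \<in> order_complex P' le"
  using assms by (auto simp: order_complex_def)

lemma order_complex_cong:
  assumes "\<And>p q. p \<in> P \<Longrightarrow> q \<in> P \<Longrightarrow> le p q \<longleftrightarrow> le' p q"
  shows "order_complex P le = order_complex P le'"
  using assms unfolding order_complex_def Complete_Partial_Order.chain_def by blast

lemma order_complex_dual: "order_complex P (\<lambda>p q. le q p) = order_complex P le"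
  unfolding order_complex_def Complete_Partial_Order.chain_def by blast

lemma finite_chain_least:
  assumes "finite S" "S \<noteq> {}" "\<And>p q. p \<in> S \<Longrightarrow> q \<in> S \<Longrightarrow> le p q \<or> le q p"
    and trans: "\<And>p q r. p \<in> S \<Longrightarrow> q \<in> S \<Longrightarrow> r \<in> S \<Longrightarrow> le p q \<Longrightarrow> le q r \<Longrightarrow> le p r"
  shows "\<exists>m\<in>S. \<forall>p\<in>S. le m p"
  using assms
proof (induction S rule: finite_ne_induct)
  case (insert x S)
  have "\<exists>m\<in>S. \<forall>p\<in>S. le m p"
  proof (rule insert.IH)
    show "le p q \<or> le q p" if "p \<in> S" "q \<in> S" for p q
      using that by (intro insert.prems(1)) simp_all
    show "le p r" if "p \<in> S" "q \<in> S" "r \<in> S" "le p q" "le q r" for p q r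
      using that by (intro insert.prems(2)[of p q r]) simp_all
  qed
  then obtain m where m: "m \<in> S" "\<forall>p\<in>S. le m p" by blast
  show ?case
  proof (cases "le m x")
    case True
    moreover have "le x x" using insert.prems(1)[of x x] by simp
    ultimately show ?thesis using m by blast
  next
    case False
    then have "le x m" using insert.prems(1)[of x m] m by simp
    then have "le x p" if "p \<in> S" for p
      using that m insert.prems(2)[of x m p] by simp
    moreover have "le x x" using insert.prems(1)[of x x] by simp
    ultimately show ?thesis by blast
  qed
next
  case (singleton x)
  show ?case using singleton.prems(1)[of x x] by simp
qed

lemma order_complex_least:
  assumes "t \<in> order_complex P le"
    and "\<And>p q r. p \<in> P \<Longrightarrow> q \<in> P \<Longrightarrow> r \<in> P \<Longrightarrow> le p q \<Longrightarrow> le q r \<Longrightarrow> le p r"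
  obtains m where "m \<in> P" "t m \<noteq> 0" "\<And>p. t p \<noteq> 0 \<Longrightarrow> le m p"
proof -
  have fin: "finite {p. t p \<noteq> 0}"
    using assms(1) unfolding order_complex_def by blast
  obtain p where "p \<in> P" "t p \<noteq> 0"
    by (rule order_complex_nonzero[OF assms(1)])
  then have ne: "{p. t p \<noteq> 0} \<noteq> {}" by blast
  have chain: "le p q \<or> le q p" if "t p \<noteq> 0" "t q \<noteq> 0" for p q
    by (rule order_complexD(3)[OF assms(1) that])
  have trans: "le p r" if "t p \<noteq> 0" "t q \<noteq> 0" "t r \<noteq> 0" "le p q" "le q r" for p q r
    using assms(2)[OF _ _ _ that(4,5)] that(1-3) order_complexD(2)[OF assms(1)] by metis
  have "\<exists>m\<in>{p. t p \<noteq> 0}. \<forall>p\<in>{p. t p \<noteq> 0}. le m p"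
    by (rule finite_chain_least[OF fin ne]) (use chain trans in blast)+
  then obtain m where m: "t m \<noteq> 0" "\<And>p. t p \<noteq> 0 \<Longrightarrow> le m p" by blast
  show thesis
    using order_complexD(2)[OF assms(1) m(1)] m by (rule that)
qed

lemma Hausdorff_top_of_set_fun: "Hausdorff_space (top_of_set (S :: ('p \<Rightarrow> real) set))"
proof (rule Hausdorff_space_subtopology)
  show "Hausdorff_space (euclidean :: ('p \<Rightarrow> real) topology)"
    by (simp add: Hausdorff_space_product_topology flip: euclidean_product_topology)
qed

text \<open>By Tychonoff the functions with values in the unit interval and zero off
  \<open>P\<close> form a compact set. The chain condition is closed because it says that
  \<open>t p * t q = 0\<close> for every incomparable pair.\<close>

lemma compact_order_complex:
  assumes "finite P"
  shows "compact (order_complex P le)"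
proof -
  let ?K = "PiE UNIV (\<lambda>p. if p \<in> P then {0..1} else {0 :: real})"
  have "compactin (product_topology (\<lambda>_. euclidean) UNIV) ?K"
    by (subst compactin_PiE) auto
  then have K: "compact ?K"
    by (simp add: euclidean_product_topology)
  define C where "C = {t. sum t P = 1} \<inter> (\<Inter>p. {t. 0 \<le> t p}) \<inter>
    (\<Inter>(p, q) \<in> {(p, q). \<not> le p q \<and> \<not> le q p}. {t :: 'a \<Rightarrow> real. t p * t q = 0})"
  have "closed {t :: 'a \<Rightarrow> real. 0 \<le> t p}" for p
    by (intro closed_Collect_le continuous_on_const continuous_on_product_coordinates)
  moreover have "closed {t :: 'a \<Rightarrow> real. t p * t q = 0}" for p q
    by (intro closed_Collect_eq continuous_on_mult continuous_on_const continuous_on_product_coordinates)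
  moreover have "closed {t :: 'a \<Rightarrow> real. sum t P = 1}"
    by (intro closed_Collect_eq continuous_on_sum continuous_on_const continuous_on_product_coordinates)
  ultimately have "closed C"
    unfolding C_def by (intro closed_Int closed_INT ballI) (simp_all add: case_prod_beta)
  have C_iff: "t \<in> C \<longleftrightarrow> sum t P = 1 \<and> (\<forall>p. 0 \<le> t p) \<and>
      (\<forall>p q. t p \<noteq> 0 \<longrightarrow> t q \<noteq> 0 \<longrightarrow> le p q \<or> le q p)" for t
    unfolding C_def by fastforce
  have K_iff: "t \<in> ?K \<longleftrightarrow> (\<forall>p. t p \<in> (if p \<in> P then {0..1} else {0}))" for t
    by (simp add: PiE_iff)
  have "t p \<le> 1" if "p \<in> P" "sum t P = 1" "\<forall>p. 0 \<le> t p" for p and t :: "'a \<Rightarrow> real"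
    using member_le_sum[of p P t] that assms by simp
  then have "t \<in> order_complex P le \<longleftrightarrow> t \<in> ?K \<and> t \<in> C" for t
    unfolding in_order_complex_iff[OF assms] C_iff K_iff
    by (smt (verit) atLeastAtMost_iff singletonD singletonI)
  then have "order_complex P le = ?K \<inter> C" by blast
  with K \<open>closed C\<close> show ?thesis by (metis compact_Int_closed)
qed

section \<open>Rescaling of coordinates and straight-line homotopies\<close>

definition normalize_on :: "'p set \<Rightarrow> ('p \<Rightarrow> real) \<Rightarrow> 'p \<Rightarrow> real" where
  "normalize_on P f = (\<lambda>p. f p / sum f P)"

lemma sum_pos_support:
  fixes f :: "'p \<Rightarrow> real"
  assumes "finite P" "\<And>p. 0 \<le> f p" "p \<in> P" "f p \<noteq> 0"
  shows "0 < sum f P"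
  using assms by (intro sum_pos2[of P p]) (auto simp: less_le)

lemma normalize_on_in_order_complex:
  assumes "finite P" "\<And>p. 0 \<le> f p" "p \<in> P" "f p \<noteq> 0" "\<And>p. f p \<noteq> 0 \<Longrightarrow> p \<in> P"
    "\<And>p q. f p \<noteq> 0 \<Longrightarrow> f q \<noteq> 0 \<Longrightarrow> le p q \<or> le q p"
  shows "normalize_on P f \<in> order_complex P le"
proof -
  have pos: "0 < sum f P" using assms(1-4) by (rule sum_pos_support)
  have "sum (normalize_on P f) P = 1"
    using pos by (simp add: normalize_on_def flip: sum_divide_distrib)
  moreover have "0 \<le> normalize_on P f p" for p
    using pos assms by (simp add: normalize_on_def)
  moreover have nz: "f q \<noteq> 0" if "normalize_on P f q \<noteq> 0" for q
    using that by (auto simp: normalize_on_def)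
  ultimately show ?thesis
    unfolding in_order_complex_iff[OF assms(1)] using assms(5)[OF nz] assms(6)[OF nz nz] by blast
qed

lemma continuous_on_normalize_on:
  fixes f :: "'a::topological_space \<Rightarrow> 'p \<Rightarrow> real"
  assumes "\<And>p. continuous_on S (\<lambda>x. f x p)" "\<And>x. x \<in> S \<Longrightarrow> 0 < sum (f x) P"
  shows "continuous_on S (\<lambda>x. normalize_on P (f x))"
  unfolding normalize_on_def
  by (intro continuous_on_coordinatewise_then_product continuous_on_divide continuous_on_sum assms ballI)
    (use assms(2) in force)

definition mix :: "real \<Rightarrow> ('p \<Rightarrow> real) \<Rightarrow> ('p \<Rightarrow> real) \<Rightarrow> 'p \<Rightarrow> real" where
  "mix s f g = (\<lambda>p. (1 - s) * f p + s * g p)"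

lemma mix_0 [simp]: "mix 0 f g = f" and mix_1 [simp]: "mix 1 f g = g"
  by (simp_all add: mix_def)

lemma mix_nonzero: "mix s f g p \<noteq> 0 \<Longrightarrow> f p \<noteq> 0 \<or> g p \<noteq> 0"
  by (auto simp: mix_def)

text \<open>The last assumption makes the union of the two supporting chains a chain, so the segment
  from \<open>f\<close> to \<open>g\<close> stays in a single simplex.\<close>

lemma mix_in_order_complex:
  assumes "finite P" "f \<in> order_complex P le" "g \<in> order_complex P le" "s \<in> {0..1}"
    and "\<And>p q. f p \<noteq> 0 \<Longrightarrow> g q \<noteq> 0 \<Longrightarrow> le p q \<or> le q p"
  shows "mix s f g \<in> order_complex P le"
  unfolding in_order_complex_iff[OF assms(1)]
proof (intro conjI allI impI)
  show "0 \<le> mix s f g p" for p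
    using assms(4) order_complexD(1)[OF assms(2), of p] order_complexD(1)[OF assms(3), of p]
    by (simp add: mix_def)
  show "p \<in> P" if "mix s f g p \<noteq> 0" for p
    using mix_nonzero[OF that] order_complexD(2)[OF assms(2)] order_complexD(2)[OF assms(3)] by blast
  show "le p q \<or> le q p" if "mix s f g p \<noteq> 0" "mix s f g q \<noteq> 0" for p q
    using mix_nonzero[OF that(1)] mix_nonzero[OF that(2)] assms(5)
      order_complexD(3)[OF assms(2)] order_complexD(3)[OF assms(3)] by blast
  have "sum (mix s f g) P = (1 - s) * sum f P + s * sum g P"
    by (simp add: mix_def sum.distrib sum_distrib_left)
  then show "sum (mix s f g) P = 1"
    using order_complex_sum[OF assms(2,1)] order_complex_sum[OF assms(3,1)] by simp
qed

lemma continuous_on_mix: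
  assumes "continuous_on S a" "continuous_on S f" "continuous_on S g"
  shows "continuous_on S (\<lambda>x. mix (a x) (f x) (g x))"
  unfolding mix_def
  by (intro continuous_on_coordinatewise_then_product continuous_on_add continuous_on_mult
      continuous_on_diff continuous_on_const assms(1)
      continuous_on_product_then_coordinatewise[OF assms(2)]
      continuous_on_product_then_coordinatewise[OF assms(3)])

lemma homotopic_canonI:
  fixes h :: "real \<times> 'a::topological_space \<Rightarrow> 'b::topological_space"
  assumes "continuous_on ({0..1} \<times> S) h" "\<And>s x. s \<in> {0..1} \<Longrightarrow> x \<in> S \<Longrightarrow> h (s, x) \<in> T"
    "\<And>x. x \<in> S \<Longrightarrow> h (0, x) = f x" "\<And>x. x \<in> S \<Longrightarrow> h (1, x) = g x"
  shows "homotopic_with_canon (\<lambda>_. True) S T f g"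
proof -
  have "\<exists>h. continuous_map (prod_topology (top_of_set {0..1::real}) (top_of_set S)) (top_of_set T) h \<and>
    (\<forall>x \<in> topspace (top_of_set S). h (0, x) = f x) \<and> (\<forall>x \<in> topspace (top_of_set S). h (1, x) = g x) \<and>
    (\<forall>t\<in>{0..1}. True)"
    by (rule exI[of _ h])
      (use assms in \<open>auto simp: prod_topology_subtopology_eu continuous_map_in_subtopology\<close>)
  then show ?thesis
    by (subst homotopic_with) simp_all
qed

lemma continuous_on_snd_compose: "continuous_on S f \<Longrightarrow> continuous_on ({0..1::real} \<times> S) (\<lambda>x. f (snd x))"
  by (rule continuous_on_compose2[where g = f]) (auto intro: continuous_intros)

lemma homotopic_mix:
  fixes f g :: "'a::topological_space \<Rightarrow> 'p \<Rightarrow> real"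
  assumes "continuous_on S f" "continuous_on S g"
    and "\<And>s x. s \<in> {0..1} \<Longrightarrow> x \<in> S \<Longrightarrow> mix s (f x) (g x) \<in> T"
  shows "homotopic_with_canon (\<lambda>_. True) S T f g"
proof (rule homotopic_canonI[where h = "\<lambda>x. mix (fst x) (f (snd x)) (g (snd x))"])
  show "continuous_on ({0..1} \<times> S) (\<lambda>x. mix (fst x) (f (snd x)) (g (snd x)))"
    using assms(1,2) by (intro continuous_on_mix continuous_on_snd_compose continuous_on_fst continuous_on_id)
qed (use assms(3) in simp_all)

section \<open>Self-maps of the realization of a finite poset\<close>

lemma continuous_on_coord: "continuous_on S (\<lambda>t :: 'p \<Rightarrow> real. t p)"
  by (rule continuous_on_product_coordinates[THEN continuous_on_subset]) simp

locale finite_poset =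
  fixes P :: "'p set" and le :: "'p \<Rightarrow> 'p \<Rightarrow> bool"
  assumes finite: "finite P"
    and refl: "p \<in> P \<Longrightarrow> le p p"
    and trans: "p \<in> P \<Longrightarrow> q \<in> P \<Longrightarrow> r \<in> P \<Longrightarrow> le p q \<Longrightarrow> le q r \<Longrightarrow> le p r"
    and antisym: "p \<in> P \<Longrightarrow> q \<in> P \<Longrightarrow> le p q \<Longrightarrow> le q p \<Longrightarrow> p = q"
begin

abbreviation realization :: "('p \<Rightarrow> real) set" ("\<Delta>") where
  "\<Delta> \<equiv> order_complex P le"

lemma dual: "finite_poset P (\<lambda>p q. le q p)"
  by standard (use finite refl trans antisym in blast)+

lemma least:
  assumes "t \<in> \<Delta>"
  obtains m where "m \<in> P" "t m \<noteq> 0" "\<And>p. t p \<noteq> 0 \<Longrightarrow> le m p"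
proof -
  have "\<exists>m\<in>P. t m \<noteq> 0 \<and> (\<forall>p. t p \<noteq> 0 \<longrightarrow> le m p)"
    by (rule order_complex_least[OF assms]) (use trans in blast)+
  then show thesis using that by blast
qed

lemma greatest:
  assumes "t \<in> \<Delta>"
  obtains m where "m \<in> P" "t m \<noteq> 0" "\<And>p. t p \<noteq> 0 \<Longrightarrow> le p m"
proof -
  interpret op: finite_poset P "\<lambda>p q. le q p" by (rule dual)
  show thesis using op.least[of t] assms that by (metis order_complex_dual)
qed

definition mass_below :: "('p \<Rightarrow> real) \<Rightarrow> 'p \<Rightarrow> real" where
  "mass_below t p = sum t {q \<in> P. le q p \<and> q \<noteq> p}"

text \<open>Laid out along its supporting chain, a point \<open>t\<close> cuts the unit interval into pieces
  \<open>[mass_below t p, mass_below t p + t p]\<close>. The two functions below keep the part of it that lies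
  to the left, respectively to the right, of \<open>1/2\<close>.\<close>

definition lower_half :: "('p \<Rightarrow> real) \<Rightarrow> 'p \<Rightarrow> real" where
  "lower_half t = normalize_on P (\<lambda>p. t p * max 0 (1/2 - mass_below t p))"

definition upper_half :: "('p \<Rightarrow> real) \<Rightarrow> 'p \<Rightarrow> real" where
  "upper_half t = normalize_on P (\<lambda>p. t p * max 0 (mass_below t p + t p - 1/2))"

text \<open>Nonnegative factors can only shrink the support, so the chain survives; the element
  \<open>p\<close> keeps the total mass positive, as rescaling requires.\<close>

lemma reweight_in_realization:
  assumes t: "t \<in> \<Delta>" and a: "\<And>p. 0 \<le> a p" "p \<in> P" "t p \<noteq> 0" "a p \<noteq> 0"
  shows "normalize_on P (\<lambda>p. t p * a p) \<in> \<Delta>"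
proof (rule normalize_on_in_order_complex[where p = p])
  show "le q r \<or> le r q" if "t q * a q \<noteq> 0" "t r * a r \<noteq> 0" for q r
    using that by (intro order_complexD(3)[OF t]) auto
  show "q \<in> P" if "t q * a q \<noteq> 0" for q
    using that by (intro order_complexD(2)[OF t]) auto
  show "0 \<le> t q * a q" for q
    using order_complexD(1)[OF t] a(1) by simp
qed (use a finite in simp_all)

lemma mass_below_least:
  assumes "t \<in> \<Delta>" "m \<in> P" "\<And>p. t p \<noteq> 0 \<Longrightarrow> le m p"
  shows "mass_below t m = 0"
  unfolding mass_below_def
proof (rule sum.neutral, safe)
  fix q assume "q \<in> P" "le q m" "q \<noteq> m"
  then show "t q = 0" using assms(2,3) antisym by blast
qed

lemma mass_below_greatest:
  assumes t: "t \<in> \<Delta>" and m: "m \<in> P" "\<And>p. t p \<noteq> 0 \<Longrightarrow> le p m"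
  shows "mass_below t m + t m = 1"
proof -
  have "sum t P = sum t (insert m {q \<in> P. le q m \<and> q \<noteq> m})"
    using m finite by (intro sum.mono_neutral_right) auto
  also have "\<dots> = t m + mass_below t m"
    using finite by (simp add: mass_below_def)
  finally show ?thesis using order_complex_sum[OF t finite] by simp
qed

lemma mass_below_less:
  assumes t: "t \<in> \<Delta>" and "p \<in> P" "q \<in> P" "le p q" "p \<noteq> q"
  shows "mass_below t p + t p \<le> mass_below t q"
proof -
  have "mass_below t p + t p = sum t (insert p {r \<in> P. le r p \<and> r \<noteq> p})"
    using finite by (simp add: mass_below_def)
  also have "\<dots> \<le> mass_below t q"
    unfolding mass_below_def
  proof (rule sum_mono2)
    show "insert p {r \<in> P. le r p \<and> r \<noteq> p} \<subseteq> {r \<in> P. le r q \<and> r \<noteq> q}"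
      using assms(2-5) trans antisym by blast
  qed (use finite order_complexD(1)[OF t] in auto)
  finally show ?thesis .
qed

text \<open>The least support element has no mass below it, so its coordinate is multiplied by 1/2
  and not all mass is lost.\<close>

lemma lower_half_in:
  assumes t: "t \<in> \<Delta>" shows "lower_half t \<in> \<Delta>"
proof -
  obtain m where m: "m \<in> P" "t m \<noteq> 0" "\<And>p. t p \<noteq> 0 \<Longrightarrow> le m p"
    using least[OF t] by blast
  then show ?thesis
    using reweight_in_realization[OF t, where p = m] mass_below_least[OF t m(1,3)]
    by (simp add: lower_half_def)
qed

text \<open>Dually, the piece of the greatest support element ends at 1, which leaves it the factor
  1/2.\<close>

lemma upper_half_in:
  assumes t: "t \<in> \<Delta>" shows "upper_half t \<in> \<Delta>"
proof -
  obtain m where m: "m \<in> P" "t m \<noteq> 0" "\<And>p. t p \<noteq> 0 \<Longrightarrow> le p m"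
    using greatest[OF t] by blast
  then show ?thesis
    using reweight_in_realization[OF t, where p = m] mass_below_greatest[OF t m(1,3)]
    by (simp add: upper_half_def)
qed

lemma lower_half_nonzero: "lower_half t p \<noteq> 0 \<Longrightarrow> t p \<noteq> 0 \<and> mass_below t p < 1/2"
  by (auto simp: lower_half_def normalize_on_def max_def split: if_splits)

lemma upper_half_nonzero: "upper_half t p \<noteq> 0 \<Longrightarrow> t p \<noteq> 0 \<and> 1/2 < mass_below t p + t p"
  by (auto simp: upper_half_def normalize_on_def max_def split: if_splits)

text \<open>If \<open>q\<close> were strictly below \<open>p\<close>, its piece would end no later
  than \<open>mass_below t p\<close>, hence before 1/2, and nothing of it would be kept in the upper
  half.\<close>

lemma lower_half_le_upper_half:
  assumes t: "t \<in> \<Delta>" and p: "lower_half t p \<noteq> 0" and q: "upper_half t q \<noteq> 0"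
  shows "le p q"
proof (rule ccontr)
  assume "\<not> le p q"
  have P: "p \<in> P" "q \<in> P"
    using order_complexD(2)[OF t] lower_half_nonzero[OF p] upper_half_nonzero[OF q] by blast+
  have "le q p" "q \<noteq> p"
    using order_complexD(3)[OF t] lower_half_nonzero[OF p] upper_half_nonzero[OF q] \<open>\<not> le p q\<close>
      refl[OF P(1)] by blast+
  then show False
    using mass_below_less[OF t P(2,1)] lower_half_nonzero[OF p] upper_half_nonzero[OF q] by simp
qed

lemma continuous_on_mass_below: "continuous_on S (\<lambda>t. mass_below t p)"
  unfolding mass_below_def by (intro continuous_on_sum continuous_on_coord)

lemma continuous_on_reweight:
  assumes "\<And>p. continuous_on \<Delta> (\<lambda>t. a t p)" "\<And>t p. 0 \<le> a t p"
    "\<And>t. t \<in> \<Delta> \<Longrightarrow> \<exists>p. t p * a t p \<noteq> 0"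
  shows "continuous_on \<Delta> (\<lambda>t. normalize_on P (\<lambda>p. t p * a t p))"
proof (rule continuous_on_normalize_on)
  show "continuous_on \<Delta> (\<lambda>t. t p * a t p)" for p
    by (intro continuous_on_mult continuous_on_coord assms(1))
  show "0 < (\<Sum>p\<in>P. t p * a t p)" if t: "t \<in> \<Delta>" for t
  proof -
    obtain p where "t p * a t p \<noteq> 0" using assms(3)[OF t] by blast
    then show ?thesis
      using order_complexD(2)[OF t, of p] assms(2) order_complexD(1)[OF t]
      by (intro sum_pos_support[where p = p]) (auto simp: finite)
  qed
qed

lemma continuous_on_lower_half: "continuous_on \<Delta> lower_half"
  unfolding lower_half_def
proof (rule continuous_on_reweight)
  show "continuous_on \<Delta> (\<lambda>t. max 0 (1 / 2 - mass_below t p))" for p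
    by (intro continuous_intros continuous_on_mass_below)
  show "\<exists>p. t p * max 0 (1 / 2 - mass_below t p) \<noteq> 0" if "t \<in> \<Delta>" for t
    using order_complex_nonzero[OF lower_half_in[OF that]]
    unfolding lower_half_def normalize_on_def by (metis div_0)
qed simp

lemma continuous_on_upper_half: "continuous_on \<Delta> upper_half"
  unfolding upper_half_def
proof (rule continuous_on_reweight)
  show "continuous_on \<Delta> (\<lambda>t. max 0 (mass_below t p + t p - 1 / 2))" for p
    by (intro continuous_on_max continuous_on_diff continuous_on_add continuous_on_const
        continuous_on_mass_below continuous_on_coord)
  show "\<exists>p. t p * max 0 (mass_below t p + t p - 1 / 2) \<noteq> 0" if "t \<in> \<Delta>" for t
    using order_complex_nonzero[OF upper_half_in[OF that]]
    unfolding upper_half_def normalize_on_def by (metis div_0)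
qed simp

lemma homotopic_in_realization:
  fixes f g :: "'a::topological_space \<Rightarrow> 'p \<Rightarrow> real"
  assumes "continuous_on S f" "continuous_on S g" "f ` S \<subseteq> \<Delta>" "g ` S \<subseteq> \<Delta>"
    and "\<And>x p q. x \<in> S \<Longrightarrow> f x p \<noteq> 0 \<Longrightarrow> g x q \<noteq> 0 \<Longrightarrow> le p q \<or> le q p"
  shows "homotopic_with_canon (\<lambda>_. True) S \<Delta> f g"
proof (rule homotopic_mix[OF assms(1,2)])
  fix s :: real and x assume s: "s \<in> {0..1}" "x \<in> S"
  then have "f x \<in> \<Delta>" "g x \<in> \<Delta>" using assms(3,4) by blast+
  then show "mix s (f x) (g x) \<in> \<Delta>"
    using s(1) assms(5)[OF s(2)] by (rule mix_in_order_complex[OF finite])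
qed

text \<open>A self-map that moves supports upwards need not be linearly homotopic to the identity, since
  the supports of a point and of its image need not form a chain together. Passing through
  \<open>lower_half\<close> and \<open>upper_half\<close> repairs this.\<close>

lemma upward_map_homotopic_id:
  assumes cont: "continuous_on \<Delta> \<psi>" and img: "\<psi> ` \<Delta> \<subseteq> \<Delta>"
    and up: "\<And>t q. t \<in> \<Delta> \<Longrightarrow> \<psi> t q \<noteq> 0 \<Longrightarrow> \<exists>p. t p \<noteq> 0 \<and> le p q"
  shows "homotopic_with_canon (\<lambda>_. True) \<Delta> \<Delta> \<psi> id"
proof -
  have upper: "upper_half ` \<Delta> \<subseteq> \<Delta>" and lower: "lower_half ` \<Delta> \<subseteq> \<Delta>"
    using upper_half_in lower_half_in by blast+
  \<comment> \<open>The homotopy from \<open>t\<close> to \<open>upper_half t\<close> shrinks the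
    support, so it is linear; applying \<open>\<psi>\<close> to it afterwards needs no comparability
    of \<open>t\<close> with \<open>\<psi> t\<close>.\<close>
  have "homotopic_with_canon (\<lambda>_. True) \<Delta> \<Delta> id upper_half"
    by (intro homotopic_in_realization continuous_on_id' continuous_on_upper_half upper)
      (use upper_half_nonzero order_complexD(3) in fastforce)+
  then have "homotopic_with_canon (\<lambda>_. True) \<Delta> \<Delta> (\<psi> \<circ> id) (\<psi> \<circ> upper_half)"
    by (rule homotopic_with_compose_continuous_left) (use cont img in auto)
  then have 1: "homotopic_with_canon (\<lambda>_. True) \<Delta> \<Delta> \<psi> (\<psi> \<circ> upper_half)" by simp
  have 2: "homotopic_with_canon (\<lambda>_. True) \<Delta> \<Delta> lower_half (\<psi> \<circ> upper_half)"
  proof (intro homotopic_in_realization continuous_on_lower_half lower)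
    show "continuous_on \<Delta> (\<psi> \<circ> upper_half)"
      using continuous_on_upper_half continuous_on_subset[OF cont upper] by (rule continuous_on_compose)
    show "(\<psi> \<circ> upper_half) ` \<Delta> \<subseteq> \<Delta>" using upper img by auto
    \<comment> \<open>An element \<open>r\<close> of the support of \<open>upper_half t\<close> lies
      below \<open>q\<close>, and \<open>p\<close> lies below every such \<open>r\<close>. So the
      two supports form a chain, and this segment is linear as well.\<close>
    fix t p q assume t: "t \<in> \<Delta>" and p: "lower_half t p \<noteq> 0" and q: "(\<psi> \<circ> upper_half) t q \<noteq> 0"
    obtain r where r: "upper_half t r \<noteq> 0" "le r q"
      using up[OF upper_half_in[OF t]] q by auto
    have "p \<in> P" "r \<in> P" "q \<in> P"
      using order_complexD(2)[OF lower_half_in[OF t] p] order_complexD(2)[OF upper_half_in[OF t] r(1)]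
        order_complexD(2)[of "\<psi> (upper_half t)", OF _ q[unfolded o_apply]] upper img t by blast+
    then show "le p q \<or> le q p"
      using lower_half_le_upper_half[OF t p r(1)] r(2) trans by blast
  qed
  have 3: "homotopic_with_canon (\<lambda>_. True) \<Delta> \<Delta> lower_half id"
    by (intro homotopic_in_realization continuous_on_id' continuous_on_lower_half lower)
      (use lower_half_nonzero order_complexD(3) in fastforce)+
  show ?thesis
    by (rule homotopic_with_trans[OF homotopic_with_trans[OF 1 homotopic_with_symD[OF 2]] 3])
qed

end

section \<open>Spaces stratified by a finite poset\<close>

text \<open>Summing over the support, not over a named vertex set, lets one map serve a complex, its
  subcomplexes and the complexes of localizations.\<close>

definition weighted_sum :: "('p \<Rightarrow> 'v::real_vector) \<Rightarrow> ('p \<Rightarrow> real) \<Rightarrow> 'v" where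
  "weighted_sum w t = (\<Sum>p | t p \<noteq> 0. t p *\<^sub>R w p)"

lemma weighted_sum_eq:
  assumes "finite P" "\<And>p. t p \<noteq> 0 \<Longrightarrow> p \<in> P"
  shows "weighted_sum w t = (\<Sum>p\<in>P. t p *\<^sub>R w p)"
  unfolding weighted_sum_def using assms by (intro sum.mono_neutral_left) auto

lemma open_positivity_function:
  fixes V :: "'v::metric_space set"
  assumes "open V"
  obtains d :: "'v \<Rightarrow> real" where "continuous_on UNIV d" "\<And>z. 0 \<le> d z" "\<And>z. 0 < d z \<longleftrightarrow> z \<in> V"
proof (cases "V = UNIV")
  \<comment> \<open>The distance to the empty set is 0 by convention, so the whole space gets the
    constant 1 instead.\<close>
  case True
  then show thesis by (intro that[of "\<lambda>_. 1"]) auto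
next
  case False
  have "0 < infdist z (- V) \<longleftrightarrow> z \<in> V" for z
    using in_closed_iff_infdist_zero[of "- V" z] assms False infdist_nonneg[of z "- V"]
    by (auto simp: less_le)
  then show thesis
    by (intro that[of "\<lambda>z. infdist z (- V)"]) (auto intro: continuous_on_infdist continuous_on_id infdist_nonneg)
qed

text \<open>The sets \<open>V p\<close> are the preimages of the lower sets \<open>{..p}\<close> under a continuous map from \<open>M\<close>
  to the finite space \<open>P\<close>.\<close>

locale poset_model = finite_poset P le
  for P :: "'p set" and le +
  fixes M :: "'v::real_normed_vector set" and V :: "'p \<Rightarrow> 'v set" and w :: "'p \<Rightarrow> 'v"
  assumes open_V: "p \<in> P \<Longrightarrow> open (V p)"
    and stratum: "z \<in> M \<Longrightarrow> \<exists>m\<in>P. \<forall>p\<in>P. z \<in> V p \<longleftrightarrow> le m p"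
    and weighted_sum_in: "t \<in> order_complex P le \<Longrightarrow> weighted_sum w t \<in> M"
    and weighted_sum_V: "t \<in> order_complex P le \<Longrightarrow> p \<in> P \<Longrightarrow>
          weighted_sum w t \<in> V p \<longleftrightarrow> (\<exists>q. t q \<noteq> 0 \<and> le q p)"
    and segment_in: "z \<in> M \<Longrightarrow> t \<in> order_complex P le \<Longrightarrow> (\<And>p. t p \<noteq> 0 \<Longrightarrow> z \<in> V p) \<Longrightarrow>
          closed_segment z (weighted_sum w t) \<subseteq> M"
begin

section \<open>The affine map on the realization and its injectivity\<close>

lemma weighted_sum_realization: "t \<in> \<Delta> \<Longrightarrow> weighted_sum w t = (\<Sum>p\<in>P. t p *\<^sub>R w p)"
  using finite order_complexD(2) by (intro weighted_sum_eq)

lemma continuous_on_weighted_sum: "continuous_on \<Delta> (weighted_sum w)"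
proof (rule continuous_on_eq)
  show "continuous_on \<Delta> (\<lambda>t. \<Sum>p\<in>P. t p *\<^sub>R w p)"
    by (intro continuous_on_sum continuous_on_scaleR continuous_on_coord continuous_on_const)
qed (simp add: weighted_sum_realization)

text \<open>The image of \<open>t\<close> lies in \<open>V p\<close> exactly if \<open>p\<close> is
  above some support element of \<open>t\<close>. Testing the common image against
  \<open>V m\<close> and \<open>V m'\<close> gives \<open>m' \<le> m\<close> and
  \<open>m \<le> m'\<close>.\<close>

lemma weighted_sum_least_unique:
  assumes t: "t \<in> \<Delta>" and t': "t' \<in> \<Delta>" and eq: "weighted_sum w t = weighted_sum w t'"
    and m: "m \<in> P" "t m \<noteq> 0" "\<And>p. t p \<noteq> 0 \<Longrightarrow> le m p"
    and m': "m' \<in> P" "t' m' \<noteq> 0" "\<And>p. t' p \<noteq> 0 \<Longrightarrow> le m' p"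
  shows "m = m'"
proof -
  have "weighted_sum w t \<in> V m" "weighted_sum w t' \<in> V m'"
    using weighted_sum_V t t' m m' refl by blast+
  then obtain p p' where p: "t' p' \<noteq> 0" "le p' m" "t p \<noteq> 0" "le p m'"
    using eq weighted_sum_V[OF t m'(1)] weighted_sum_V[OF t' m(1)] by auto
  have "p \<in> P" "p' \<in> P" using order_complexD(2)[OF t p(3)] order_complexD(2)[OF t' p(1)] .
  then have "le m m'" "le m' m"
    using trans[of m p m'] trans[of m' p' m] m m' p by blast+
  then show ?thesis using antisym m(1) m'(1) by blast
qed

text \<open>The point \<open>t\<close> is the convex combination of the vertex \<open>m\<close> with
  weight \<open>c\<close> and of this point with weight \<open>1 - c\<close>. For
  \<open>c = t m\<close> it is the radial projection from \<open>m\<close> to the opposite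
  face.\<close>

definition remove_mass :: "'p \<Rightarrow> real \<Rightarrow> ('p \<Rightarrow> real) \<Rightarrow> 'p \<Rightarrow> real" where
  "remove_mass m c t = (\<lambda>p. (t p - (if p = m then c else 0)) / (1 - c))"

text \<open>The last equation involves \<open>t\<close> only through its image. Hence two points
  with the same image keep equal images when the same mass is removed from both at the same
  vertex.\<close>

lemma remove_mass:
  assumes t: "t \<in> \<Delta>" and c: "0 \<le> c" "c \<le> t m" "c < 1" and m: "m \<in> P"
  shows "remove_mass m c t \<in> \<Delta>" "{p. remove_mass m c t p \<noteq> 0} \<subseteq> {p. t p \<noteq> 0}"
    "weighted_sum w (remove_mass m c t) = (weighted_sum w t - c *\<^sub>R w m) /\<^sub>R (1 - c)"
proof -
  let ?r = "remove_mass m c t"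
  have sub: "t p \<noteq> 0" if "?r p \<noteq> 0" for p
    using that c by (auto simp: remove_mass_def split: if_splits)
  then show "{p. ?r p \<noteq> 0} \<subseteq> {p. t p \<noteq> 0}" by blast
  have "sum ?r P = (sum t P - c) / (1 - c)"
    using m finite by (simp add: remove_mass_def sum_subtractf flip: sum_divide_distrib)
  then have sum: "sum ?r P = 1" using order_complex_sum[OF t finite] c by simp
  have nonneg: "0 \<le> ?r p" for p
    using order_complexD(1)[OF t, of p] c by (auto simp: remove_mass_def)
  show r: "?r \<in> \<Delta>"
    unfolding in_order_complex_iff[OF finite]
    using sum nonneg order_complexD(2)[OF t sub] order_complexD(3)[OF t sub sub] by blast
  have "(\<Sum>p\<in>P. (if p = m then c else 0) *\<^sub>R w p) = c *\<^sub>R w m"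
    using m finite by (simp add: if_distrib[of "\<lambda>x. x *\<^sub>R _"] cong: if_cong)
  then have "(\<Sum>p\<in>P. (t p - (if p = m then c else 0)) *\<^sub>R w p) = weighted_sum w t - c *\<^sub>R w m"
    by (simp add: weighted_sum_realization[OF t] scaleR_diff_left sum_subtractf)
  moreover have "(\<Sum>p\<in>P. ?r p *\<^sub>R w p) =
      (\<Sum>p\<in>P. (t p - (if p = m then c else 0)) *\<^sub>R w p) /\<^sub>R (1 - c)"
    by (simp add: remove_mass_def scaleR_sum_right divide_inverse_commute)
  ultimately show "weighted_sum w ?r = (weighted_sum w t - c *\<^sub>R w m) /\<^sub>R (1 - c)"
    by (simp add: weighted_sum_realization[OF r])
qed

text \<open>Induction on the total size of both supports. Points with equal images share their least
  vertex \<open>m\<close>; removing the smaller of the two coordinates at \<open>m\<close> from both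
  keeps the images equal, shrinks one support strictly and enlarges neither.\<close>

lemma inj_on_weighted_sum: "inj_on (weighted_sum w) \<Delta>"
proof -
  have "t = t'" if "t \<in> \<Delta>" "t' \<in> \<Delta>" "weighted_sum w t = weighted_sum w t'" for t t'
    using that
  proof (induction "card {p. t p \<noteq> 0} + card {p. t' p \<noteq> 0}" arbitrary: t t' rule: less_induct)
    case less
    have *: "t = t'" if t: "t \<in> \<Delta>" and t': "t' \<in> \<Delta>" and eq: "weighted_sum w t = weighted_sum w t'"
      and m: "m \<in> P" "t m \<noteq> 0" and le: "t m \<le> t' m"
      and IH: "\<And>r r'. card {p. r p \<noteq> 0} + card {p. r' p \<noteq> 0} < card {p. t p \<noteq> 0} + card {p. t' p \<noteq> 0} \<Longrightarrow>
         r \<in> \<Delta> \<Longrightarrow> r' \<in> \<Delta> \<Longrightarrow> weighted_sum w r = weighted_sum w r' \<Longrightarrow> r = r'"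
      for t t' m
    proof (cases "t m < 1")
      case True
      define r where "r = remove_mass m (t m) t"
      define r' where "r' = remove_mass m (t m) t'"
      note r = remove_mass[OF t order_complexD(1)[OF t] order_refl True m(1), folded r_def]
      note r' = remove_mass[OF t' order_complexD(1)[OF t] le True m(1), folded r'_def]
      have fin: "finite {p. t p \<noteq> 0}" "finite {p. t' p \<noteq> 0}"
        using t t' by (simp_all add: order_complex_def)
      have "r m = 0" by (simp add: r_def remove_mass_def)
      then have "{p. r p \<noteq> 0} \<subset> {p. t p \<noteq> 0}" using r(2) m(2) by blast
      then have "card {p. r p \<noteq> 0} < card {p. t p \<noteq> 0}" by (rule psubset_card_mono[OF fin(1)])
      moreover have "card {p. r' p \<noteq> 0} \<le> card {p. t' p \<noteq> 0}" by (rule card_mono[OF fin(2) r'(2)])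
      ultimately have "r = r'" using IH[of r r'] r(1,3) r'(1,3) eq by simp
      then have "r p = r' p" for p by simp
      then show ?thesis using True by (auto simp: r_def r'_def remove_mass_def fun_eq_iff divide_simps split: if_splits)
    next
      case False
      \<comment> \<open>Here \<open>1 - t m\<close> cannot be divided by, but a coordinate of at
        least 1 leaves nothing for the others, so both points are the vertex
        \<open>m\<close>.\<close>
      have vertex: "s p = (if p = m then 1 else 0)" if s: "s \<in> \<Delta>" "1 \<le> s m" for s p
      proof (cases "p = m \<or> p \<notin> P")
        case True
        have "s m \<le> 1"
          using member_le_sum[of m P s] order_complex_sum[OF s(1) finite] order_complexD(1)[OF s(1)] m finite
          by simp
        then show ?thesis using True s(2) m(1) order_complexD(2)[OF s(1)] by auto
      next
        case False
        have "s m + s p = sum s {m, p}" using False by auto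
        also have "\<dots> \<le> sum s P"
          using False m finite order_complexD(1)[OF s(1)] by (intro sum_mono2) auto
        finally show ?thesis
          using False s(2) order_complex_sum[OF s(1) finite] order_complexD(1)[OF s(1), of p] by simp
      qed
      have "1 \<le> t m" "1 \<le> t' m" using False le by auto
      then show ?thesis using vertex[OF t] vertex[OF t'] by (intro ext) simp
    qed
    obtain m where m: "m \<in> P" "t m \<noteq> 0" "\<And>p. t p \<noteq> 0 \<Longrightarrow> le m p"
      using least[OF less.prems(1)] by blast
    obtain m' where m': "m' \<in> P" "t' m' \<noteq> 0" "\<And>p. t' p \<noteq> 0 \<Longrightarrow> le m' p"
      using least[OF less.prems(2)] by blast
    have "m = m'" by (rule weighted_sum_least_unique[OF less.prems m m'])
    show ?case
    proof (cases "t m \<le> t' m")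
      case True
      show ?thesis by (rule *[OF less.prems m(1,2) True less.hyps])
    next
      case False
      have "t' = t"
        by (rule *[OF less.prems(2,1) less.prems(3)[symmetric] m'(1,2)])
          (use False \<open>m = m'\<close> less.hyps[OF _ _ _ sym] in \<open>simp_all add: add.commute\<close>)
      then show ?thesis by simp
    qed
  qed
  then show ?thesis by (rule inj_onI)
qed

text \<open>Where the function positive on \<open>V p\<close> exceeds all those of the \<open>V q\<close> with \<open>q\<close> not above \<open>p\<close>,
  take the product of the differences. Two such regions can only meet for comparable elements.\<close>

lemma exists_map_to_realization:
  obtains \<rho> where "continuous_on M \<rho>" "\<rho> ` M \<subseteq> \<Delta>" "\<And>z p. z \<in> M \<Longrightarrow> \<rho> z p \<noteq> 0 \<Longrightarrow> z \<in> V p"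
proof -
  have "\<exists>d. continuous_on UNIV d \<and> (\<forall>z. 0 \<le> d z) \<and> (\<forall>z. (0 :: real) < d z \<longleftrightarrow> z \<in> V p)" if "p \<in> P" for p
    using open_positivity_function[OF open_V[OF that]] by metis
  then have "\<exists>d. \<forall>p\<in>P. continuous_on UNIV (d p) \<and> (\<forall>z. 0 \<le> d p z) \<and> (\<forall>z. (0 :: real) < d p z \<longleftrightarrow> z \<in> V p)"
    by (intro bchoice) blast
  then obtain d :: "'p \<Rightarrow> 'v \<Rightarrow> real"
    where d: "\<And>p. p \<in> P \<Longrightarrow> continuous_on UNIV (d p)" "\<And>p z. p \<in> P \<Longrightarrow> 0 \<le> d p z"
      "\<And>p z. p \<in> P \<Longrightarrow> 0 < d p z \<longleftrightarrow> z \<in> V p"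
    by blast
  define \<tau> where "\<tau> z p = (if p \<in> P then d p z * (\<Prod>q | q \<in> P \<and> \<not> le p q. max 0 (d p z - d q z)) else 0)" for z p
  have nonneg: "0 \<le> \<tau> z p" for z p
    by (auto simp: \<tau>_def d(2) intro!: mult_nonneg_nonneg prod_nonneg)
  have pos: "p \<in> P" "z \<in> V p" "\<And>q. q \<in> P \<Longrightarrow> \<not> le p q \<Longrightarrow> d q z < d p z" if "\<tau> z p \<noteq> 0" for z p
  proof -
    show p: "p \<in> P" using that by (auto simp: \<tau>_def split: if_splits)
    with that have "d p z \<noteq> 0" "(\<Prod>q | q \<in> P \<and> \<not> le p q. max 0 (d p z - d q z)) \<noteq> 0"
      by (auto simp: \<tau>_def)
    then show "z \<in> V p" "\<And>q. q \<in> P \<Longrightarrow> \<not> le p q \<Longrightarrow> d q z < d p z"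
      using d(2,3)[OF p, of z] finite by (auto simp: max_def split: if_splits)
  qed
  have chain: "le p q \<or> le q p" if "\<tau> z p \<noteq> 0" "\<tau> z q \<noteq> 0" for z p q
    using pos(3)[OF that(1) pos(1)[OF that(2)]] pos(3)[OF that(2) pos(1)[OF that(1)]] by force
  \<comment> \<open>At the least \<open>m\<close> with \<open>z\<close> in \<open>V m\<close>, each
    \<open>q\<close> not above \<open>m\<close> has \<open>d q z = 0\<close>, so every factor of the
    product equals \<open>d m z\<close>, which is positive.\<close>
  have nonzero: "\<exists>m\<in>P. \<tau> z m \<noteq> 0" if z: "z \<in> M" for z
  proof -
    obtain m where m: "m \<in> P" "\<And>p. p \<in> P \<Longrightarrow> z \<in> V p \<longleftrightarrow> le m p" using stratum[OF z] by blast
    have "0 < d m z" using m d(3) refl by blast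
    moreover have "d q z = 0" if "q \<in> P" "\<not> le m q" for q
      using d(2,3)[OF that(1), of z] m(2)[OF that(1)] that(2) by force
    ultimately have "\<tau> z m \<noteq> 0" using m(1) finite by (auto simp: \<tau>_def)
    with m(1) show ?thesis by blast
  qed
  show thesis
  proof (rule that)
    show "continuous_on M (\<lambda>z. normalize_on P (\<tau> z))"
    proof (rule continuous_on_normalize_on)
      show "continuous_on M (\<lambda>z. \<tau> z p)" for p
      proof (cases "p \<in> P")
        case True
        have "continuous_on M (d q)" if "q \<in> P" for q
          using d(1)[OF that] by (rule continuous_on_subset) simp
        with True have "continuous_on M (\<lambda>z. d p z * (\<Prod>q | q \<in> P \<and> \<not> le p q. max 0 (d p z - d q z)))"
          by (intro continuous_on_mult continuous_on_prod continuous_on_max continuous_on_diff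
              continuous_on_const) auto
        with True show ?thesis by (simp add: \<tau>_def)
      qed (simp add: \<tau>_def)
      show "0 < sum (\<tau> z) P" if "z \<in> M" for z
        using nonzero[OF that] nonneg sum_pos_support[OF finite] by blast
    qed
    show "(\<lambda>z. normalize_on P (\<tau> z)) ` M \<subseteq> \<Delta>"
    proof (rule image_subsetI)
      fix z assume "z \<in> M"
      then obtain m where "m \<in> P" "\<tau> z m \<noteq> 0" using nonzero by blast
      then show "normalize_on P (\<tau> z) \<in> \<Delta>"
        by (rule normalize_on_in_order_complex[OF finite nonneg _ _ pos(1) chain])
    qed
    show "z \<in> V p" if "z \<in> M" "normalize_on P (\<tau> z) p \<noteq> 0" for z p
      using that(2) pos(2) by (auto simp: normalize_on_def)
  qed
qed

lemma homotopy_eqv_realization: "M homotopy_eqv \<Delta>"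
proof -
  obtain \<rho> where \<rho>: "continuous_on M \<rho>" "\<rho> ` M \<subseteq> \<Delta>" "\<And>z p. z \<in> M \<Longrightarrow> \<rho> z p \<noteq> 0 \<Longrightarrow> z \<in> V p"
    using exists_map_to_realization by blast
  have img: "weighted_sum w ` \<Delta> \<subseteq> M" using weighted_sum_in by blast
  have cont: "continuous_on M (weighted_sum w \<circ> \<rho>)" "continuous_on \<Delta> (\<rho> \<circ> weighted_sum w)"
    by (rule continuous_on_compose \<rho>(1) continuous_on_weighted_sum
        continuous_on_subset[OF continuous_on_weighted_sum \<rho>(2)] continuous_on_subset[OF \<rho>(1) img])+
  \<comment> \<open>Every support element \<open>p\<close> of \<open>\<rho> z\<close> has
    \<open>z\<close> in \<open>V p\<close>, which is what \<open>segment_in\<close> asks of the pair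
    \<open>z\<close>, \<open>\<rho> z\<close>.\<close>
  have "homotopic_with_canon (\<lambda>_. True) M M id (weighted_sum w \<circ> \<rho>)"
    using cont(1) \<rho>(2,3) segment_in by (intro homotopic_with_linear) (auto simp: image_subset_iff)
  then have 1: "homotopic_with_canon (\<lambda>_. True) M M (weighted_sum w \<circ> \<rho>) id"
    by (rule homotopic_with_symD)
  have 2: "homotopic_with_canon (\<lambda>_. True) \<Delta> \<Delta> (\<rho> \<circ> weighted_sum w) id"
  proof (rule upward_map_homotopic_id[OF cont(2)])
    show "(\<rho> \<circ> weighted_sum w) ` \<Delta> \<subseteq> \<Delta>" using \<rho>(2) img by auto
    \<comment> \<open>If \<open>q\<close> is in the new support, the image of \<open>t\<close> lies
      in \<open>V q\<close>, and by \<open>weighted_sum_V\<close> some old support element lies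
      below \<open>q\<close>.\<close>
    fix t q assume t: "t \<in> \<Delta>" and q: "(\<rho> \<circ> weighted_sum w) t q \<noteq> 0"
    have "\<rho> (weighted_sum w t) \<in> \<Delta>" using \<rho>(2) weighted_sum_in[OF t] by blast
    then have "q \<in> P" using order_complexD(2)[of "\<rho> (weighted_sum w t)" P le q] q by simp
    then show "\<exists>p. t p \<noteq> 0 \<and> le p q"
      using \<rho>(3)[of "weighted_sum w t" q] q weighted_sum_in[OF t] weighted_sum_V[OF t] by simp
  qed
  show ?thesis
    unfolding homotopy_equivalent_space_def
    using 1 2 \<rho>(1,2) continuous_on_weighted_sum img
    by (intro exI[of _ \<rho>] exI[of _ "weighted_sum w"]) (auto simp: image_subset_iff_funcset)
qed

text \<open>A continuous bijection from a compact space to a Hausdorff space. The point is the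
  inverse: barycentric coordinates can be read off continuously from a point of the image.\<close>

lemma homeomorphic_map_weighted_sum:
  "homeomorphic_map (top_of_set \<Delta>) (top_of_set (weighted_sum w ` \<Delta>)) (weighted_sum w)"
proof (rule bijective_closed_imp_homeomorphic_map)
  show cont: "continuous_map (top_of_set \<Delta>) (top_of_set (weighted_sum w ` \<Delta>)) (weighted_sum w)"
    using continuous_on_weighted_sum by auto
  show "closed_map (top_of_set \<Delta>) (top_of_set (weighted_sum w ` \<Delta>)) (weighted_sum w)"
    using cont compact_order_complex[OF finite]
    by (intro continuous_imp_closed_map_gen)
      (auto simp: compact_space_subtopology Hausdorff_space_subtopology Hausdorff_imp_kc_space)
qed (use inj_on_weighted_sum in auto)

end

section \<open>Homotopy colimits\<close>

lemma topspace_quotient_topology: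
  assumes "equiv (topspace X) r"
  shows "topspace (quotient_topology X r) = topspace X // r"
proof (rule antisym)
  show "topspace (quotient_topology X r) \<subseteq> topspace X // r"
    using openin_topspace[of "quotient_topology X r"] unfolding openin_quotient_topology[OF assms] by blast
  have "openin (quotient_topology X r) (topspace X // r)"
    by (simp add: openin_quotient_topology[OF assms] Union_quotient[OF assms])
  then show "topspace X // r \<subseteq> topspace (quotient_topology X r)" by (rule openin_subset)
qed

text \<open>From a compact space to a Hausdorff space \<open>f\<close> is closed, hence a quotient
  map onto its image. So the image and the quotient carry the topology determined by the same
  partition into fibres.\<close>

lemma quotient_topology_homeomorphic:
  assumes X: "compact_space X" and T: "Hausdorff_space T" and f: "continuous_map X T f"
    and r: "equiv (topspace X) r"
    and fibre: "\<And>x y. x \<in> topspace X \<Longrightarrow> y \<in> topspace X \<Longrightarrow> (x, y) \<in> r \<longleftrightarrow> f x = f y"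
  shows "quotient_topology X r homeomorphic_space subtopology T (f ` topspace X)"
proof -
  let ?Y = "subtopology T (f ` topspace X)"
  have f': "continuous_map X ?Y f" using f by (simp add: continuous_map_in_subtopology)
  have topY: "topspace ?Y = f ` topspace X"
    using continuous_map_image_subset_topspace[OF f] by auto
  have "closed_map X ?Y f"
    using X f' T by (intro continuous_imp_closed_map_gen)
      (auto intro: Hausdorff_imp_kc_space Hausdorff_space_subtopology)
  then have q: "quotient_map X ?Y f"
    using f' topY by (simp add: continuous_closed_quotient_map)
  have quot_open: "openin X {x \<in> topspace X. f x \<in> W} \<longleftrightarrow> openin ?Y W" if "W \<subseteq> f ` topspace X" for W
    using q that unfolding quotient_map_def topY by blast
  \<comment> \<open>The fibre \<open>h y\<close> is an equivalence class, and \<open>g\<close>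
    evaluates \<open>f\<close> at an arbitrary element of a class; the two are mutually
    inverse.\<close>
  define h where "h y = {x \<in> topspace X. f x = y}" for y
  define g where "g c = f (SOME x. x \<in> c)" for c
  have cls: "r `` {x} = h (f x)" if "x \<in> topspace X" for x
  proof -
    have "(x, y) \<in> r \<longleftrightarrow> y \<in> topspace X \<and> f y = f x" for y
      using fibre[OF that, of y] equiv_type[OF r] by auto
    then show ?thesis unfolding h_def by blast
  qed
  have gh: "g (h (f x)) = f x" if "x \<in> topspace X" for x
    unfolding g_def h_def using someI[of "\<lambda>z. z \<in> topspace X \<and> f z = f x" x] that by simp
  have quot: "topspace X // r = h ` f ` topspace X"
    using cls by (auto simp: quotient_def)
  have "homeomorphic_maps (quotient_topology X r) ?Y g h"
    unfolding homeomorphic_maps_def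
  proof (intro conjI ballI)
    show "continuous_map (quotient_topology X r) ?Y g"
      unfolding continuous_map_def topspace_quotient_topology[OF r]
    proof (intro conjI allI impI)
      show "g \<in> topspace X // r \<rightarrow> topspace ?Y" using gh unfolding quot topY by auto
      fix U assume U: "openin ?Y U"
      have "\<Union> {c \<in> topspace X // r. g c \<in> U} = {x \<in> topspace X. f x \<in> U}"
        using gh unfolding quot by (force simp: h_def)
      moreover have "openin X {x \<in> topspace X. f x \<in> U}"
        by (rule openin_continuous_map_preimage[OF f' U])
      ultimately show "openin (quotient_topology X r) {c \<in> topspace X // r. g c \<in> U}"
        unfolding openin_quotient_topology[OF r] by auto
    qed
    show "continuous_map ?Y (quotient_topology X r) h"
      unfolding continuous_map_def topspace_quotient_topology[OF r] topY
    proof (intro conjI allI impI)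
      show "h \<in> f ` topspace X \<rightarrow> topspace X // r" unfolding quot by auto
      fix U assume U: "openin (quotient_topology X r) U"
      then have U': "U \<subseteq> h ` f ` topspace X" "openin X (\<Union>U)"
        unfolding openin_quotient_topology[OF r] quot by auto
      have "x \<in> \<Union>U \<longleftrightarrow> h (f x) \<in> U" if x: "x \<in> topspace X" for x
      proof
        assume "x \<in> \<Union>U"
        then obtain y where "h y \<in> U" "x \<in> h y" using U'(1) by blast
        then show "h (f x) \<in> U" by (simp add: h_def)
      next
        assume "h (f x) \<in> U"
        moreover have "x \<in> h (f x)" using x by (simp add: h_def)
        ultimately show "x \<in> \<Union>U" by blast
      qed
      then have *: "{x \<in> topspace X. f x \<in> {y \<in> f ` topspace X. h y \<in> U}} = \<Union>U"
        using openin_subset[OF U'(2)] by blast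
      show "openin ?Y {y \<in> f ` topspace X. h y \<in> U}"
        using quot_open[of "{y \<in> f ` topspace X. h y \<in> U}", unfolded *] U'(2) by blast
    qed
    show "h (g c) = c" if "c \<in> topspace (quotient_topology X r)" for c
      using that gh unfolding topspace_quotient_topology[OF r] quot by auto
    show "g (h y) = y" if "y \<in> topspace ?Y" for y
      using that gh unfolding topY by auto
  qed
  then show ?thesis by (auto simp: homeomorphic_space_def)
qed

section \<open>Homotopy colimits as images in Hausdorff spaces\<close>

lemma compact_space_sum_topology:
  assumes "finite I" "\<And>i. i \<in> I \<Longrightarrow> compact_space (X i)"
  shows "compact_space (sum_topology X I)"
proof -
  have "compactin (sum_topology X I) (Pair i ` topspace (X i))" if "i \<in> I" for i
  proof (rule image_compactin)
    show "compactin (X i) (topspace (X i))" using assms(2)[OF that] by (simp add: compact_space_def)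
    show "continuous_map (X i) (sum_topology X I) (Pair i)"
      using that by (rule continuous_map_component_injection)
  qed
  then have "compactin (sum_topology X I) (\<Union>i\<in>I. Pair i ` topspace (X i))"
    using assms(1) by (intro compactin_Union) auto
  moreover have "(\<Union>i\<in>I. Pair i ` topspace (X i)) = topspace (sum_topology X I)" by auto
  ultimately show ?thesis by (simp add: compact_space_def)
qed

lemma continuous_map_sum_topology:
  assumes "\<And>i. i \<in> I \<Longrightarrow> continuous_map (X i) T (\<lambda>x. f (i, x))"
  shows "continuous_map (sum_topology X I) T f"
  unfolding continuous_map_def
proof (intro conjI allI impI)
  show "f \<in> topspace (sum_topology X I) \<rightarrow> topspace T"
    using continuous_map_funspace[OF assms] by fastforce
  fix U assume "openin T U"
  then have "openin (X i) {x \<in> topspace (X i). f (i, x) \<in> U}" if "i \<in> I" for i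
    using openin_continuous_map_preimage[OF assms[OF that]] by blast
  then show "openin (sum_topology X I) {u \<in> topspace (sum_topology X I). f u \<in> U}"
    by (auto simp: openin_sum_topology)
qed

text \<open>By \<open>glue\<close> the map is constant on classes. By \<open>inj\<close>, two points
  with one image meet over some \<open>q\<close> below both indices, reached by at most one gluing
  step from each side, so they lie in one class. The case distinctions reflect that gluing relates
  distinct indices only.\<close>

lemma hocolim_homeomorphic:
  fixes \<Phi> :: "'p \<Rightarrow> 'a \<Rightarrow> ('p \<Rightarrow> real) \<Rightarrow> 'b"
  assumes P: "finite P" and D: "\<And>p. p \<in> P \<Longrightarrow> compact_space (D p)" and T: "Hausdorff_space T"
    and cont: "\<And>p. p \<in> P \<Longrightarrow> continuous_map
       (prod_topology (D p) (top_of_set (order_complex {q \<in> P. le q p} le))) T (\<lambda>(x, t). \<Phi> p x t)"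
    and glue: "\<And>p q x t. p \<in> P \<Longrightarrow> q \<in> P \<Longrightarrow> le q p \<Longrightarrow> q \<noteq> p \<Longrightarrow> x \<in> topspace (D p) \<Longrightarrow>
       t \<in> order_complex {r \<in> P. le r q} le \<Longrightarrow> \<Phi> p x t = \<Phi> q (f p q x) t"
    and inj: "\<And>p x t p' x' t'. p \<in> P \<Longrightarrow> x \<in> topspace (D p) \<Longrightarrow> t \<in> order_complex {r \<in> P. le r p} le \<Longrightarrow>
       p' \<in> P \<Longrightarrow> x' \<in> topspace (D p') \<Longrightarrow> t' \<in> order_complex {r \<in> P. le r p'} le \<Longrightarrow>
       \<Phi> p x t = \<Phi> p' x' t' \<Longrightarrow>
       t = t' \<and> (\<exists>q\<in>P. le q p \<and> le q p' \<and> t \<in> order_complex {r \<in> P. le r q} le \<and>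
         (if q = p then x else f p q x) = (if q = p' then x' else f p' q x'))"
  shows "hocolim P le D f homeomorphic_space
    subtopology T {\<Phi> p x t | p x t. p \<in> P \<and> x \<in> topspace (D p) \<and> t \<in> order_complex {r \<in> P. le r p} le}"
proof -
  define X where "X = sum_topology
    (\<lambda>p. prod_topology (D p) (top_of_set (order_complex {q \<in> P. le q p} le))) P"
  define g where "g = (\<lambda>u v. \<exists>p\<in>P. \<exists>q\<in>P. le q p \<and> q \<noteq> p \<and>
    (\<exists>x \<in> topspace (D p). \<exists>t \<in> order_complex {r \<in> P. le r q} le. u = (p, x, t) \<and> v = (q, f p q x, t)))"
  define F where "F = (\<lambda>(p, x, t). \<Phi> p x t)"
  have topX: "topspace X = {(p, x, t). p \<in> P \<and> x \<in> topspace (D p) \<and> t \<in> order_complex {r \<in> P. le r p} le}"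
    by (auto simp: X_def)
  have fibre: "equivclp g u v \<longleftrightarrow> F u = F v" if u: "u \<in> topspace X" and v: "v \<in> topspace X" for u v
  proof
    assume "equivclp g u v"
    then show "F u = F v"
    proof (induction rule: equivclp_induct)
      case (step y z)
      have "F y = F z" if "g y z" for y z
        using that unfolding g_def F_def by (auto intro: glue)
      with step show ?case by metis
    qed simp
  next
    assume eq: "F u = F v"
    obtain p x t where u': "u = (p, x, t)" "p \<in> P" "x \<in> topspace (D p)" "t \<in> order_complex {r \<in> P. le r p} le"
      using u unfolding topX by auto
    obtain p' x' t' where v': "v = (p', x', t')" "p' \<in> P" "x' \<in> topspace (D p')" "t' \<in> order_complex {r \<in> P. le r p'} le"
      using v unfolding topX by auto
    from inj[OF u'(2-4) v'(2-4)] eq obtain q where q: "t = t'" "q \<in> P" "le q p" "le q p'"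
      "t \<in> order_complex {r \<in> P. le r q} le" "(if q = p then x else f p q x) = (if q = p' then x' else f p' q x')"
      unfolding F_def u'(1) v'(1) by auto
    have reach: "equivclp g (p, x, t) (q, if q = p then x else f p q x, t)"
      if "p \<in> P" "x \<in> topspace (D p)" "le q p" for p x
    proof (cases "q = p")
      case False
      then have "g (p, x, t) (q, f p q x, t)" using that q(2,5) unfolding g_def by blast
      with False show ?thesis by auto
    qed simp
    show "equivclp g u v"
      unfolding u'(1) v'(1)
      using equivclp_trans[OF reach[OF u'(2,3) q(3)], OF equivclp_sym[OF reach[OF v'(2,3) q(4)], folded q(6)]]
      by (simp add: q(1))
  qed
  have "continuous_map X T F"
    unfolding X_def F_def using cont by (intro continuous_map_sum_topology) simp
  moreover have "compact_space X"
    unfolding X_def using P D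
    by (intro compact_space_sum_topology)
      (simp_all add: compact_space_prod_topology compact_space_subtopology compact_order_complex)
  ultimately have "quotient_topology X (generated_equiv (topspace X) g) homeomorphic_space
      subtopology T (F ` topspace X)"
    using T fibre by (intro quotient_topology_homeomorphic equiv_generated_equiv) (auto simp: generated_equiv_def)
  moreover have "F ` topspace X =
      {\<Phi> p x t | p x t. p \<in> P \<and> x \<in> topspace (D p) \<and> t \<in> order_complex {r \<in> P. le r p} le}"
    unfolding topX F_def by (force simp: image_iff)
  ultimately show ?thesis
    unfolding hocolim_def Let_def X_def[symmetric] g_def[symmetric] by simp
qed

text \<open>The simplicial map induced by a map of vertices, in barycentric coordinates.\<close>

definition push_forward :: "('q \<Rightarrow> 'p) \<Rightarrow> 'q set \<Rightarrow> ('q \<Rightarrow> real) \<Rightarrow> 'p \<Rightarrow> real" where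
  "push_forward \<pi> Q t = (\<lambda>p. sum t {q \<in> Q. \<pi> q = p})"

lemma push_forward_nonzero:
  assumes "push_forward \<pi> Q t p \<noteq> 0"
  obtains q where "q \<in> Q" "\<pi> q = p" "t q \<noteq> 0"
  using sum.not_neutral_contains_not_neutral[OF assms[unfolded push_forward_def]] by blast

lemma push_forward_in_order_complex:
  assumes "finite Q" "finite P" "t \<in> order_complex Q leQ" "\<pi> ` Q \<subseteq> P"
    and mono: "\<And>q q'. q \<in> Q \<Longrightarrow> q' \<in> Q \<Longrightarrow> leQ q q' \<Longrightarrow> leP (\<pi> q) (\<pi> q')"
  shows "push_forward \<pi> Q t \<in> order_complex P leP"
  unfolding in_order_complex_iff[OF assms(2)]
proof (intro conjI allI impI)
  show "0 \<le> push_forward \<pi> Q t p" for p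
    unfolding push_forward_def using order_complexD(1)[OF assms(3)] by (intro sum_nonneg) auto
  show "p \<in> P" if "push_forward \<pi> Q t p \<noteq> 0" for p
    using push_forward_nonzero[OF that] assms(4) by blast
  show "leP p p' \<or> leP p' p" if p: "push_forward \<pi> Q t p \<noteq> 0" and p': "push_forward \<pi> Q t p' \<noteq> 0" for p p'
  proof -
    obtain q where "q \<in> Q" "\<pi> q = p" "t q \<noteq> 0" by (rule push_forward_nonzero[OF p])
    moreover obtain q' where "q' \<in> Q" "\<pi> q' = p'" "t q' \<noteq> 0" by (rule push_forward_nonzero[OF p'])
    ultimately show ?thesis using order_complexD(3)[OF assms(3), of q q'] mono by blast
  qed
  have "sum (push_forward \<pi> Q t) P = sum t Q"
    unfolding push_forward_def by (rule sum.group[OF assms(1,2,4)])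
  then show "sum (push_forward \<pi> Q t) P = 1"
    using order_complex_sum[OF assms(3,1)] by simp
qed

lemma continuous_on_push_forward: "continuous_on S (push_forward \<pi> Q)"
  unfolding push_forward_def
  by (intro continuous_on_coordinatewise_then_product continuous_on_sum continuous_on_coord)

text \<open>The space on the left is the homotopy colimit of the covering of the realization of \<open>Q\<close> by the
  subcomplexes spanned by the \<open>q\<close> with \<open>\<pi> q\<close> below a given element of \<open>P\<close>.\<close>

lemma cover_hocolim_homotopy_eqv:
  assumes Q: "finite_poset Q leQ" and P: "finite P" and \<pi>: "\<pi> ` Q \<subseteq> P"
    and mono: "\<And>q q'. q \<in> Q \<Longrightarrow> q' \<in> Q \<Longrightarrow> leQ q q' \<Longrightarrow> leP (\<pi> q) (\<pi> q')"
    and trans: "\<And>p q r. p \<in> P \<Longrightarrow> q \<in> P \<Longrightarrow> r \<in> P \<Longrightarrow> leP p q \<Longrightarrow> leP q r \<Longrightarrow> leP p r"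
  shows "{(t, s). t \<in> order_complex Q leQ \<and> s \<in> order_complex P leP \<and>
      (\<forall>q p. t q \<noteq> 0 \<longrightarrow> s p \<noteq> 0 \<longrightarrow> leP (\<pi> q) p)} homotopy_eqv order_complex Q leQ"
    (is "?Y homotopy_eqv _")
proof -
  interpret finite_poset Q leQ by (rule Q)
  \<comment> \<open>The homotopy inverse will be \<open>t \<mapsto> (lower_half t, u t)\<close>.
    Pairing \<open>t\<close> with its own image under \<open>\<pi>\<close> fails, since the faces of
    later support elements need not lie below those of earlier ones; the cut puts the first support
    below the second.\<close>
  define u where "u t = push_forward \<pi> Q (upper_half t)" for t
  have u_in: "u t \<in> order_complex P leP" if "t \<in> realization" for t
    unfolding u_def by (rule push_forward_in_order_complex[OF finite P upper_half_in[OF that] \<pi>]) (rule mono)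
  have cont_u: "continuous_on realization u"
    unfolding u_def by (rule continuous_on_compose2[OF continuous_on_push_forward continuous_on_upper_half subset_UNIV])
  have u_le: "leP p p'" if Y: "(t, s) \<in> ?Y" and "u t p \<noteq> 0" "s p' \<noteq> 0" for t s p p'
  proof -
    obtain q where "\<pi> q = p" "upper_half t q \<noteq> 0"
      using push_forward_nonzero[OF \<open>u t p \<noteq> 0\<close>[unfolded u_def]] by blast
    then show ?thesis using Y \<open>s p' \<noteq> 0\<close> upper_half_nonzero[of t q] by auto
  qed
  have le_u: "leP (\<pi> q) p" if t: "t \<in> realization" and q: "lower_half t q \<noteq> 0" and "u t p \<noteq> 0" for t q p
  proof -
    obtain q' where q': "\<pi> q' = p" "upper_half t q' \<noteq> 0"
      using push_forward_nonzero[OF \<open>u t p \<noteq> 0\<close>[unfolded u_def]] by blast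
    have "q \<in> Q" "q' \<in> Q"
      using order_complexD(2)[OF lower_half_in[OF t] q] order_complexD(2)[OF upper_half_in[OF t] q'(2)] .
    then show ?thesis using mono[OF _ _ lower_half_le_upper_half[OF t q q'(2)]] q'(1) by blast
  qed
  have fst_Y: "fst ` ?Y \<subseteq> realization" by auto
  have g_Y: "(\<lambda>t. (lower_half t, u t)) ` realization \<subseteq> ?Y"
    using lower_half_in u_in le_u by auto
  have cont_g: "continuous_on realization (\<lambda>t. (lower_half t, u t))"
    by (intro continuous_on_Pair continuous_on_lower_half cont_u)
  have cont_fst: "continuous_on ?Y fst" by (rule continuous_on_fst[OF continuous_on_id])
  have cont_snd: "continuous_on ?Y snd" by (rule continuous_on_snd[OF continuous_on_id])
  have cont_lower: "continuous_on ?Y (\<lambda>y. lower_half (fst y))"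
    by (rule continuous_on_compose2[OF continuous_on_lower_half cont_fst fst_Y])
  have cont_upper: "continuous_on ?Y (\<lambda>y. u (fst y))"
    by (rule continuous_on_compose2[OF cont_u cont_fst fst_Y])
  have "homotopic_with_canon (\<lambda>_. True) realization realization lower_half id"
    using lower_half_in
    by (intro homotopic_in_realization continuous_on_id' continuous_on_lower_half)
      (use lower_half_nonzero order_complexD(3) in fastforce)+
  then have 1: "homotopic_with_canon (\<lambda>_. True) realization realization (fst \<circ> (\<lambda>t. (lower_half t, u t))) id"
    by (simp add: comp_def)
  \<comment> \<open>The second component moves while the first is still \<open>lower_half t\<close>,
    which lies below both \<open>u t\<close> and \<open>s\<close>. In the other order the pair
    \<open>(t, u t)\<close> would occur, which need not belong to the space.\<close>
  have "homotopic_with_canon (\<lambda>_. True) ?Y ?Y (\<lambda>y. (lower_half (fst y), u (fst y))) (\<lambda>y. (lower_half (fst y), snd y))"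
  proof (rule homotopic_canonI[where h = "\<lambda>x. (lower_half (fst (snd x)), mix (fst x) (u (fst (snd x))) (snd (snd x)))"])
    show "continuous_on ({0..1} \<times> ?Y) (\<lambda>x. (lower_half (fst (snd x)), mix (fst x) (u (fst (snd x))) (snd (snd x))))"
      by (intro continuous_on_Pair continuous_on_mix
          continuous_on_snd_compose[OF cont_lower] continuous_on_snd_compose[OF cont_upper]
          continuous_on_snd_compose[OF cont_snd] continuous_on_fst continuous_on_id)
    fix a :: real and y assume a: "a \<in> {0..1}" and y: "y \<in> ?Y"
    obtain t s where ts: "y = (t, s)" "t \<in> realization" "s \<in> order_complex P leP" "(t, s) \<in> ?Y"
      using y by auto
    have "mix a (u t) s \<in> order_complex P leP"
      using u_le[OF ts(4)] by (intro mix_in_order_complex[OF P u_in[OF ts(2)] ts(3) a]) blast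
    moreover have "leP (\<pi> q) p" if "lower_half t q \<noteq> 0" "mix a (u t) s p \<noteq> 0" for q p
      using mix_nonzero[OF that(2)] le_u[OF ts(2) that(1)] lower_half_nonzero[OF that(1)] ts(4) by auto
    ultimately show "(lower_half (fst (snd (a, y))), mix (fst (a, y)) (u (fst (snd (a, y)))) (snd (snd (a, y)))) \<in> ?Y"
      using lower_half_in[OF ts(2)] ts(1) by auto
  qed auto
  moreover have "homotopic_with_canon (\<lambda>_. True) ?Y ?Y (\<lambda>y. (lower_half (fst y), snd y)) id"
  proof (rule homotopic_canonI[where h = "\<lambda>x. (mix (fst x) (lower_half (fst (snd x))) (fst (snd x)), snd (snd x))"])
    show "continuous_on ({0..1} \<times> ?Y) (\<lambda>x. (mix (fst x) (lower_half (fst (snd x))) (fst (snd x)), snd (snd x)))"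
      by (intro continuous_on_Pair continuous_on_mix
          continuous_on_snd_compose[OF cont_lower] continuous_on_snd_compose[OF cont_fst]
          continuous_on_snd_compose[OF cont_snd] continuous_on_fst continuous_on_id)
    fix a :: real and y assume a: "a \<in> {0..1}" and y: "y \<in> ?Y"
    obtain t s where ts: "y = (t, s)" "t \<in> realization" "s \<in> order_complex P leP" "(t, s) \<in> ?Y"
      using y by auto
    have "mix a (lower_half t) t \<in> realization"
      using lower_half_nonzero order_complexD(3)[OF ts(2)]
      by (intro mix_in_order_complex[OF finite lower_half_in[OF ts(2)] ts(2) a]) blast
    moreover have "t q \<noteq> 0" if "mix a (lower_half t) t q \<noteq> 0" for q
      using mix_nonzero[OF that] lower_half_nonzero by blast
    ultimately show "(mix (fst (a, y)) (lower_half (fst (snd (a, y)))) (fst (snd (a, y))), snd (snd (a, y))) \<in> ?Y"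
      using ts by auto
  qed auto
  ultimately have "homotopic_with_canon (\<lambda>_. True) ?Y ?Y (\<lambda>y. (lower_half (fst y), u (fst y))) id"
    by (rule homotopic_with_trans)
  then have 2: "homotopic_with_canon (\<lambda>_. True) ?Y ?Y ((\<lambda>t. (lower_half t, u t)) \<circ> fst) id"
    by (simp add: comp_def)
  have "continuous_map (top_of_set ?Y) (top_of_set realization) fst"
    using cont_fst fst_Y by (simp only: continuous_map_subtopology_eu image_subset_iff_funcset)
  moreover have "continuous_map (top_of_set realization) (top_of_set ?Y) (\<lambda>t. (lower_half t, u t))"
    using cont_g g_Y by (simp only: continuous_map_subtopology_eu image_subset_iff_funcset)
  ultimately show ?thesis
    unfolding homotopy_equivalent_space_def using 1 2 by blast
qed

section \<open>Faces and chambers\<close>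

definition normal_form :: "(real ^ 'n) set \<Rightarrow> (real ^ 'n) \<times> real" where
  "normal_form H = (SOME (a, b). a \<noteq> 0 \<and> H = {x. a \<bullet> x = b})"

definition level :: "(real ^ 'n) set \<Rightarrow> real ^ 'n \<Rightarrow> real" where
  "level H x = fst (normal_form H) \<bullet> x - snd (normal_form H)"

text \<open>The linear part of \<open>level H\<close>. At \<open>z = x + iy\<close> the complexified
  defining function has real part \<open>level H x\<close> and imaginary part
  \<open>slope H y\<close>.\<close>

definition slope :: "(real ^ 'n) set \<Rightarrow> real ^ 'n \<Rightarrow> real" where
  "slope H y = fst (normal_form H) \<bullet> y"

lemma level_add: "level H (x + y) = level H x + slope H y"
  by (simp add: level_def slope_def inner_add_right)

lemma slope_diff: "slope H (x - y) = level H x - level H y"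
  by (simp add: level_def slope_def inner_diff_right)

lemma slope_scale: "slope H (c *\<^sub>R y) = c * slope H y"
  by (simp add: slope_def)

lemma slope_minus: "slope H (- y) = - slope H y"
  by (simp add: slope_def)

lemma slope_add: "slope H (x + y) = slope H x + slope H y"
  by (simp add: slope_def inner_add_right)

lemma slope_sum: "slope H (\<Sum>p\<in>P. f p) = (\<Sum>p\<in>P. slope H (f p))"
  by (simp add: slope_def inner_sum_right)

lemma level_convex: "level H ((1 - s) *\<^sub>R x + s *\<^sub>R y) = (1 - s) * level H x + s * level H y"
  by (simp add: level_def inner_add_right algebra_simps)

lemma level_weighted_sum:
  assumes "sum t P = 1"
  shows "level H (\<Sum>p\<in>P. t p *\<^sub>R f p) = (\<Sum>p\<in>P. t p * level H (f p))"
proof -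
  have "(\<Sum>p\<in>P. t p * level H (f p)) = (\<Sum>p\<in>P. t p * (fst (normal_form H) \<bullet> f p)) - sum t P * snd (normal_form H)"
    by (simp add: level_def right_diff_distrib sum_subtractf sum_distrib_right)
  then show ?thesis using assms by (simp add: level_def inner_sum_right)
qed

lemma continuous_level: "continuous_on S (level H)"
  unfolding level_def by (intro continuous_intros)

lemma continuous_slope: "continuous_on S (slope H)"
  unfolding slope_def by (intro continuous_intros)

text \<open>If the second function had different signs at \<open>x\<close> and \<open>y\<close>, it
  would vanish between them, while the first keeps one strict sign on the whole segment. This avoids
  showing that the equations are proportional.\<close>

lemma sgn_eq_of_same_zeros:
  fixes a a' :: "'a::euclidean_space"
  assumes zeros: "{x. a \<bullet> x = b} = {x. a' \<bullet> x = b'}"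
    and eq: "sgn (a \<bullet> x - b) = sgn (a \<bullet> y - b)"
  shows "sgn (a' \<bullet> x - b') = sgn (a' \<bullet> y - b')"
proof (rule ccontr)
  assume ne: "sgn (a' \<bullet> x - b') \<noteq> sgn (a' \<bullet> y - b')"
  have zero: "a \<bullet> z - b = 0 \<longleftrightarrow> a' \<bullet> z - b' = 0" for z
    using zeros by (auto simp: set_eq_iff)
  define u v where "u = a' \<bullet> x - b'" and "v = a' \<bullet> y - b'"
  have "(a \<bullet> x - b = 0) = (a \<bullet> y - b = 0)" using eq by (metis sgn_0 sgn_zero_iff)
  then have uv: "u \<noteq> 0" "v \<noteq> 0" "sgn u \<noteq> sgn v" using ne zero unfolding u_def v_def by auto
  then have "u * v < 0" by (auto simp: sgn_if mult_less_0_iff split: if_splits)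
  \<comment> \<open>The parameter at which the affine function with end values \<open>u\<close> and
    \<open>v\<close> vanishes.\<close>
  define s where "s = u / (u - v)"
  have s: "0 < s" "s < 1"
    using uv \<open>u * v < 0\<close> unfolding s_def by (auto simp: mult_less_0_iff divide_simps)
  define p where "p = (1 - s) *\<^sub>R x + s *\<^sub>R y"
  have "a' \<bullet> p - b' = u - s * (u - v)"
    by (simp add: p_def u_def v_def inner_add_right algebra_simps)
  also have "\<dots> = 0" using uv by (auto simp: s_def)
  finally have "a \<bullet> p - b = 0" using zero by simp
  moreover have "a \<bullet> p - b = (1 - s) * (a \<bullet> x - b) + s * (a \<bullet> y - b)"
    by (simp add: p_def inner_add_right algebra_simps)
  moreover have "a \<bullet> x - b \<noteq> 0" using zero uv(1) by (simp add: u_def)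
  ultimately show False
    using eq s by (smt (verit) mult_pos_pos mult_pos_neg sgn_greater sgn_less)
qed

text \<open>Points stand for their faces: the sign vector of \<open>y\<close> arises from that of
  \<open>x\<close> by setting some entries to 0. This is the face order in the language of
  covectors.\<close>

definition below :: "(real ^ 'n) set set \<Rightarrow> real ^ 'n \<Rightarrow> real ^ 'n \<Rightarrow> bool" where
  "below A x y \<longleftrightarrow> (\<forall>H\<in>A. level H y \<noteq> 0 \<longrightarrow> sgn (level H x) = sgn (level H y))"

definition regular :: "(real ^ 'n) set set \<Rightarrow> real ^ 'n \<Rightarrow> bool" where
  "regular A x \<longleftrightarrow> (\<forall>H\<in>A. level H x \<noteq> 0)"

definition face_at :: "(real ^ 'n) set set \<Rightarrow> real ^ 'n \<Rightarrow> (real ^ 'n) set" where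
  "face_at A x = {y. \<forall>H\<in>A. sgn (level H y) = sgn (level H x)}"

lemma belowD: "below A x y \<Longrightarrow> H \<in> A \<Longrightarrow> level H y \<noteq> 0 \<Longrightarrow> sgn (level H x) = sgn (level H y)"
  by (simp add: below_def)

lemma below_zero: "below A x y \<Longrightarrow> H \<in> A \<Longrightarrow> level H x = 0 \<Longrightarrow> level H y = 0"
  using belowD by (metis sgn_0 sgn_zero_iff)

lemma below_refl [simp]: "below A x x"
  by (simp add: below_def)

lemma below_trans: "below A x y \<Longrightarrow> below A y z \<Longrightarrow> below A x z"
  unfolding below_def by (metis sgn_0 sgn_zero_iff)

lemma below_antisym: "below A x y \<Longrightarrow> below A y x \<Longrightarrow> H \<in> A \<Longrightarrow> sgn (level H x) = sgn (level H y)"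
  unfolding below_def by metis

lemma face_at_self [simp]: "x \<in> face_at A x"
  by (simp add: face_at_def)

lemma face_at_eq_iff: "face_at A x = face_at A y \<longleftrightarrow> (\<forall>H\<in>A. sgn (level H x) = sgn (level H y))"
  unfolding face_at_def by auto

lemma in_face_at_iff: "y \<in> face_at A x \<longleftrightarrow> face_at A y = face_at A x"
  unfolding face_at_eq_iff by (simp add: face_at_def)

lemma sgn_0_iff: "sgn (a :: real) = sgn b \<Longrightarrow> a = 0 \<longleftrightarrow> b = 0"
  by (metis sgn_0 sgn_zero_iff)

lemma face_at_cong:
  assumes "face_at A x = face_at A x'" "face_at A y = face_at A y'"
  shows "below A x y \<longleftrightarrow> below A x' y'" "regular A x \<longleftrightarrow> regular A x'"
  using assms unfolding face_at_eq_iff below_def regular_def by (metis sgn_0_iff)+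

section \<open>Faces, chambers and \<open>C\<^sub>F\<close> in terms of sign vectors\<close>

locale hyperplane_arrangement =
  fixes A :: "(real ^ 'n) set set"
  assumes arrangement: "arrangement A"
begin

lemma finite_A: "finite A"
  using arrangement by (simp add: arrangement_def)

lemma normal_form:
  assumes "H \<in> A"
  shows "fst (normal_form H) \<noteq> 0" "H = {x. fst (normal_form H) \<bullet> x = snd (normal_form H)}"
proof -
  obtain a b where ab: "a \<noteq> 0" "H = {x. a \<bullet> x = b}"
    using arrangement assms unfolding arrangement_def by blast
  have "case normal_form H of (a, b) \<Rightarrow> a \<noteq> 0 \<and> H = {x. a \<bullet> x = b}"
    unfolding normal_form_def by (rule someI[of _ "(a, b)"]) (use ab in simp)
  then show "fst (normal_form H) \<noteq> 0" "H = {x. fst (normal_form H) \<bullet> x = snd (normal_form H)}"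
    by (simp_all add: case_prod_beta)
qed

lemma level_eq_0_iff: "H \<in> A \<Longrightarrow> level H x = 0 \<longleftrightarrow> x \<in> H"
  using normal_form(2)[of H] unfolding level_def by auto

lemma normal_form_in_equations: "H \<in> A \<Longrightarrow> normal_form H \<in> equations A"
  using normal_form[of H] by (simp add: equations_def case_prod_beta)

text \<open>Equal signs for the one chosen equation of each hyperplane force equal signs for all its
  equations, by \<open>sgn_eq_of_same_zeros\<close>.\<close>

lemma faces_eq: "faces A = range (face_at A)"
proof -
  have "(\<forall>(a, b) \<in> equations A. sgn (a \<bullet> y - b) = sgn (a \<bullet> x - b)) \<longleftrightarrow>
      (\<forall>H\<in>A. sgn (level H y) = sgn (level H x))" for x y
  proof
    assume "\<forall>(a, b) \<in> equations A. sgn (a \<bullet> y - b) = sgn (a \<bullet> x - b)"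
    then show "\<forall>H\<in>A. sgn (level H y) = sgn (level H x)"
      using normal_form_in_equations unfolding level_def by fastforce
  next
    assume eq: "\<forall>H\<in>A. sgn (level H y) = sgn (level H x)"
    show "\<forall>(a, b) \<in> equations A. sgn (a \<bullet> y - b) = sgn (a \<bullet> x - b)"
    proof (intro ballI, clarify)
      fix a b assume ab: "(a, b) \<in> equations A"
      let ?H = "{x. a \<bullet> x = b}"
      have H: "?H \<in> A" using ab by (simp add: equations_def)
      show "sgn (a \<bullet> y - b) = sgn (a \<bullet> x - b)"
        using eq H by (intro sgn_eq_of_same_zeros[OF normal_form(2)[OF H, symmetric]]) (simp add: level_def)
    qed
  qed
  then show ?thesis unfolding faces_def face_at_def by simp
qed

lemma face_at_in_faces [simp]: "face_at A x \<in> faces A"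
  by (simp add: faces_eq)

text \<open>A face is determined by its sign vector, an element of \<open>{-1, 0, 1}\<close> to the
  power \<open>A\<close>.\<close>

lemma finite_faces: "finite (faces A)"
proof (rule finite_subset)
  let ?F = "\<lambda>f. {y. \<forall>H\<in>A. sgn (level H y) = f H}"
  show "faces A \<subseteq> ?F ` (PiE A (\<lambda>_. {-1, 0, 1}))"
  proof
    fix F assume "F \<in> faces A"
    then obtain x where x: "F = face_at A x" by (auto simp: faces_eq)
    have "F = ?F (\<lambda>H\<in>A. sgn (level H x))" unfolding x face_at_def by auto
    moreover have "(\<lambda>H\<in>A. sgn (level H x)) \<in> PiE A (\<lambda>_. {-1, 0, 1})"
      by (auto simp: sgn_if)
    ultimately show "F \<in> ?F ` (PiE A (\<lambda>_. {-1, 0, 1}))" by blast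
  qed
  show "finite (?F ` (PiE A (\<lambda>_. {-1, 0, 1 :: real})))"
    using finite_A by (intro finite_imageI finite_PiE) auto
qed

lemma eventually_below: "eventually (\<lambda>y. below A y x) (nhds x)"
proof -
  have "eventually (\<lambda>y. level H x \<noteq> 0 \<longrightarrow> sgn (level H y) = sgn (level H x)) (nhds x)" for H
  proof -
    have lim: "(level H \<longlongrightarrow> level H x) (nhds x)"
      using continuous_level[of UNIV H] by (simp add: continuous_on_def tendsto_at_iff_tendsto_nhds)
    consider "level H x = 0" | "level H x > 0" | "level H x < 0" by linarith
    then show ?thesis
    proof cases
      case 2
      from order_tendstoD(1)[OF lim this] show ?thesis by eventually_elim (use 2 in simp)
    next
      case 3
      from order_tendstoD(2)[OF lim this] show ?thesis by eventually_elim (use 3 in simp)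
    qed simp
  qed
  then show ?thesis unfolding below_def using finite_A by (simp add: eventually_ball_finite)
qed

lemma eventually_perturb:
  "eventually (\<lambda>e. below A (x + e *\<^sub>R v) x) (at_right 0)"
proof -
  have "((\<lambda>e. x + e *\<^sub>R v) \<longlongrightarrow> x + 0 *\<^sub>R v) (at_right 0)"
    by (intro tendsto_intros)
  then have "filterlim (\<lambda>e. x + e *\<^sub>R v) (nhds x) (at_right 0)" by simp
  then show ?thesis using eventually_below unfolding filterlim_iff by blast
qed

text \<open>Take \<open>d = x + e v\<close> for small \<open>e > 0\<close>: nonzero levels keep
  their sign, and a level that is 0 at \<open>x\<close> becomes \<open>e\<close> times the slope of
  \<open>v\<close>.\<close>

lemma perturb:
  obtains d where "\<And>H. H \<in> A \<Longrightarrow> sgn (level H d) = (if level H x = 0 then sgn (slope H v) else sgn (level H x))"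
proof -
  have "eventually (\<lambda>e. below A (x + e *\<^sub>R v) x \<and> 0 < e) (at_right (0 :: real))"
    by (intro eventually_conj eventually_perturb eventually_at_right_less)
  then obtain e :: real where e: "below A (x + e *\<^sub>R v) x" "0 < e"
    using eventually_happens'[OF trivial_limit_at_right_real] by blast
  show thesis
  proof (rule that[of "x + e *\<^sub>R v"])
    show "sgn (level H (x + e *\<^sub>R v)) = (if level H x = 0 then sgn (slope H v) else sgn (level H x))"
      if "H \<in> A" for H
      using e(2) belowD[OF e(1) that] by (simp add: level_add slope_scale sgn_mult)
  qed
qed

text \<open>The composition of two covectors, realized by a point. For regular \<open>c\<close> it
  is the sign vector of the chamber \<open>C\<^sub>F\<close>, with \<open>F\<close> the face of
  \<open>x\<close> and \<open>C\<close> that of \<open>c\<close>.\<close>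

lemma perturb_towards:
  obtains d where "\<And>H. H \<in> A \<Longrightarrow> sgn (level H d) = (if level H x = 0 then sgn (level H c) else sgn (level H x))"
proof -
  obtain d where d: "\<And>H. H \<in> A \<Longrightarrow> sgn (level H d) = (if level H x = 0 then sgn (slope H (c - x)) else sgn (level H x))"
    using perturb by blast
  show thesis by (rule that[of d]) (simp add: d slope_diff)
qed

lemma exists_regular: obtains c where "regular A c"
proof -
  have "negligible H" if "H \<in> A" for H
    using normal_form[OF that] negligible_hyperplane by metis
  then have "negligible (\<Union>A)" using finite_A by (intro negligible_Union) auto
  then have "\<Union>A \<noteq> UNIV" using non_negligible_UNIV by metis
  then obtain c where "c \<notin> \<Union>A" by blast
  then have "regular A c" using level_eq_0_iff by (auto simp: regular_def)
  then show thesis by (rule that)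
qed

lemma exists_regular_below: obtains c where "regular A c" "below A c x"
proof -
  obtain r where r: "regular A r" by (rule exists_regular)
  obtain d where d: "\<And>H. H \<in> A \<Longrightarrow> sgn (level H d) = (if level H x = 0 then sgn (level H r) else sgn (level H x))"
    using perturb_towards by blast
  have "level H d \<noteq> 0" if "H \<in> A" for H
    using d[OF that] r that sgn_0_iff[of "level H d"] unfolding regular_def by presburger
  then show thesis using d by (intro that[of d]) (auto simp: regular_def below_def)
qed

text \<open>All points near \<open>y\<close> are below \<open>y\<close>, in particular one of the
  face of \<open>x\<close>. Conversely, small steps from \<open>y\<close> towards \<open>x\<close>
  already lie in the face of \<open>x\<close>.\<close>

lemma in_closure_face_at_iff: "y \<in> closure (face_at A x) \<longleftrightarrow> below A x y"
proof
  assume "y \<in> closure (face_at A x)"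
  moreover obtain U where "open U" "y \<in> U" "\<And>z. z \<in> U \<Longrightarrow> below A z y"
    using eventually_below[of y] unfolding eventually_nhds by blast
  ultimately obtain z where z: "z \<in> face_at A x" "below A z y"
    using open_Int_closure_eq_empty[of U "face_at A x"] by blast
  then show "below A x y"
    using face_at_cong(1)[of A z x y y] in_face_at_iff by blast
next
  assume b: "below A x y"
  have "((\<lambda>e. y + e *\<^sub>R (x - y)) \<longlongrightarrow> y + 0 *\<^sub>R (x - y)) (at_right 0)"
    by (intro tendsto_intros)
  then have lim: "((\<lambda>e. y + e *\<^sub>R (x - y)) \<longlongrightarrow> y) (at_right 0)" by simp
  have "eventually (\<lambda>e. below A (y + e *\<^sub>R (x - y)) y \<and> 0 < e) (at_right (0 :: real))"
    by (intro eventually_conj eventually_perturb eventually_at_right_less)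
  then have "eventually (\<lambda>e. y + e *\<^sub>R (x - y) \<in> closure (face_at A x)) (at_right 0)"
  proof eventually_elim
    case (elim e)
    have "sgn (level H (y + e *\<^sub>R (x - y))) = sgn (level H x)" if "H \<in> A" for H
      using elim belowD[OF conjunct1[OF elim] that] belowD[OF b that]
      by (cases "level H y = 0") (auto simp: level_add slope_scale slope_diff sgn_mult)
    then have "y + e *\<^sub>R (x - y) \<in> face_at A x" by (simp add: face_at_def)
    then show ?case using closure_subset by blast
  qed
  then show "y \<in> closure (face_at A x)"
    by (intro Lim_in_closed_set[OF closed_closure _ trivial_limit_at_right_real lim])
qed

lemma face_subset_closure_iff: "face_at A y \<subseteq> closure (face_at A x) \<longleftrightarrow> below A x y"
  using in_closure_face_at_iff face_at_cong(1)[of A x x] in_face_at_iff by (metis face_at_self subset_iff)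

lemma face_le_iff: "face_le (face_at A x) (face_at A y) \<longleftrightarrow> below A x y"
  unfolding face_le_def using face_subset_closure_iff[of y x] closure_subset[of "face_at A y"]
  by (metis closed_closure closure_minimal order_trans)

text \<open>Below every point there is a regular one, so a minimal face is regular; below a regular
  point no sign can change.\<close>

lemma face_at_in_chambers_iff: "face_at A x \<in> chambers A \<longleftrightarrow> regular A x"
proof
  assume *: "face_at A x \<in> chambers A"
  obtain c where c: "regular A c" "below A c x" by (rule exists_regular_below)
  then have "face_at A c = face_at A x"
    using * face_le_iff unfolding chambers_def by auto
  then show "regular A x" using c(1) face_at_cong(2) by blast
next
  assume "regular A x"
  then have eq: "face_at A y = face_at A x" if "below A y x" for y
    using that unfolding face_at_eq_iff by (auto simp: regular_def below_def)
  have "F = face_at A x" if F: "F \<in> faces A" and le: "face_le F (face_at A x)" for F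
  proof -
    obtain y where y: "F = face_at A y" using F unfolding faces_eq by blast
    have "below A y x" using le unfolding y face_le_iff .
    then show ?thesis unfolding y by (rule eq)
  qed
  then show "face_at A x \<in> chambers A"
    unfolding chambers_def by simp
qed

lemma localization_face_at: "localization A (face_at A x) = {H \<in> A. level H x = 0}"
proof -
  have "affine hull (face_at A x) \<subseteq> H \<longleftrightarrow> level H x = 0" if H: "H \<in> A" for H
  proof
    assume "affine hull (face_at A x) \<subseteq> H"
    then have "x \<in> H" using hull_subset[of "face_at A x" affine] face_at_self by blast
    then show "level H x = 0" using level_eq_0_iff[OF H] by simp
  next
    assume "level H x = 0"
    then have "level H y = 0" if "y \<in> face_at A x" for y
      using that H sgn_0_iff[of "level H y" "level H x"] by (simp add: face_at_def)
    then have "face_at A x \<subseteq> H"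
      using level_eq_0_iff[OF H] by blast
    moreover have "affine H" using normal_form(2)[OF H] affine_hyperplane by metis
    ultimately show "affine hull (face_at A x) \<subseteq> H" by (rule hull_minimal)
  qed
  then show ?thesis unfolding localization_def by blast
qed

lemma sub_arrangement: "B \<subseteq> A \<Longrightarrow> hyperplane_arrangement B"
  using arrangement finite_subset unfolding arrangement_def hyperplane_arrangement_def by blast

text \<open>The two conditions on \<open>C\<^sub>F\<close> fix all its signs: on hyperplanes through
  \<open>x\<close> the common chamber of the localization forces those of \<open>c\<close>, and on
  the others the closure condition forces those of \<open>x\<close>.\<close>

lemma chamber_at_eq:
  assumes c: "regular A c"
    and d: "\<And>H. H \<in> A \<Longrightarrow> sgn (level H d) = (if level H x = 0 then sgn (level H c) else sgn (level H x))"
  shows "chamber_at A (face_at A x) (face_at A c) = face_at A d"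
  unfolding chamber_at_def
proof (rule the_equality)
  define B where "B = localization A (face_at A x)"
  have B: "B = {H \<in> A. level H x = 0}" unfolding B_def by (rule localization_face_at)
  interpret B: hyperplane_arrangement B by (rule sub_arrangement) (auto simp: B)
  have "level H d \<noteq> 0" if "H \<in> A" for H
    using d[OF that] c that sgn_0_iff[of "level H d"] unfolding regular_def by presburger
  then have reg: "regular A d" by (simp add: regular_def)
  have "face_at A c \<subseteq> face_at B c" "face_at A d \<subseteq> face_at B c"
    using d unfolding face_at_def B by auto
  moreover have "regular B c" using c by (simp add: regular_def B)
  then have "face_at B c \<in> chambers B" unfolding B.face_at_in_chambers_iff .
  ultimately have "\<exists>K\<in>chambers B. face_at A c \<subseteq> K \<and> face_at A d \<subseteq> K" by blast
  then show "face_at A d \<in> chambers A \<and> face_at A x \<subseteq> closure (face_at A d) \<and>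
      (\<exists>K\<in>chambers (localization A (face_at A x)). face_at A c \<subseteq> K \<and> face_at A d \<subseteq> K)"
    unfolding face_at_in_chambers_iff face_subset_closure_iff B_def[symmetric]
    using reg d by (auto simp: below_def)
  fix D assume D: "D \<in> chambers A \<and> face_at A x \<subseteq> closure D \<and>
      (\<exists>K\<in>chambers (localization A (face_at A x)). face_at A c \<subseteq> K \<and> D \<subseteq> K)"
  then obtain d' where d': "D = face_at A d'" by (auto simp: chambers_def faces_eq)
  obtain K where K: "K \<in> chambers B" "face_at A c \<subseteq> K" "face_at A d' \<subseteq> K"
    using D d' B_def by blast
  then obtain k where k: "K = face_at B k" by (auto simp: chambers_def B.faces_eq)
  have "c \<in> face_at B k" "d' \<in> face_at B k"
    using K(2,3) k face_at_self[of c A] face_at_self[of d' A] by blast+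
  then have "face_at B c = face_at B d'"
    unfolding in_face_at_iff by simp
  moreover have below: "below A d' x"
    using D face_subset_closure_iff[of x d'] by (simp add: d')
  ultimately have "sgn (level H d') = sgn (level H d)" if "H \<in> A" for H
    using d[OF that] that belowD[OF below that] unfolding face_at_eq_iff B by simp
  then show "D = face_at A d" unfolding d' face_at_eq_iff by blast
qed

end

section \<open>The complement is stratified by the vertices of the Salvetti complex\<close>

definition re_vec :: "complex ^ 'n \<Rightarrow> real ^ 'n" where
  "re_vec z = (\<chi> i. Re (z $ i))"

definition im_vec :: "complex ^ 'n \<Rightarrow> real ^ 'n" where
  "im_vec z = (\<chi> i. Im (z $ i))"

lemma re_vec_complex_vec [simp]: "re_vec (complex_vec x y) = x"
  and im_vec_complex_vec [simp]: "im_vec (complex_vec x y) = y"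
  by (simp_all add: re_vec_def im_vec_def complex_vec_def)

lemma linear_re_vec: "linear re_vec" and linear_im_vec: "linear im_vec"
  by (auto simp: re_vec_def im_vec_def vec_eq_iff intro!: linearI)

lemma continuous_re_vec: "continuous_on S re_vec" and continuous_im_vec: "continuous_on S im_vec"
  using linear_re_vec linear_im_vec
  by (auto intro: linear_continuous_on simp: linear_conv_bounded_linear)

definition vertex_point :: "(real ^ 'n) \<times> (real ^ 'n) \<Rightarrow> complex ^ 'n" where
  "vertex_point v = complex_vec (fst v) (fst v - snd v)"

lemma inj_vertex_point: "inj vertex_point"
proof (rule injI)
  fix u v :: "(real ^ 'n) \<times> (real ^ 'n)"
  assume "vertex_point u = vertex_point v"
  then have "re_vec (vertex_point u) = re_vec (vertex_point v)" "im_vec (vertex_point u) = im_vec (vertex_point v)"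
    by simp_all
  then show "u = v" by (simp add: vertex_point_def prod_eq_iff)
qed

text \<open>A vertex of the Salvetti complex is given by the chosen points of a face and of a chamber
  above which it lies; then \<open>C\<^sub>F = C\<close>.\<close>

definition vertices :: "(real ^ 'n) set set \<Rightarrow> ((real ^ 'n) set \<Rightarrow> real ^ 'n) \<Rightarrow> ((real ^ 'n) \<times> (real ^ 'n)) set" where
  "vertices A w = {(w F, w C) | F C. F \<in> faces A \<and> C \<in> chambers A \<and> face_le C F}"

text \<open>For vertices \<open>(F, C)\<close> and \<open>(G, D)\<close> the second clause says that
  \<open>C = D\<^sub>F\<close>: off the hyperplanes through \<open>F\<close> the signs of both
  chambers are those of \<open>F\<close>. Chains of this order are the compatible families in the
  Salvetti complex.\<close>

definition vertex_le :: "(real ^ 'n) set set \<Rightarrow> (real ^ 'n) \<times> (real ^ 'n) \<Rightarrow> (real ^ 'n) \<times> (real ^ 'n) \<Rightarrow> bool" where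
  "vertex_le A u v \<longleftrightarrow> below A (fst u) (fst v) \<and>
     (\<forall>H\<in>A. level H (fst u) = 0 \<longrightarrow> sgn (level H (snd u)) = sgn (level H (snd v)))"

text \<open>The union of the strata of vertices below \<open>v\<close>. The minus sign stems from
  the imaginary part \<open>w(F) - w(C)\<close> of the vertex itself.\<close>

definition vertex_nhd :: "(real ^ 'n) set set \<Rightarrow> (real ^ 'n) \<times> (real ^ 'n) \<Rightarrow> (complex ^ 'n) set" where
  "vertex_nhd A v = {z. \<forall>H\<in>A.
     (level H (fst v) = 0 \<or> sgn (level H (re_vec z)) = sgn (level H (fst v))) \<and>
     (level H (re_vec z) \<noteq> 0 \<or> sgn (slope H (im_vec z)) = - sgn (level H (snd v)))}"

text \<open>After multiplication by \<open>sgn a\<close> no term is negative, and the first is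
  positive since \<open>s < 1\<close>.\<close>

lemma sgn_convex_combination:
  fixes a :: real
  assumes a: "a \<noteq> 0" and s: "0 \<le> s" "s < 1" and t: "\<And>p. p \<in> P \<Longrightarrow> 0 \<le> t p"
    and f: "\<And>p. p \<in> P \<Longrightarrow> t p \<noteq> 0 \<Longrightarrow> f p = 0 \<or> sgn (f p) = sgn a"
  shows "sgn ((1 - s) * a + s * (\<Sum>p\<in>P. t p * f p)) = sgn a"
proof -
  have nonneg: "0 \<le> sgn a * (t p * f p)" if "p \<in> P" for p
    using t[OF that] f[OF that] a
    by (cases "t p = 0") (auto simp: sgn_if mult_le_0_iff zero_le_mult_iff split: if_splits)
  have "sgn a * ((1 - s) * a + s * (\<Sum>p\<in>P. t p * f p)) =
      (1 - s) * (sgn a * a) + s * (\<Sum>p\<in>P. sgn a * (t p * f p))"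
    by (simp add: sum_distrib_left algebra_simps)
  moreover have "0 < (1 - s) * (sgn a * a)" using a s by (simp add: sgn_if mult_less_0_iff)
  moreover have "0 \<le> s * (\<Sum>p\<in>P. sgn a * (t p * f p))" using s nonneg by (simp add: sum_nonneg)
  ultimately have "0 < sgn a * ((1 - s) * a + s * (\<Sum>p\<in>P. t p * f p))" by simp
  then show ?thesis using a by (auto simp: sgn_if zero_less_mult_iff split: if_splits)
qed

lemma sgn_weighted_sum:
  fixes f :: "'p \<Rightarrow> real"
  assumes "finite P" "m \<in> P" "0 < t m" and t: "\<And>p. p \<in> P \<Longrightarrow> 0 \<le> t p"
    and f: "\<And>p. p \<in> P \<Longrightarrow> t p \<noteq> 0 \<Longrightarrow> f p = 0 \<or> sgn (f p) = sgn (f m)"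
  shows "sgn (\<Sum>p\<in>P. t p * f p) = sgn (f m)"
proof (cases "f m = 0")
  case True
  then have "t p * f p = 0" if "p \<in> P" for p
    using f[OF that] sgn_0_iff[of "f p" "f m"] by auto
  then show ?thesis using True by (simp add: sum.neutral)
next
  case False
  have "sgn ((1 - 0) * (t m * f m) + 1 / 2 * (\<Sum>p\<in>P - {m}. 2 * t p * f p)) = sgn (t m * f m)"
  proof -
    \<comment> \<open>The convex form is used at \<open>s = 1/2\<close>, with all weights doubled to
      compensate.\<close>
    have "sgn ((1 - 1/2) * (2 * t m * f m) + 1/2 * (\<Sum>p\<in>P - {m}. (2 * t p) * f p)) = sgn (2 * t m * f m)"
    proof (rule sgn_convex_combination)
      show "f p = 0 \<or> sgn (f p) = sgn (2 * t m * f m)" if "p \<in> P - {m}" "2 * t p \<noteq> 0" for p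
        using f[of p] that assms(3) by (simp add: sgn_mult)
    qed (use False assms(3) t in auto)
    then show ?thesis using assms(3) by (simp add: sgn_mult)
  qed
  then have "sgn (t m * f m + (\<Sum>p\<in>P - {m}. t p * f p)) = sgn (f m)"
    using assms(3) by (simp add: sgn_mult sum_distrib_left)
  then show ?thesis using assms(1,2) by (simp add: sum.remove)
qed

lemma open_sgn_eq:
  fixes f :: "'a::topological_space \<Rightarrow> real"
  assumes f: "continuous_on UNIV f" and "c \<noteq> 0"
  shows "open {z. sgn (f z) = sgn c}"
proof (cases "c > 0")
  case True
  then have "{z. sgn (f z) = sgn c} = {z. 0 < f z}" by (auto simp: sgn_if)
  then show ?thesis using open_Collect_less[OF continuous_on_const f, of 0] by simp
next
  case False
  then have "{z. sgn (f z) = sgn c} = {z. f z < 0}" using assms(2) by (auto simp: sgn_if)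
  then show ?thesis using open_Collect_less[OF f continuous_on_const, of 0] by simp
qed

context hyperplane_arrangement
begin

text \<open>For real \<open>a\<close> and \<open>b\<close>, a point \<open>x + iy\<close> solves the
  complex equation iff \<open>x\<close> and \<open>x + y\<close> both lie in the real hyperplane.
  This depends only on the hyperplane, so one equation can replace all of them.\<close>

lemma complexified_complement_eq:
  "complexified_complement A = {z. \<forall>H\<in>A. level H (re_vec z) \<noteq> 0 \<or> slope H (im_vec z) \<noteq> 0}"
proof -
  have dot: "(\<Sum>i\<in>UNIV. complex_of_real (a $ i) * z $ i) = complex_of_real b \<longleftrightarrow>
      a \<bullet> re_vec z = b \<and> a \<bullet> im_vec z = 0" for a :: "real ^ 'n" and b z
    by (simp add: complex_eq_iff re_vec_def im_vec_def inner_vec_def)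
  have "(\<forall>(a, b) \<in> equations A. (\<Sum>i\<in>UNIV. complex_of_real (a $ i) * z $ i) \<noteq> complex_of_real b) \<longleftrightarrow>
      (\<forall>H\<in>A. level H (re_vec z) \<noteq> 0 \<or> slope H (im_vec z) \<noteq> 0)" for z
  proof
    assume L: "\<forall>(a, b) \<in> equations A. (\<Sum>i\<in>UNIV. complex_of_real (a $ i) * z $ i) \<noteq> complex_of_real b"
    show "\<forall>H\<in>A. level H (re_vec z) \<noteq> 0 \<or> slope H (im_vec z) \<noteq> 0"
    proof
      fix H assume "H \<in> A"
      from bspec[OF L normal_form_in_equations[OF this]]
      show "level H (re_vec z) \<noteq> 0 \<or> slope H (im_vec z) \<noteq> 0"
        by (simp add: case_prod_beta dot level_def slope_def)
    qed
  next
    assume R: "\<forall>H\<in>A. level H (re_vec z) \<noteq> 0 \<or> slope H (im_vec z) \<noteq> 0"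
    show "\<forall>(a, b) \<in> equations A. (\<Sum>i\<in>UNIV. complex_of_real (a $ i) * z $ i) \<noteq> complex_of_real b"
    proof (intro ballI, clarify)
      fix a b assume ab: "(a, b) \<in> equations A"
        and "(\<Sum>i\<in>UNIV. complex_of_real (a $ i) * z $ i) = complex_of_real b"
      then have "a \<bullet> re_vec z = b" "a \<bullet> (re_vec z + im_vec z) = b"
        by (simp_all add: dot inner_add_right)
      moreover have H: "{x. a \<bullet> x = b} \<in> A" using ab by (simp add: equations_def)
      ultimately have "level {x. a \<bullet> x = b} (re_vec z) = 0" "level {x. a \<bullet> x = b} (re_vec z + im_vec z) = 0"
        by (simp_all add: level_eq_0_iff)
      then show False using bspec[OF R H] by (simp add: level_add)
    qed
  qed
  then show ?thesis unfolding complexified_complement_def by blast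
qed

text \<open>The imaginary part is constrained only where the real level vanishes, but the condition
  is a union of two open ones: a level is nonzero, or a slope has a prescribed sign, nonzero by
  regularity.\<close>

lemma open_vertex_nhd:
  assumes "regular A (snd v)"
  shows "open (vertex_nhd A v)"
proof -
  have re: "continuous_on UNIV (\<lambda>z. level H (re_vec z))" for H :: "(real ^ 'n) set"
    by (rule continuous_on_compose2[OF continuous_level continuous_re_vec subset_UNIV])
  have im: "continuous_on UNIV (\<lambda>z. slope H (im_vec z))" for H :: "(real ^ 'n) set"
    by (rule continuous_on_compose2[OF continuous_slope continuous_im_vec subset_UNIV])
  have 1: "open {z. level H (fst v) = 0 \<or> sgn (level H (re_vec z)) = sgn (level H (fst v))}" for H
    using open_sgn_eq[OF re, of "level H (fst v)" H] by (cases "level H (fst v) = 0") simp_all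
  have 2: "open {z. level H (re_vec z) \<noteq> 0 \<or> sgn (slope H (im_vec z)) = - sgn (level H (snd v))}" if "H \<in> A" for H
  proof -
    have "open {z. level H (re_vec z) \<noteq> 0}"
      by (intro open_Collect_neq re continuous_on_const)
    moreover have "open {z. sgn (slope H (im_vec z)) = sgn (- level H (snd v))}"
      using that assms by (intro open_sgn_eq im) (simp add: regular_def)
    ultimately show ?thesis unfolding Collect_disj_eq sgn_minus by (rule open_Un)
  qed
  have "vertex_nhd A v = (\<Inter>H\<in>A. {z. level H (fst v) = 0 \<or> sgn (level H (re_vec z)) = sgn (level H (fst v))} \<inter>
      {z. level H (re_vec z) \<noteq> 0 \<or> sgn (slope H (im_vec z)) = - sgn (level H (snd v))})"
    unfolding vertex_nhd_def by blast
  then show ?thesis using 1 2 finite_A by (simp add: open_INT open_Int)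
qed

end

locale pointed_arrangement = hyperplane_arrangement A
  for A :: "(real ^ 'n) set set" +
  fixes w :: "(real ^ 'n) set \<Rightarrow> real ^ 'n"
  assumes w_in: "F \<in> faces A \<Longrightarrow> w F \<in> F"
begin

lemma face_at_w: "F \<in> faces A \<Longrightarrow> face_at A (w F) = F"
  using w_in[of F] in_face_at_iff[of "w F" A] unfolding faces_eq by auto

lemma w_face_at_eq_iff: "w (face_at A x) = w (face_at A y) \<longleftrightarrow> face_at A x = face_at A y"
  using face_at_w[OF face_at_in_faces] by metis

lemma in_vertices_iff:
  "(g, c) \<in> vertices A w \<longleftrightarrow>
     g = w (face_at A g) \<and> c = w (face_at A c) \<and> regular A c \<and> below A c g"
proof
  assume "(g, c) \<in> vertices A w"
  then obtain F C where FC: "F \<in> faces A" "C \<in> chambers A" "face_le C F" "g = w F" "c = w C"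
    unfolding vertices_def by blast
  have C: "C \<in> faces A" using FC(2) by (simp add: chambers_def)
  show "g = w (face_at A g) \<and> c = w (face_at A c) \<and> regular A c \<and> below A c g"
    using FC(2,3) face_at_w[OF FC(1)] face_at_w[OF C] face_le_iff[of c g] face_at_in_chambers_iff[of c]
    by (simp add: FC(4,5))
next
  assume "g = w (face_at A g) \<and> c = w (face_at A c) \<and> regular A c \<and> below A c g"
  then show "(g, c) \<in> vertices A w"
    unfolding vertices_def using face_at_in_faces face_at_in_chambers_iff face_le_iff by blast
qed

lemma vertex_in_vertices:
  assumes "regular A c" "below A c g"
  shows "(w (face_at A g), w (face_at A c)) \<in> vertices A w"
  using assms face_at_in_chambers_iff face_le_iff face_at_in_faces unfolding vertices_def by blast

lemma finite_vertices: "finite (vertices A w)"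
proof (rule finite_subset)
  show "vertices A w \<subseteq> (w ` faces A) \<times> (w ` faces A)"
    by (auto simp: vertices_def chambers_def)
qed (simp add: finite_faces)

lemma vertex_le_trans: "vertex_le A u v \<Longrightarrow> vertex_le A v v' \<Longrightarrow> vertex_le A u v'"
  unfolding vertex_le_def using below_trans below_zero[of A "fst u" "fst v"] by metis

text \<open>Both faces have the same signs. The chambers agree on the hyperplanes through the face
  by \<open>vertex_le\<close> and on the others because both lie below the face.\<close>

lemma vertex_le_antisym:
  assumes u: "u \<in> vertices A w" and v: "v \<in> vertices A w" and "vertex_le A u v" "vertex_le A v u"
  shows "u = v"
proof -
  obtain g c g' c' where uv: "u = (g, c)" "v = (g', c')" by (metis surj_pair)
  note u' = u[unfolded uv in_vertices_iff] and v' = v[unfolded uv in_vertices_iff]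
  have le: "below A g g'" "below A g' g" and c: "\<And>H. H \<in> A \<Longrightarrow> level H g = 0 \<Longrightarrow> sgn (level H c) = sgn (level H c')"
    using assms(3,4) by (auto simp: uv vertex_le_def)
  have g: "sgn (level H g) = sgn (level H g')" if "H \<in> A" for H
    using below_antisym[OF le that] .
  then have "face_at A g = face_at A g'" by (simp add: face_at_eq_iff)
  then have "g = g'" using u' v' by metis
  moreover have "sgn (level H c) = sgn (level H c')" if "H \<in> A" for H
    using c[OF that] u' v' \<open>g = g'\<close> belowD[of A c g H] belowD[of A c' g H] that by metis
  then have "face_at A c = face_at A c'" by (simp add: face_at_eq_iff)
  then have "c = c'" using u' v' by metis
  ultimately show ?thesis by (simp add: uv)
qed

sublocale finite_poset "vertices A w" "vertex_le A"
proof
  show "finite (vertices A w)" by (rule finite_vertices)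
  show "vertex_le A p p" for p by (simp add: vertex_le_def)
qed (blast intro: vertex_le_trans vertex_le_antisym)+

text \<open>The fibre over the single vertex \<open>m\<close> of the map from the complement to the
  finite poset.\<close>

definition in_stratum :: "complex ^ 'n \<Rightarrow> (real ^ 'n) \<times> (real ^ 'n) \<Rightarrow> bool" where
  "in_stratum z m \<longleftrightarrow> (\<forall>H\<in>A. sgn (level H (re_vec z)) = sgn (level H (fst m)) \<and>
     (level H (fst m) = 0 \<longrightarrow> sgn (slope H (im_vec z)) = - sgn (level H (snd m))))"

lemma in_vertex_nhd_iff:
  assumes m: "in_stratum z m"
  shows "z \<in> vertex_nhd A v \<longleftrightarrow> vertex_le A m v"
proof -
  have "(level H (fst v) = 0 \<or> sgn (level H (re_vec z)) = sgn (level H (fst v))) \<and>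
      (level H (re_vec z) \<noteq> 0 \<or> sgn (slope H (im_vec z)) = - sgn (level H (snd v))) \<longleftrightarrow>
      (level H (fst v) \<noteq> 0 \<longrightarrow> sgn (level H (fst m)) = sgn (level H (fst v))) \<and>
      (level H (fst m) = 0 \<longrightarrow> sgn (level H (snd m)) = sgn (level H (snd v)))" if "H \<in> A" for H
  proof -
    have "sgn (level H (re_vec z)) = sgn (level H (fst m))"
      "level H (fst m) = 0 \<longrightarrow> sgn (slope H (im_vec z)) = - sgn (level H (snd m))"
      using m that by (auto simp: in_stratum_def)
    then show ?thesis using sgn_0_iff[of "level H (re_vec z)" "level H (fst m)"] by auto
  qed
  then show ?thesis unfolding vertex_nhd_def vertex_le_def below_def by blast
qed

lemma in_stratum_complement:
  assumes "in_stratum z m" "regular A (snd m)"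
  shows "z \<in> complexified_complement A"
  unfolding complexified_complement_eq
proof (intro CollectI ballI)
  fix H assume "H \<in> A"
  then show "level H (re_vec z) \<noteq> 0 \<or> slope H (im_vec z) \<noteq> 0"
    using assms sgn_0_iff[of "level H (re_vec z)" "level H (fst m)"]
    by (auto simp: in_stratum_def regular_def sgn_eq_0_iff)
qed

text \<open>The chamber is that of a small step from the real part against the imaginary part. It is
  regular because on the complement the slope is nonzero wherever the level vanishes.\<close>

lemma exists_stratum:
  assumes z: "z \<in> complexified_complement A"
  obtains m where "m \<in> vertices A w" "in_stratum z m"
proof -
  let ?x = "re_vec z" and ?y = "im_vec z"
  obtain c where c: "\<And>H. H \<in> A \<Longrightarrow>
      sgn (level H c) = (if level H ?x = 0 then sgn (slope H (- ?y)) else sgn (level H ?x))"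
    using perturb by blast
  have "level H c \<noteq> 0" if H: "H \<in> A" for H
  proof (cases "level H ?x = 0")
    case True
    then have "slope H (- ?y) \<noteq> 0"
      using z H by (auto simp: complexified_complement_eq slope_minus)
    then show ?thesis using True c[OF H] sgn_0_iff[of "level H c" "slope H (- ?y)"] by simp
  next
    case False
    then show ?thesis using c[OF H] sgn_0_iff[of "level H c" "level H ?x"] by simp
  qed
  then have "regular A c" by (simp add: regular_def)
  moreover have "below A c ?x" using c by (simp add: below_def)
  ultimately have "(w (face_at A ?x), w (face_at A c)) \<in> vertices A w" by (rule vertex_in_vertices)
  moreover have "in_stratum z (w (face_at A ?x), w (face_at A c))"
  proof -
    have "sgn (level H (w (face_at A ?x))) = sgn (level H ?x)" "sgn (level H (w (face_at A c))) = sgn (level H c)"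
      if "H \<in> A" for H
      using that face_at_w[of "face_at A ?x"] face_at_w[of "face_at A c"] unfolding face_at_eq_iff by auto
    note sgns = this
    have "level H (w (face_at A ?x)) = 0 \<longleftrightarrow> level H ?x = 0" if "H \<in> A" for H
      by (rule sgn_0_iff[OF sgns(1)[OF that]])
    then show ?thesis
      unfolding in_stratum_def by (simp add: sgns c slope_minus sgn_minus)
  qed
  ultimately show thesis by (rule that)
qed

lemma re_vec_weighted_sum:
  assumes "t \<in> realization"
  shows "re_vec (weighted_sum vertex_point t) = (\<Sum>v\<in>vertices A w. t v *\<^sub>R fst v)"
    "im_vec (weighted_sum vertex_point t) = (\<Sum>v\<in>vertices A w. t v *\<^sub>R (fst v - snd v))"
proof -
  have "weighted_sum vertex_point t = (\<Sum>v\<in>vertices A w. t v *\<^sub>R vertex_point v)"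
    using order_complexD(2)[OF assms] by (intro weighted_sum_eq finite_vertices)
  then show "re_vec (weighted_sum vertex_point t) = (\<Sum>v\<in>vertices A w. t v *\<^sub>R fst v)"
    "im_vec (weighted_sum vertex_point t) = (\<Sum>v\<in>vertices A w. t v *\<^sub>R (fst v - snd v))"
    by (simp_all add: linear_sum[OF linear_re_vec] linear_sum[OF linear_im_vec]
        linear_scale[OF linear_re_vec] linear_scale[OF linear_im_vec] vertex_point_def)
qed

lemma level_weighted_sum_vertices:
  assumes "t \<in> realization"
  shows "level H (re_vec (weighted_sum vertex_point t)) = (\<Sum>v\<in>vertices A w. t v * level H (fst v))"
    "slope H (im_vec (weighted_sum vertex_point t)) = (\<Sum>v\<in>vertices A w. t v * (level H (fst v) - level H (snd v)))"
  unfolding re_vec_weighted_sum[OF assms]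
  by (simp_all add: level_weighted_sum[OF order_complex_sum[OF assms finite_vertices]]
      slope_sum slope_scale slope_diff)

text \<open>The least vertex decides every sign: at the other support faces a level is 0 or has the
  sign at \<open>m\<close>. A hyperplane through the face of \<open>m\<close> contains all support
  faces, and all support chambers lie on the same side of it.\<close>

lemma in_stratum_weighted_sum:
  assumes t: "t \<in> realization" and m: "m \<in> vertices A w" "t m \<noteq> 0" "\<And>v. t v \<noteq> 0 \<Longrightarrow> vertex_le A m v"
  shows "in_stratum (weighted_sum vertex_point t) m"
  unfolding in_stratum_def level_weighted_sum_vertices[OF t]
proof (intro ballI conjI impI)
  fix H assume H: "H \<in> A"
  have tm: "0 < t m" using m(2) order_complexD(1)[OF t, of m] by simp
  show "sgn (\<Sum>v\<in>vertices A w. t v * level H (fst v)) = sgn (level H (fst m))"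
  proof (rule sgn_weighted_sum[where f = "\<lambda>v. level H (fst v)" and t = t and m = m,
        OF finite_vertices m(1) tm order_complexD(1)[OF t]])
    fix v assume "t v \<noteq> 0"
    then show "level H (fst v) = 0 \<or> sgn (level H (fst v)) = sgn (level H (fst m))"
      using m(3)[of v] H unfolding vertex_le_def below_def by metis
  qed
  assume zero: "level H (fst m) = 0"
  have fst0: "level H (fst v) = 0" and snd: "sgn (level H (snd v)) = sgn (level H (snd m))" if "t v \<noteq> 0" for v
    using m(3)[OF that] H zero below_zero[of A "fst m" "fst v" H] by (auto simp: vertex_le_def)
  have "sgn (\<Sum>v\<in>vertices A w. t v * (level H (fst v) - level H (snd v))) = sgn (level H (fst m) - level H (snd m))"
  proof (rule sgn_weighted_sum[where f = "\<lambda>v. level H (fst v) - level H (snd v)" and t = t and m = m,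
        OF finite_vertices m(1) tm order_complexD(1)[OF t]])
    fix v assume "t v \<noteq> 0"
    then show "level H (fst v) - level H (snd v) = 0 \<or>
        sgn (level H (fst v) - level H (snd v)) = sgn (level H (fst m) - level H (snd m))"
      using fst0[of v] snd[of v] zero by (simp add: sgn_minus)
  qed
  then show "sgn (\<Sum>v\<in>vertices A w. t v * (level H (fst v) - level H (snd v))) = - sgn (level H (snd m))"
    using zero by (simp add: sgn_minus)
qed

lemma regular_vertex: "v \<in> vertices A w \<Longrightarrow> regular A (snd v)"
  using in_vertices_iff[of "fst v" "snd v"] by simp

sublocale poset_model "vertices A w" "vertex_le A" "complexified_complement A" "vertex_nhd A" vertex_point
proof
  show "open (vertex_nhd A p)" if "p \<in> vertices A w" for p
    using open_vertex_nhd[OF regular_vertex[OF that]] .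
  show "\<exists>m\<in>vertices A w. \<forall>p\<in>vertices A w. z \<in> vertex_nhd A p \<longleftrightarrow> vertex_le A m p"
    if z: "z \<in> complexified_complement A" for z
  proof -
    obtain m where "m \<in> vertices A w" "in_stratum z m" using z by (rule exists_stratum)
    then show ?thesis using in_vertex_nhd_iff by blast
  qed
  fix t assume t: "t \<in> realization"
  obtain m where m: "m \<in> vertices A w" "t m \<noteq> 0" "\<And>v. t v \<noteq> 0 \<Longrightarrow> vertex_le A m v"
    using least[OF t] by blast
  have st: "in_stratum (weighted_sum vertex_point t) m"
    by (rule in_stratum_weighted_sum[OF t m(1,2)]) (rule m(3))
  show M: "weighted_sum vertex_point t \<in> complexified_complement A"
    using in_stratum_complement[OF st regular_vertex[OF m(1)]] .
  show "weighted_sum vertex_point t \<in> vertex_nhd A p \<longleftrightarrow> (\<exists>q. t q \<noteq> 0 \<and> vertex_le A q p)" for p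
    unfolding in_vertex_nhd_iff[OF st] using m(2) m(3) vertex_le_trans by blast
  fix z assume z: "z \<in> complexified_complement A" and V: "\<And>p. t p \<noteq> 0 \<Longrightarrow> z \<in> vertex_nhd A p"
  show "closed_segment z (weighted_sum vertex_point t) \<subseteq> complexified_complement A"
  proof
    fix z' assume "z' \<in> closed_segment z (weighted_sum vertex_point t)"
    then obtain s where s: "0 \<le> s" "s \<le> 1" and z': "z' = (1 - s) *\<^sub>R z + s *\<^sub>R weighted_sum vertex_point t"
      by (auto simp: in_segment)
    show "z' \<in> complexified_complement A"
    proof (cases "s = 1")
      case True
      then show ?thesis using M z' by simp
    next
      case False
      with s have s1: "s < 1" by simp
      have "level H (re_vec z') \<noteq> 0 \<or> slope H (im_vec z') \<noteq> 0" if H: "H \<in> A" for H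
      \<comment> \<open>Off \<open>H\<close> the real level keeps its sign up to the end point. On
        \<open>H\<close>, membership in the sets \<open>vertex_nhd A v\<close> puts all support
        faces on \<open>H\<close> and their chambers on one side, so the slope keeps its
        sign.\<close>
      proof (cases "level H (re_vec z) = 0")
        case False
        have "level H (re_vec z') = (1 - s) * level H (re_vec z) + s * (\<Sum>v\<in>vertices A w. t v * level H (fst v))"
          by (simp add: z' linear_add[OF linear_re_vec] linear_scale[OF linear_re_vec] level_convex
              level_weighted_sum_vertices[OF t])
        moreover have "sgn ((1 - s) * level H (re_vec z) + s * (\<Sum>v\<in>vertices A w. t v * level H (fst v)))
            = sgn (level H (re_vec z))"
        proof (intro sgn_convex_combination[OF False s(1) s1] order_complexD(1)[OF t])
          fix v assume "t v \<noteq> 0"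
          from V[OF this] H have "level H (fst v) = 0 \<or> sgn (level H (re_vec z)) = sgn (level H (fst v))"
            by (auto simp: vertex_nhd_def)
          then show "level H (fst v) = 0 \<or> sgn (level H (fst v)) = sgn (level H (re_vec z))" by metis
        qed
        ultimately have "sgn (level H (re_vec z')) = sgn (level H (re_vec z))" by simp
        with False show ?thesis using sgn_0_iff by blast
      next
        case True
        have nz: "slope H (im_vec z) \<noteq> 0"
          using z H True by (auto simp: complexified_complement_eq)
        have "slope H (im_vec z') = (1 - s) * slope H (im_vec z) +
            s * (\<Sum>v\<in>vertices A w. t v * (level H (fst v) - level H (snd v)))"
          by (simp add: z' linear_add[OF linear_im_vec] linear_scale[OF linear_im_vec] slope_add slope_scale
              level_weighted_sum_vertices[OF t])
        moreover have "sgn ((1 - s) * slope H (im_vec z) +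
            s * (\<Sum>v\<in>vertices A w. t v * (level H (fst v) - level H (snd v)))) = sgn (slope H (im_vec z))"
        proof (intro sgn_convex_combination[OF nz s(1) s1] order_complexD(1)[OF t])
          fix v assume "t v \<noteq> 0"
          from V[OF this] H True have "level H (fst v) = 0" "sgn (slope H (im_vec z)) = - sgn (level H (snd v))"
            using sgn_0_iff[of "level H (re_vec z)" "level H (fst v)"] by (auto simp: vertex_nhd_def)
          then show "level H (fst v) - level H (snd v) = 0 \<or>
              sgn (level H (fst v) - level H (snd v)) = sgn (slope H (im_vec z))"
            by (simp add: sgn_minus)
        qed
        ultimately have "sgn (slope H (im_vec z')) = sgn (slope H (im_vec z))" by simp
        with nz show ?thesis using sgn_0_iff by blast
      qed
      then show ?thesis by (simp add: complexified_complement_eq)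
    qed
  qed
qed

end

section \<open>The Salvetti complex as a realization\<close>

text \<open>The order is descending, the least element coming last, to match the chains
  \<open>F\<^sub>0 > ... > F\<^sub>k\<close> of the Salvetti complex.\<close>

lemma (in finite_poset) enumerate_chain:
  assumes "finite S" "S \<noteq> {}" "S \<subseteq> P" "\<And>p q. p \<in> S \<Longrightarrow> q \<in> S \<Longrightarrow> le p q \<or> le q p"
  shows "\<exists>k v. v ` {..k::nat} = S \<and> inj_on v {..k} \<and> (\<forall>i j. i \<le> j \<longrightarrow> j \<le> k \<longrightarrow> le (v j) (v i))"
  using assms
proof (induction "card S" arbitrary: S)
  case 0
  then show ?case by simp
next
  case (Suc n)
  have "\<exists>m\<in>S. \<forall>p\<in>S. le m p"
    by (rule finite_chain_least) (use Suc.prems trans in blast)+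
  then obtain m where m: "m \<in> S" "\<And>p. p \<in> S \<Longrightarrow> le m p" by blast
  show ?case
  proof (cases "S = {m}")
    case True
    then show ?thesis using m(2)[OF m(1)] by (intro exI[of _ 0] exI[of _ "\<lambda>_. m"]) auto
  next
    case False
    have "\<exists>k v. v ` {..k::nat} = S - {m} \<and> inj_on v {..k} \<and> (\<forall>i j. i \<le> j \<longrightarrow> j \<le> k \<longrightarrow> le (v j) (v i))"
    proof (rule Suc.hyps(1))
      show "n = card (S - {m})" using Suc.hyps(2) m(1) Suc.prems(1) by simp
    qed (use Suc.prems m(1) False in auto)
    then obtain k v where v: "v ` {..k::nat} = S - {m}" "inj_on v {..k}"
      "\<And>i j. i \<le> j \<Longrightarrow> j \<le> k \<Longrightarrow> le (v j) (v i)" by blast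
    let ?v = "v(Suc k := m)"
    have eq: "?v i = v i" if "i \<le> k" for i using that by simp
    have vS: "v i \<in> S" if "i \<le> k" for i using v(1) that by blast
    have img: "?v ` {..k} = S - {m}" using v(1) eq by (metis atMost_iff image_cong)
    have "?v ` {..Suc k} = insert (?v (Suc k)) (?v ` {..k})"
      unfolding atMost_Suc image_insert ..
    then have "?v ` {..Suc k} = S" unfolding img using m(1) by auto
    moreover have "inj_on ?v {..Suc k}"
    proof -
      have "inj_on ?v {..k}" using v(2) eq by (metis atMost_iff inj_on_cong)
      then show ?thesis unfolding atMost_Suc using img by (subst inj_on_insert) auto
    qed
    moreover have "le (?v j) (?v i)" if ij: "i \<le> j" "j \<le> Suc k" for i j
    proof (cases "j = Suc k")
      case True
      then show ?thesis using m vS[of i] ij(1) by (cases "i = Suc k") auto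
    next
      case False
      then show ?thesis using ij v(3)[of i j] by auto
    qed
    ultimately show ?thesis by blast
  qed
qed

lemma convex_hull_image_eq:
  fixes f :: "'p \<Rightarrow> 'v::real_vector"
  assumes S: "finite S" and inj: "inj_on f S"
  shows "convex hull (f ` S) =
    weighted_sum f ` {t. (\<forall>p. 0 \<le> t p) \<and> (\<forall>p. t p \<noteq> 0 \<longrightarrow> p \<in> S) \<and> sum t S = 1}"
proof (intro equalityI subsetI)
  fix z assume "z \<in> convex hull (f ` S)"
  then obtain u where u: "\<forall>x\<in>f ` S. 0 \<le> u x" "sum u (f ` S) = 1" "(\<Sum>x\<in>f ` S. u x *\<^sub>R x) = z"
    using convex_hull_finite[OF finite_imageI[OF S, of f]] by auto
  define t where "t = (\<lambda>p. if p \<in> S then u (f p) else 0)"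
  have "weighted_sum f t = (\<Sum>p\<in>S. t p *\<^sub>R f p)"
    by (rule weighted_sum_eq[OF S]) (simp add: t_def split: if_splits)
  also have "\<dots> = z" using u(3) inj by (simp add: t_def sum.reindex)
  finally have "weighted_sum f t = z" .
  moreover have "sum t S = 1" using u(2) inj by (simp add: t_def sum.reindex)
  moreover have "0 \<le> t p" "t p \<noteq> 0 \<longrightarrow> p \<in> S" for p using u(1) by (auto simp: t_def)
  ultimately show "z \<in> weighted_sum f ` {t. (\<forall>p. 0 \<le> t p) \<and> (\<forall>p. t p \<noteq> 0 \<longrightarrow> p \<in> S) \<and> sum t S = 1}"
    by blast
next
  fix z assume "z \<in> weighted_sum f ` {t. (\<forall>p. 0 \<le> t p) \<and> (\<forall>p. t p \<noteq> 0 \<longrightarrow> p \<in> S) \<and> sum t S = 1}"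
  then obtain t where t: "\<And>p. 0 \<le> t p" "\<And>p. t p \<noteq> 0 \<Longrightarrow> p \<in> S" "sum t S = 1" "z = weighted_sum f t"
    by blast
  have "(\<Sum>p\<in>S. t p *\<^sub>R f p) \<in> convex hull (f ` S)"
    using t(1,3) by (intro convex_sum[OF S convex_convex_hull]) (auto intro: hull_inc)
  moreover have "weighted_sum f t = (\<Sum>p\<in>S. t p *\<^sub>R f p)"
    by (rule weighted_sum_eq[OF S]) (rule t(2))
  ultimately show "z \<in> convex hull (f ` S)"
    using t(4) by simp
qed

context pointed_arrangement
begin

lemma face_at_w_face_at [simp]: "face_at A (w (face_at A x)) = face_at A x"
  by (simp add: face_at_w)

lemma sgn_level_w: "H \<in> A \<Longrightarrow> sgn (level H (w (face_at A x))) = sgn (level H x)"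
  using face_at_w_face_at[of x] unfolding face_at_eq_iff by blast

lemma faces_cases:
  assumes "F \<in> faces A"
  obtains x where "F = face_at A x" "w F = x"
  using assms face_at_w by metis

lemma chambers_cases:
  assumes "C \<in> chambers A"
  obtains c where "C = face_at A c" "w C = c" "regular A c"
proof -
  have "C \<in> faces A" using assms by (simp add: chambers_def)
  then obtain c where "C = face_at A c" "w C = c" by (rule faces_cases)
  then show thesis using that assms face_at_in_chambers_iff by blast
qed

lemma chamber_at_cases:
  assumes "regular A c"
  obtains d where "chamber_at A (face_at A x) (face_at A c) = face_at A d" "d = w (face_at A d)"
    "regular A d" "below A d x" "\<And>H. H \<in> A \<Longrightarrow> level H x = 0 \<Longrightarrow> sgn (level H d) = sgn (level H c)"
proof -
  obtain e where e: "\<And>H. H \<in> A \<Longrightarrow>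
      sgn (level H e) = (if level H x = 0 then sgn (level H c) else sgn (level H x))"
    using perturb_towards by blast
  have 1: "chamber_at A (face_at A x) (face_at A c) = face_at A e"
    by (rule chamber_at_eq[OF assms e])
  define d where "d = w (face_at A e)"
  have d: "sgn (level H d) = (if level H x = 0 then sgn (level H c) else sgn (level H x))" if "H \<in> A" for H
    using e[OF that] sgn_level_w[OF that] by (simp add: d_def)
  have face: "face_at A d = face_at A e" by (simp add: d_def)
  have "level H d \<noteq> 0" if H: "H \<in> A" for H
    using d[OF H] sgn_0_iff[of "level H d"] assms H unfolding regular_def by presburger
  then have "regular A d" by (simp add: regular_def)
  moreover have "below A d x" using d by (simp add: below_def)
  ultimately show thesis using that[of d] 1 face d d_def by auto
qed

lemma vertex_pair:
  assumes "v \<in> vertices A w"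
  shows "fst v = w (face_at A (fst v))" "snd v = w (face_at A (snd v))" "regular A (snd v)" "below A (snd v) (fst v)"
  using assms in_vertices_iff[of "fst v" "snd v"] by auto

text \<open>Consequently a chain of vertices has at most one vertex over each face, and its faces
  form a strict chain.\<close>

lemma vertex_le_fst_eq:
  assumes "u \<in> vertices A w" "v \<in> vertices A w" "vertex_le A u v" "face_at A (fst u) = face_at A (fst v)"
  shows "u = v"
proof -
  have "fst u = fst v" using vertex_pair(1)[OF assms(1)] vertex_pair(1)[OF assms(2)] assms(4) by simp
  then have "vertex_le A v u" using assms(3) by (simp add: vertex_le_def)
  then show ?thesis using vertex_le_antisym assms(1-3) by blast
qed

text \<open>The chambers of a simplex enter only through \<open>(C\<^sub>0)\<^sub>F\<close> for the
  faces \<open>F\<close> of its chain, and the resulting vertices form a chain. Conversely, a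
  supporting chain, listed downwards, supplies both the faces and the chambers of a simplex.\<close>

lemma Sal_eq: "Sal A w = weighted_sum vertex_point ` realization"
proof (intro equalityI subsetI)
  fix z assume "z \<in> Sal A w"
  then obtain k F C where z: "z \<in> convex hull ((\<lambda>i. sal_vertex A w (F i) (C i)) ` {..k :: nat})"
    and FC: "\<And>i. i \<le> k \<Longrightarrow> F i \<in> faces A" "\<And>i. i \<le> k \<Longrightarrow> C i \<in> chambers A"
    and F_le: "\<And>i. i < k \<Longrightarrow> face_le (F (Suc i)) (F i)"
    and C_eq: "\<And>i. i \<le> k \<Longrightarrow> chamber_at A (F i) (C 0) = chamber_at A (F i) (C i)"
    unfolding Sal_def sal_simplices_def by blast
  obtain c where c: "C 0 = face_at A c" "regular A c"
    using chambers_cases[OF FC(2)[of 0]] by blast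
  \<comment> \<open>The single chamber \<open>C 0\<close> gives the same vertices, and makes their
    comparability a matter of the signs of one point \<open>c\<close>.\<close>
  define v where "v i = (w (F i), w (chamber_at A (F i) (C 0)))" for i
  have F_eq: "F i = face_at A (w (F i))" if "i \<le> k" for i
    using face_at_w[OF FC(1)[OF that]] by simp
  have v_data: "v i \<in> vertices A w \<and>
      (\<forall>H\<in>A. level H (w (F i)) = 0 \<longrightarrow> sgn (level H (snd (v i))) = sgn (level H c))"
    if i: "i \<le> k" for i
  proof -
    obtain d where d: "chamber_at A (face_at A (w (F i))) (face_at A c) = face_at A d" "d = w (face_at A d)"
      "regular A d" "below A d (w (F i))"
      "\<And>H. H \<in> A \<Longrightarrow> level H (w (F i)) = 0 \<Longrightarrow> sgn (level H d) = sgn (level H c)"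
      using chamber_at_cases[OF c(2)] by blast
    have v: "v i = (w (face_at A (w (F i))), w (face_at A d))"
      unfolding v_def c(1) d(1)[symmetric] F_eq[OF i, symmetric] by simp
    show ?thesis
      unfolding v using vertex_in_vertices[OF d(3,4)] d(5) sgn_level_w by simp
  qed
  have F_below: "below A (w (F j)) (w (F i))" if "i \<le> j" "j \<le> k" for i j
    using that
  proof (induction j rule: dec_induct)
    case (step j)
    have "face_le (face_at A (w (F (Suc j)))) (face_at A (w (F j)))"
      using F_le[of j] F_eq[of j] F_eq[of "Suc j"] step.prems by simp
    then have "below A (w (F (Suc j))) (w (F j))" unfolding face_le_iff .
    then show ?case using step below_trans by auto
  qed simp
  have v_le: "vertex_le A (v j) (v i)" if ij: "i \<le> j" "j \<le> k" for i j
    unfolding vertex_le_def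
  proof (intro conjI ballI impI)
    show b: "below A (fst (v j)) (fst (v i))" using F_below[OF ij] by (simp add: v_def)
    fix H assume H: "H \<in> A" "level H (fst (v j)) = 0"
    then have "level H (w (F j)) = 0" "level H (w (F i)) = 0"
      using below_zero[OF b H] by (simp_all add: v_def)
    then show "sgn (level H (snd (v j))) = sgn (level H (snd (v i)))"
      using v_data[of i] v_data[of j] ij H(1) by simp
  qed
  have "sal_vertex A w (F i) (C i) = vertex_point (v i)" if "i \<le> k" for i
    using C_eq[OF that] by (simp add: sal_vertex_def vertex_point_def v_def)
  then have "(\<lambda>i. sal_vertex A w (F i) (C i)) ` {..k} = vertex_point ` v ` {..k}"
    unfolding image_image by (intro image_cong) auto
  then have "z \<in> convex hull (vertex_point ` v ` {..k})" using z by simp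
  also have "convex hull (vertex_point ` v ` {..k}) = weighted_sum vertex_point `
      {t. (\<forall>p. 0 \<le> t p) \<and> (\<forall>p. t p \<noteq> 0 \<longrightarrow> p \<in> v ` {..k}) \<and> sum t (v ` {..k}) = 1}"
    by (intro convex_hull_image_eq inj_on_subset[OF inj_vertex_point subset_UNIV]) simp
  finally obtain t where t: "\<And>p. 0 \<le> t p" "\<And>p. t p \<noteq> 0 \<Longrightarrow> p \<in> v ` {..k}" "sum t (v ` {..k}) = 1"
    "z = weighted_sum vertex_point t"
    by blast
  have sub: "v ` {..k} \<subseteq> vertices A w" using v_data by blast
  have "\<forall>p\<in>vertices A w - v ` {..k}. t p = 0" using t(2) by blast
  then have "sum t (vertices A w) = 1"
    using t(3) sum.mono_neutral_right[OF finite_vertices sub, of t] by simp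
  moreover have "vertex_le A p q \<or> vertex_le A q p" if p: "t p \<noteq> 0" and q: "t q \<noteq> 0" for p q
  proof -
    obtain i j where "p = v i" "q = v j" "i \<le> k" "j \<le> k"
      using t(2)[OF p] t(2)[OF q] by auto
    then show ?thesis using v_le[of i j] v_le[of j i] by (cases "i \<le> j") auto
  qed
  ultimately have "t \<in> realization"
    unfolding in_order_complex_iff[OF finite_vertices] using t(1,2) sub by blast
  then show "z \<in> weighted_sum vertex_point ` realization" using t(4) by blast
next
  fix z assume "z \<in> weighted_sum vertex_point ` realization"
  then obtain t where t: "t \<in> realization" and z: "z = weighted_sum vertex_point t" by blast
  define S where "S = {p. t p \<noteq> 0}"
  have S: "S \<subseteq> vertices A w"
    unfolding S_def using order_complexD(2)[OF t] by (rule subsetI) simp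
  have fin: "finite S" by (rule finite_subset[OF S finite_vertices])
  obtain p where "t p \<noteq> 0" by (rule order_complex_nonzero[OF t])
  then have ne: "S \<noteq> {}" unfolding S_def by blast
  have chain: "vertex_le A p q \<or> vertex_le A q p" if "p \<in> S" "q \<in> S" for p q
    using that unfolding S_def by (intro order_complexD(3)[OF t]) simp_all
  obtain k v where v: "v ` {..k::nat} = S" "inj_on v {..k}"
    and v_le: "\<And>i j. i \<le> j \<Longrightarrow> j \<le> k \<Longrightarrow> vertex_le A (v j) (v i)"
    using enumerate_chain[OF fin ne S chain] by blast
  have vV: "v i \<in> vertices A w" if "i \<le> k" for i using v(1) S that by blast
  define F C where "F i = face_at A (fst (v i))" and "C i = face_at A (snd (v i))" for i
  \<comment> \<open>Restricting the chamber of an earlier, larger vertex to a later face gives the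
    later chamber; \<open>j = 0\<close> and \<open>j = i\<close> yield the compatibility
    condition.\<close>
  have chamber: "chamber_at A (F i) (C j) = C i" if ij: "j \<le> i" "i \<le> k" for i j
    unfolding F_def C_def
  proof (rule chamber_at_eq)
    show "regular A (snd (v j))" using vertex_pair(3)[OF vV] ij by simp
    show "sgn (level H (snd (v i))) = (if level H (fst (v i)) = 0 then sgn (level H (snd (v j))) else sgn (level H (fst (v i))))"
      if "H \<in> A" for H
      using v_le[OF ij] vertex_pair(4)[OF vV[OF ij(2)]] that by (auto simp: vertex_le_def below_def)
  qed
  have sal: "sal_vertex A w (F i) (C i) = vertex_point (v i)" if "i \<le> k" for i
    unfolding sal_vertex_def chamber[OF order_refl that] vertex_point_def
    using vertex_pair(1,2)[OF vV[OF that]] by (simp add: F_def C_def)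
  have "(\<lambda>i. sal_vertex A w (F i) (C i)) ` {..k} = vertex_point ` S"
    unfolding v(1)[symmetric] image_image using sal by (intro image_cong) auto
  moreover have "z \<in> convex hull (vertex_point ` S)"
  proof -
    have "sum t S = 1"
      using order_complex_sum[OF t finite_vertices] sum.mono_neutral_right[OF finite_vertices S, of t]
      by (auto simp: S_def)
    then have "t \<in> {t. (\<forall>p. 0 \<le> t p) \<and> (\<forall>p. t p \<noteq> 0 \<longrightarrow> p \<in> S) \<and> sum t S = 1}"
      using order_complexD(1)[OF t] by (auto simp: S_def)
    then show ?thesis
      using convex_hull_image_eq[OF fin inj_on_subset[OF inj_vertex_point subset_UNIV]] z by blast
  qed
  moreover have "convex hull ((\<lambda>i. sal_vertex A w (F i) (C i)) ` {..k}) \<in> sal_simplices A w"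
    unfolding sal_simplices_def
  proof (intro CollectI exI conjI allI impI)
    show "convex hull ((\<lambda>i. sal_vertex A w (F i) (C i)) ` {..k}) = convex hull ((\<lambda>i. sal_vertex A w (F i) (C i)) ` {..k})" ..
    show "F i \<in> faces A" for i by (simp add: F_def)
    show "C i \<in> chambers A" if "i \<le> k" for i
      unfolding C_def face_at_in_chambers_iff using vertex_pair(3)[OF vV[OF that]] .
    show "face_le (F (Suc i)) (F i)" if "i < k" for i
      unfolding F_def face_le_iff using v_le[of i "Suc i"] that by (simp add: vertex_le_def)
    show "F (Suc i) \<noteq> F i" if "i < k" for i
    proof
      assume "F (Suc i) = F i"
      then have "v (Suc i) = v i"
        using vertex_le_fst_eq[of "v (Suc i)" "v i"] vV that v_le[of i "Suc i"] by (simp add: F_def)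
      then show False using v(2) that by (auto dest: inj_onD)
    qed
    show "chamber_at A (F i) (C 0) = chamber_at A (F i) (C i)" if "i \<le> k" for i
      using chamber[OF _ that, of 0] chamber[OF _ that, of i] by simp
  qed
  ultimately show "z \<in> Sal A w" unfolding Sal_def by auto
qed

end

section \<open>The two diagrams\<close>

lemma face_le_refl [simp]: "face_le F F"
  by (simp add: face_le_def)

lemma face_le_trans: "face_le F G \<Longrightarrow> face_le G K \<Longrightarrow> face_le F K"
  by (auto simp: face_le_def)

lemma (in hyperplane_arrangement) finite_poset_faces: "finite_poset (faces A) face_le"
proof
  fix F G assume F: "F \<in> faces A" and G: "G \<in> faces A" and le: "face_le F G" "face_le G F"
  obtain x y where xy: "F = face_at A x" "G = face_at A y" using F G unfolding faces_eq by blast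
  have "below A x y" "below A y x" using le unfolding xy face_le_iff .
  then show "F = G" unfolding xy face_at_eq_iff using below_antisym by blast
qed (use finite_faces face_le_trans in auto)

section \<open>The diagram of Salvetti complexes of localizations\<close>

context pointed_arrangement
begin

definition vertices_below :: "(real ^ 'n) set \<Rightarrow> ((real ^ 'n) \<times> (real ^ 'n)) set" where
  "vertices_below F = {v \<in> vertices A w. face_le (face_at A (fst v)) F}"

text \<open>All faces below \<open>F\<close> have the signs of \<open>F\<close> on the hyperplanes
  that do not contain it. So for them signs with respect to \<open>A\<close> and to the localization
  carry the same information, and \<open>Sal_eq\<close> for the localization has the same vertices
  and order.\<close>

lemma Sal_localization:
  assumes "F \<in> faces A"
  shows "Sal (localization A F) (w \<circ> local_face A F) =
    weighted_sum vertex_point ` order_complex (vertices_below F) (vertex_le A)"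
proof -
  obtain f where F: "F = face_at A f" using assms unfolding faces_eq by blast
  define B where "B = localization A F"
  define w' where "w' = w \<circ> local_face A F"
  have B: "B = {H \<in> A. level H f = 0}" unfolding B_def F by (rule localization_face_at)
  interpret B: hyperplane_arrangement B by (rule sub_arrangement) (auto simp: B)
  have agree: "sgn (level H x) = sgn (level H y)" if "below A x f" "below A y f" "H \<in> A" "H \<notin> B" for H x y
  proof -
    have "level H f \<noteq> 0" using that(3,4) by (simp add: B)
    then show ?thesis using belowD[OF that(1,3)] belowD[OF that(2,3)] by simp
  qed
  have below_iff: "below B x y \<longleftrightarrow> below A x y" if "below A x f" "below A y f" for x y
  proof
    assume "below B x y"
    then show "below A x y" unfolding below_def using agree[OF that] by blast
  qed (auto simp: below_def B)
  have face_iff: "face_at B x = face_at B y \<longleftrightarrow> face_at A x = face_at A y" if "below A x f" "below A y f" for x y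
    unfolding face_at_eq_iff using agree[OF that] B by blast
  have regular_iff: "regular B c \<longleftrightarrow> regular A c" if "below A c f" for c
  proof
    assume reg: "regular B c"
    have "level H c \<noteq> 0" if H: "H \<in> A" for H
    proof (cases "H \<in> B")
      case False
      then have "level H f \<noteq> 0" using H by (simp add: B)
      then show ?thesis using below_zero[OF \<open>below A c f\<close> H] by blast
    qed (use reg in \<open>simp add: regular_def\<close>)
    then show "regular A c" by (simp add: regular_def)
  qed (simp add: regular_def B)
  have facesB: "\<exists>x. G' = face_at B x \<and> below A x f" if "G' \<in> faces B" for G'
  proof -
    obtain y where y: "G' = face_at B y" using \<open>G' \<in> faces B\<close> unfolding B.faces_eq by blast
    \<comment> \<open>A small step from \<open>f\<close> towards \<open>y\<close> has the signs of
      \<open>y\<close> on the localization and stays below \<open>f\<close>.\<close>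
    obtain x where x: "\<And>H. H \<in> A \<Longrightarrow> sgn (level H x) = (if level H f = 0 then sgn (level H y) else sgn (level H f))"
      using perturb_towards by blast
    have "face_at B y = face_at B x" unfolding face_at_eq_iff using x by (simp add: B)
    moreover have "below A x f" using x by (simp add: below_def)
    ultimately show ?thesis using y by blast
  qed
  have sub: "face_at A x \<subseteq> face_at B x" for x by (auto simp: face_at_def B)
  have containing: "containing_face B (face_at A x) = face_at B x" for x
    unfolding containing_face_def
  proof (rule the_equality)
    show "face_at B x \<in> faces B \<and> face_at A x \<subseteq> face_at B x" using sub by simp
    fix G' assume G': "G' \<in> faces B \<and> face_at A x \<subseteq> G'"
    then obtain y where y: "G' = face_at B y" unfolding B.faces_eq by blast
    have "x \<in> face_at B y" using G' y face_at_self by blast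
    then show "G' = face_at B x" unfolding y in_face_at_iff by simp
  qed
  have inj: "inj_on (containing_face B) {G \<in> faces A. face_le G F}"
  proof (rule inj_onI)
    fix G G' assume G: "G \<in> {G \<in> faces A. face_le G F}" and G': "G' \<in> {G \<in> faces A. face_le G F}"
      and eq: "containing_face B G = containing_face B G'"
    obtain x y where xy: "G = face_at A x" "G' = face_at A y" using G G' unfolding faces_eq by blast
    have "below A x f" "below A y f" using G G' unfolding xy F by (simp_all add: face_le_iff)
    then show "G = G'" using eq face_iff unfolding xy containing by blast
  qed
  have w': "w' (face_at B x) = w (face_at A x)" if "below A x f" for x
  proof -
    have "face_at A x \<in> {G \<in> faces A. face_le G F}" using that by (simp add: F face_le_iff)
    from the_inv_into_f_f[OF inj this] show ?thesis
      by (simp add: w'_def local_face_def B_def[symmetric] containing)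
  qed
  have w_below: "below A (w (face_at A x)) y \<longleftrightarrow> below A x y" for x y
    by (rule face_at_cong(1)) simp_all
  interpret B: pointed_arrangement B w'
  proof
    fix G' assume "G' \<in> faces B"
    then obtain x where x: "G' = face_at B x" "below A x f" using facesB by blast
    have "w (face_at A x) \<in> face_at B x" using w_in[OF face_at_in_faces] sub by blast
    then show "w' G' \<in> G'" by (simp add: x w')
  qed
  have "vertices B w' = vertices_below F"
  proof (intro equalityI subsetI)
    fix v assume "v \<in> vertices B w'"
    then obtain G' C' where GC: "v = (w' G', w' C')" "G' \<in> faces B" "C' \<in> chambers B" "face_le C' G'"
      unfolding vertices_def by blast
    obtain x where x: "G' = face_at B x" "below A x f" using facesB[OF GC(2)] by blast
    have "C' \<in> faces B" using GC(3) by (simp add: chambers_def)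
    then obtain c where c: "C' = face_at B c" "below A c f" using facesB by blast
    have "regular A c" using GC(3) c B.face_at_in_chambers_iff regular_iff by simp
    moreover have "below A c x" using GC(4) below_iff[OF c(2) x(2)] by (simp add: c(1) x(1) B.face_le_iff)
    ultimately have "(w (face_at A x), w (face_at A c)) \<in> vertices A w" by (rule vertex_in_vertices)
    then show "v \<in> vertices_below F"
      using x c by (simp add: GC(1) w' vertices_below_def F face_le_iff w_below)
  next
    fix v assume "v \<in> vertices_below F"
    then have v: "v \<in> vertices A w" and "face_le (face_at A (fst v)) F" by (auto simp: vertices_below_def)
    then have g: "below A (fst v) f" by (simp add: F face_le_iff)
    note p = vertex_pair[OF v]
    have c: "below A (snd v) f" using below_trans[OF p(4) g] .
    have "(w' (face_at B (fst v)), w' (face_at B (snd v))) \<in> vertices B w'"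
      using p(3,4) regular_iff[OF c] below_iff[OF c g] by (intro B.vertex_in_vertices) simp_all
    then show "v \<in> vertices B w'"
      using p(1,2) w'[OF g] w'[OF c] by (metis prod.collapse)
  qed
  moreover have "order_complex (vertices_below F) (vertex_le B) = order_complex (vertices_below F) (vertex_le A)"
  proof (rule order_complex_cong)
    fix u v assume "u \<in> vertices_below F" "v \<in> vertices_below F"
    then have uv: "below A (fst u) f" "below A (fst v) f"
      by (simp_all add: vertices_below_def F face_le_iff)
    \<comment> \<open>The clause on chambers concerns hyperplanes through the smaller face only, and
      these contain \<open>F\<close>.\<close>
    have "H \<in> B" if "H \<in> A" "level H (fst u) = 0" for H
      using below_zero[OF uv(1) that] that(1) by (simp add: B)
    then show "vertex_le B u v \<longleftrightarrow> vertex_le A u v"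
      unfolding vertex_le_def below_iff[OF uv] using B by blast
  qed
  ultimately show ?thesis
    using B.Sal_eq by (simp add: B_def[symmetric] w'_def[symmetric])
qed

lemma E_space_eq:
  assumes "F \<in> faces A"
  shows "E_space A w F = top_of_set (weighted_sum vertex_point ` order_complex (vertices_below F) (vertex_le A))"
  unfolding E_space_def Sal_localization[OF assms] ..

lemma realization_vertices_below: "order_complex (vertices_below F) (vertex_le A) \<subseteq> realization"
  by (rule order_complex_mono) (auto simp: vertices_below_def)

lemma hocolim_E_homotopy_equivalent: "hocolim_E A w homotopy_equivalent_space top_of_set realization"
proof -
  interpret faces: finite_poset "faces A" face_le by (rule finite_poset_faces)
  let ?\<sigma> = "weighted_sum vertex_point"
  let ?\<Delta> = "\<lambda>F. order_complex (vertices_below F) (vertex_le A)"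
  let ?\<Delta>F = "order_complex (faces A) face_le"
  let ?le = "\<lambda>F G. face_le G F"
  let ?upper = "\<lambda>F. order_complex {G \<in> faces A. face_le F G} ?le"
  define coord where "coord = the_inv_into realization ?\<sigma>"
  have coord: "coord (?\<sigma> t) = t" if "t \<in> realization" for t
    unfolding coord_def by (rule the_inv_into_f_f[OF inj_on_weighted_sum that])
  have upper: "?upper F \<subseteq> ?\<Delta>F" for F
    unfolding order_complex_dual[of _ face_le] by (rule order_complex_mono) blast
  have cont_coord: "continuous_on (?\<sigma> ` realization) coord"
  proof -
    obtain g where g: "homeomorphic_maps (top_of_set realization) (top_of_set (?\<sigma> ` realization)) ?\<sigma> g"
      using homeomorphic_map_weighted_sum unfolding homeomorphic_map_maps by blast
    then have "continuous_on (?\<sigma> ` realization) g"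
      unfolding homeomorphic_maps_def by simp
    moreover have "g z = coord z" if "z \<in> ?\<sigma> ` realization" for z
      using g that coord unfolding homeomorphic_maps_def by auto
    ultimately show ?thesis by (metis continuous_on_cong)
  qed
  let ?T = "top_of_set (realization \<times> ?\<Delta>F)"
  let ?S = "{(coord z, s) | F z s. F \<in> faces A \<and> z \<in> topspace (E_space A w F) \<and> s \<in> ?upper F}"
  have "hocolim (faces A) ?le (E_space A w) (\<lambda>F1 F2 z. z) homeomorphic_space
      subtopology ?T {(coord z, s) | F z s. F \<in> faces A \<and> z \<in> topspace (E_space A w F) \<and> s \<in> ?upper F}"
  proof (rule hocolim_homeomorphic)
    show "finite (faces A)" by (rule finite_faces)
    show "Hausdorff_space ?T"
      by (simp add: Hausdorff_space_prod_topology Hausdorff_top_of_set_fun flip: prod_topology_subtopology_eu)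
    fix F assume F: "F \<in> faces A"
    have fin: "finite (vertices_below F)" using finite_vertices by (simp add: vertices_below_def)
    have sub: "?\<sigma> ` ?\<Delta> F \<subseteq> ?\<sigma> ` realization" using realization_vertices_below by blast
    have "compact (?\<sigma> ` ?\<Delta> F)"
      using compact_order_complex[OF fin] continuous_on_subset[OF continuous_on_weighted_sum realization_vertices_below]
      by (intro compact_continuous_image)
    then show "compact_space (E_space A w F)"
      unfolding E_space_eq[OF F] by (simp add: compact_space_subtopology)
    have "continuous_on (?\<sigma> ` ?\<Delta> F \<times> ?upper F) (\<lambda>x. (coord (fst x), snd x))"
      by (intro continuous_on_Pair continuous_on_compose2[OF continuous_on_subset[OF cont_coord sub]]
          continuous_on_fst continuous_on_snd continuous_on_id) auto
    moreover have "(\<lambda>x. (coord (fst x), snd x)) \<in> ?\<sigma> ` ?\<Delta> F \<times> ?upper F \<rightarrow> realization \<times> ?\<Delta>F"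
      using coord realization_vertices_below[of F] upper[of F] by auto
    ultimately show "continuous_map (prod_topology (E_space A w F) (top_of_set (?upper F))) ?T (\<lambda>(z, s). (coord z, s))"
      unfolding E_space_eq[OF F] prod_topology_subtopology_eu by (simp add: case_prod_beta')
    fix z s F' z' s'
    assume z: "z \<in> topspace (E_space A w F)" and s: "s \<in> ?upper F" and F': "F' \<in> faces A"
      and z': "z' \<in> topspace (E_space A w F')" and s': "s' \<in> ?upper F'" and eq: "(coord z, s) = (coord z', s')"
    have "z \<in> ?\<sigma> ` realization" "z' \<in> ?\<sigma> ` realization"
      using z z' realization_vertices_below unfolding E_space_eq[OF F] E_space_eq[OF F'] by auto
    then have "z = z'" using eq coord by auto
    \<comment> \<open>Two points with the same image meet over the least face in the support of
      \<open>s\<close>: in the opposite poset it is below both indices, and the maps are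
      inclusions.\<close>
    obtain m where m: "m \<in> faces A" "s m \<noteq> 0" "\<And>G. s G \<noteq> 0 \<Longrightarrow> face_le m G"
      using faces.least[of s] s upper by blast
    have "face_le F m" "face_le F' m"
      using order_complexD(2)[OF s m(2)] order_complexD(2)[of s'] s' eq m(2) by auto
    moreover have "s \<in> ?upper m"
      using m(3) order_complexD(2)[OF s] by (intro order_complex_restrict[OF s]) auto
    ultimately show "s = s' \<and> (\<exists>q\<in>faces A. face_le F q \<and> face_le F' q \<and> s \<in> ?upper q \<and>
        (if q = F then z else z) = (if q = F' then z' else z'))"
      using m(1) eq \<open>z = z'\<close> by auto
  qed simp
  also have "?S = {(t, s). t \<in> realization \<and> s \<in> ?\<Delta>F \<and>
      (\<forall>v G. t v \<noteq> 0 \<longrightarrow> s G \<noteq> 0 \<longrightarrow> face_le (face_at A (fst v)) G)}" (is "_ = ?Y")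
  proof (intro equalityI subsetI)
    fix y assume "y \<in> ?S"
    then obtain F z s where y: "y = (coord z, s)" "F \<in> faces A" "z \<in> topspace (E_space A w F)" "s \<in> ?upper F"
      by blast
    then obtain t where t: "z = ?\<sigma> t" "t \<in> ?\<Delta> F" unfolding E_space_eq[OF y(2)] by auto
    have tr: "t \<in> realization" using t(2) realization_vertices_below by blast
    have "face_le (face_at A (fst v)) G" if "t v \<noteq> 0" "s G \<noteq> 0" for v G
      using order_complexD(2)[OF t(2) that(1)] order_complexD(2)[OF y(4) that(2)] face_le_trans
      by (auto simp: vertices_below_def)
    moreover have "s \<in> ?\<Delta>F" using upper[of F] y(4) by blast
    ultimately show "y \<in> ?Y" using y(1) tr t(1) coord[OF tr] by auto
  next
    fix y assume "y \<in> ?Y"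
    then obtain t s where y: "y = (t, s)" "t \<in> realization" "s \<in> ?\<Delta>F"
      "\<And>v G. t v \<noteq> 0 \<Longrightarrow> s G \<noteq> 0 \<Longrightarrow> face_le (face_at A (fst v)) G"
      by blast
    obtain m where m: "m \<in> faces A" "s m \<noteq> 0" "\<And>G. s G \<noteq> 0 \<Longrightarrow> face_le m G"
      using faces.least[OF y(3)] by blast
    \<comment> \<open>The least support face indexes the smallest of the subcomplexes, and
      \<open>t\<close> lies in it by assumption.\<close>
    have "t \<in> ?\<Delta> m"
      using y(4)[OF _ m(2)] order_complexD(2)[OF y(2)]
      by (intro order_complex_restrict[OF y(2)]) (auto simp: vertices_below_def)
    then have "?\<sigma> t \<in> topspace (E_space A w m)" unfolding E_space_eq[OF m(1)] by simp
    moreover have "s \<in> ?upper m"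
      unfolding order_complex_dual[of _ face_le]
      using m(3) order_complexD(2)[OF y(3)] by (intro order_complex_restrict[OF y(3)]) auto
    ultimately show "y \<in> ?S" using m(1) coord[OF y(2)] y(1) by (auto intro!: exI[of _ "?\<sigma> t"])
  qed
  also have "subtopology ?T ?Y = top_of_set ?Y"
  proof -
    have "(realization \<times> ?\<Delta>F) \<inter> ?Y = ?Y" by auto
    then show ?thesis by (simp add: subtopology_subtopology)
  qed
  finally have "hocolim_E A w homotopy_equivalent_space top_of_set ?Y"
    unfolding hocolim_E_def by (rule homeomorphic_imp_homotopy_equivalent_space)
  also have "?Y homotopy_eqv realization"
  proof (rule cover_hocolim_homotopy_eqv)
    show "finite_poset (vertices A w) (vertex_le A)" by unfold_locales
    show "(\<lambda>v. face_at A (fst v)) ` vertices A w \<subseteq> faces A" by auto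
    show "face_le (face_at A (fst u)) (face_at A (fst v))" if "vertex_le A u v" for u v
      using that by (simp add: face_le_iff vertex_le_def)
  qed (use finite_faces face_le_trans in blast)+
  finally show ?thesis .
qed

end

section \<open>The diagram of chambers\<close>

lemma continuous_map_discrete_prod:
  assumes "\<And>s. s \<in> S \<Longrightarrow> continuous_map X Y (f s)"
  shows "continuous_map (prod_topology (discrete_topology S) X) Y (\<lambda>(s, x). f s x)"
  unfolding continuous_map_def
proof (intro conjI allI impI)
  show "(\<lambda>(s, x). f s x) \<in> topspace (prod_topology (discrete_topology S) X) \<rightarrow> topspace Y"
    using continuous_map_funspace[OF assms] by fastforce
  fix U assume U: "openin Y U"
  have "{p \<in> topspace (prod_topology (discrete_topology S) X). (case p of (s, x) \<Rightarrow> f s x) \<in> U} =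
      (\<Union>s\<in>S. {s} \<times> {x \<in> topspace X. f s x \<in> U})" by auto
  moreover have "openin (prod_topology (discrete_topology S) X) (\<Union>s\<in>S. {s} \<times> {x \<in> topspace X. f s x \<in> U})"
    using openin_continuous_map_preimage[OF assms U] by (intro openin_Union) (auto simp: openin_prod_Times_iff)
  ultimately show "openin (prod_topology (discrete_topology S) X)
      {p \<in> topspace (prod_topology (discrete_topology S) X). (case p of (s, x) \<Rightarrow> f s x) \<in> U}" by simp
qed

context pointed_arrangement
begin

lemma chamber_at_below:
  assumes "regular A c" "below A c x"
  shows "chamber_at A (face_at A x) (face_at A c) = face_at A c"
  by (rule chamber_at_eq[OF assms(1)]) (simp add: belowD[OF assms(2)])

text \<open>Functoriality of the diagram: a hyperplane through the smaller face contains the larger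
  one in this order, so the intermediate chamber still has the sign of \<open>c\<close>
  there.\<close>

lemma chamber_at_chamber_at:
  assumes c: "regular A c" and xy: "below A x y"
  shows "chamber_at A (face_at A x) (chamber_at A (face_at A y) (face_at A c)) =
    chamber_at A (face_at A x) (face_at A c)"
proof -
  obtain d where d: "chamber_at A (face_at A y) (face_at A c) = face_at A d" "d = w (face_at A d)"
    "regular A d" "below A d y" "\<And>H. H \<in> A \<Longrightarrow> level H y = 0 \<Longrightarrow> sgn (level H d) = sgn (level H c)"
    using chamber_at_cases[OF c, of y] by blast
  obtain e where e: "chamber_at A (face_at A x) (face_at A c) = face_at A e" "e = w (face_at A e)"
    "regular A e" "below A e x" "\<And>H. H \<in> A \<Longrightarrow> level H x = 0 \<Longrightarrow> sgn (level H e) = sgn (level H c)"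
    using chamber_at_cases[OF c, of x] by blast
  have "chamber_at A (face_at A x) (face_at A d) = face_at A e"
  proof (rule chamber_at_eq[OF d(3)])
    fix H assume H: "H \<in> A"
    show "sgn (level H e) = (if level H x = 0 then sgn (level H d) else sgn (level H x))"
    proof (cases "level H x = 0")
      case True
      then show ?thesis using d(5)[OF H below_zero[OF xy H True]] e(5)[OF H True] by simp
    next
      case False
      then show ?thesis using belowD[OF e(4) H] by simp
    qed
  qed
  then show ?thesis unfolding d(1) e(1) .
qed

lemma chamber_at_vertex:
  assumes "v \<in> vertices A w" "v' \<in> vertices A w" "vertex_le A v v'"
  shows "chamber_at A (face_at A (fst v)) (face_at A (snd v')) = face_at A (snd v)"
proof (rule chamber_at_eq[OF vertex_pair(3)[OF assms(2)]])
  fix H assume "H \<in> A"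
  then show "sgn (level H (snd v)) = (if level H (fst v) = 0 then sgn (level H (snd v')) else sgn (level H (fst v)))"
    using assms(3) vertex_pair(4)[OF assms(1)] by (auto simp: vertex_le_def below_def)
qed

text \<open>The simplicial map induced by \<open>F \<mapsto> (F, C\<^sub>F)\<close>. The two
  equations test whether a pair of points is the vertex assigned to the face of its first
  component.\<close>

definition lift_point :: "(real ^ 'n) set \<Rightarrow> ((real ^ 'n) set \<Rightarrow> real) \<Rightarrow> (real ^ 'n) \<times> (real ^ 'n) \<Rightarrow> real" where
  "lift_point C t v = (if fst v = w (face_at A (fst v)) \<and> snd v = w (chamber_at A (face_at A (fst v)) C)
     then t (face_at A (fst v)) else 0)"

lemma lift_point_face:
  "F \<in> faces A \<Longrightarrow> lift_point C t (w F, w (chamber_at A F C)) = t F"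
  using face_at_w[of F] by (simp add: lift_point_def)

lemma lift_point_nonzero:
  assumes "lift_point C t v \<noteq> 0"
  shows "v = (w (face_at A (fst v)), w (chamber_at A (face_at A (fst v)) C))" "t (face_at A (fst v)) \<noteq> 0"
    "lift_point C t v = t (face_at A (fst v))"
  using assms by (auto simp: lift_point_def prod_eq_iff split: if_splits)

lemma lift_point_cong:
  assumes "\<And>F. F \<in> faces A \<Longrightarrow> t F \<noteq> 0 \<Longrightarrow> chamber_at A F C = chamber_at A F C'"
  shows "lift_point C t = lift_point C' t"
proof
  fix v
  show "lift_point C t v = lift_point C' t v"
    using assms[of "face_at A (fst v)"] by (cases "t (face_at A (fst v)) = 0") (auto simp: lift_point_def)
qed

lemma lift_point_vertex:
  assumes c: "regular A c" and v: "lift_point (face_at A c) t v \<noteq> 0"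
  shows "v \<in> vertices A w" "\<And>H. H \<in> A \<Longrightarrow> level H (fst v) = 0 \<Longrightarrow> sgn (level H (snd v)) = sgn (level H c)"
proof -
  let ?g = "fst v"
  obtain d where d: "chamber_at A (face_at A ?g) (face_at A c) = face_at A d" "d = w (face_at A d)"
    "regular A d" "below A d ?g"
    "\<And>H. H \<in> A \<Longrightarrow> level H ?g = 0 \<Longrightarrow> sgn (level H d) = sgn (level H c)"
    using chamber_at_cases[OF c, of ?g] by blast
  have v': "v = (w (face_at A ?g), w (face_at A d))"
    using lift_point_nonzero(1)[OF v] unfolding d(1) .
  show "v \<in> vertices A w"
    using vertex_in_vertices[OF d(3,4)] v' by metis
  have "snd v = d" using v' d(2) by (metis snd_conv)
  then show "sgn (level H (snd v)) = sgn (level H c)" if "H \<in> A" "level H (fst v) = 0" for H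
    using d(5) that by simp
qed

text \<open>All chambers \<open>C\<^sub>F\<close> agree with \<open>C\<close> on the hyperplanes
  through \<open>F\<close>, so comparable faces give comparable vertices. Distinct faces give
  distinct vertices, which preserves the total mass.\<close>

lemma lift_point_in_realization:
  assumes C: "C \<in> chambers A" and t: "t \<in> order_complex (faces A) face_le"
  shows "lift_point C t \<in> realization"
proof -
  obtain c where c: "C = face_at A c" "regular A c" using chambers_cases[OF C] by blast
  show ?thesis
    unfolding in_order_complex_iff[OF finite_vertices]
  proof (intro conjI allI impI)
    show "0 \<le> lift_point C t v" for v
      using order_complexD(1)[OF t] by (simp add: lift_point_def)
    show "v \<in> vertices A w" if "lift_point C t v \<noteq> 0" for v
      using lift_point_vertex(1)[OF c(2)] that unfolding c(1) by blast
    show "vertex_le A u v \<or> vertex_le A v u" if u: "lift_point C t u \<noteq> 0" and v: "lift_point C t v \<noteq> 0" for u v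
    proof -
      have "vertex_le A u v" if u: "lift_point C t u \<noteq> 0" and v: "lift_point C t v \<noteq> 0"
        and b: "below A (fst u) (fst v)" for u v
        unfolding vertex_le_def
      proof (intro conjI ballI impI b)
        fix H assume H: "H \<in> A" "level H (fst u) = 0"
        then show "sgn (level H (snd u)) = sgn (level H (snd v))"
          using lift_point_vertex(2)[OF c(2) u[unfolded c(1)] H]
            lift_point_vertex(2)[OF c(2) v[unfolded c(1)] H(1) below_zero[OF b H]] by simp
      qed
      moreover have "below A (fst u) (fst v) \<or> below A (fst v) (fst u)"
        using order_complexD(3)[OF t lift_point_nonzero(2)[OF u] lift_point_nonzero(2)[OF v]]
        unfolding face_le_iff .
      ultimately show ?thesis using u v by blast
    qed
    let ?\<phi> = "\<lambda>F. (w F, w (chamber_at A F C))"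
    have zero: "lift_point C t v = 0" if "v \<in> vertices A w - ?\<phi> ` faces A" for v
    proof (rule ccontr)
      assume nz: "lift_point C t v \<noteq> 0"
      have "v \<in> ?\<phi> ` faces A"
        by (rule image_eqI[where f = ?\<phi>, OF lift_point_nonzero(1)[OF nz] face_at_in_faces])
      then show False using that by blast
    qed
    have sub: "?\<phi> ` faces A \<subseteq> vertices A w"
    proof (rule image_subsetI)
      fix F assume F: "F \<in> faces A"
      obtain x where x: "F = face_at A x" using F unfolding faces_eq by blast
      obtain d where d: "chamber_at A F C = face_at A d" "d = w (face_at A d)" "regular A d" "below A d x"
        unfolding c(1) x by (rule chamber_at_cases[OF c(2), of x])
      show "?\<phi> F \<in> vertices A w"
        unfolding d(1) unfolding x by (rule vertex_in_vertices[OF d(3,4)])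
    qed
    have inj: "inj_on ?\<phi> (faces A)"
    proof (rule inj_onI)
      fix F G assume FG: "F \<in> faces A" "G \<in> faces A" and eq: "?\<phi> F = ?\<phi> G"
      have "F = face_at A (w F)" using face_at_w[OF FG(1)] by (rule sym)
      also have "w F = w G" using eq by (rule Pair_inject)
      also have "face_at A (w G) = G" by (rule face_at_w[OF FG(2)])
      finally show "F = G" .
    qed
    have "sum (lift_point C t) (vertices A w) = sum (lift_point C t) (?\<phi> ` faces A)"
      by (rule sum.mono_neutral_right[OF finite_vertices sub]) (rule ballI, rule zero)
    also have "\<dots> = sum t (faces A)"
      unfolding sum.reindex[OF inj] o_def by (rule sum.cong[OF HOL.refl]) (rule lift_point_face)
    finally show "sum (lift_point C t) (vertices A w) = 1"
      using order_complex_sum[OF t finite_faces] by simp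
  qed
qed

text \<open>Besides \<open>t\<close>, only the chambers \<open>C\<^sub>F\<close> for
  \<open>F\<close> in the support are recovered, not \<open>C\<close>; this is the ambiguity that
  gluing removes.\<close>

lemma lift_point_inj:
  assumes t: "t \<in> order_complex (faces A) face_le" and t': "t' \<in> order_complex (faces A) face_le"
    and eq: "lift_point C t = lift_point C' t'"
  shows "t = t'" "\<And>F. t F \<noteq> 0 \<Longrightarrow> w (chamber_at A F C) = w (chamber_at A F C')"
proof -
  have *: "t' F = t F \<and> w (chamber_at A F C) = w (chamber_at A F C')"
    if t: "t \<in> order_complex (faces A) face_le" and eq: "lift_point C t = lift_point C' t'" and "t F \<noteq> 0"
    for t t' C C' F
  proof -
    have F: "F \<in> faces A" using order_complexD(2)[OF t \<open>t F \<noteq> 0\<close>] .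
    let ?v = "(w F, w (chamber_at A F C))"
    have val: "lift_point C' t' ?v = t F" using lift_point_face[OF F, of C t] eq by simp
    then have nz: "lift_point C' t' ?v \<noteq> 0" using \<open>t F \<noteq> 0\<close> by simp
    note nonzero = lift_point_nonzero[OF nz, unfolded fst_conv face_at_w[OF F]]
    show ?thesis using nonzero(1) nonzero(3)[unfolded val] by simp
  qed
  show "t = t'"
  proof
    fix F show "t F = t' F"
    proof (cases "t F = 0")
      case True
      have "t' F = 0"
      proof (rule ccontr)
        assume nz: "t' F \<noteq> 0"
        from *[OF t' eq[symmetric] nz] nz True show False by simp
      qed
      with True show ?thesis by simp
    next
      case False
      from *[OF t eq False] show ?thesis by simp
    qed
  qed
  show "w (chamber_at A F C) = w (chamber_at A F C')" if "t F \<noteq> 0" for F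
    using *[OF t eq that] by blast
qed

text \<open>The chamber of the greatest support vertex determines all others, as
  \<open>chamber_at_vertex\<close> shows. The projection to faces merges no coordinates, since a
  chain has one vertex at most over each face.\<close>

lemma lift_point_surj:
  assumes u: "u \<in> realization"
  obtains F C t where "F \<in> faces A" "C \<in> chambers A" "face_le C F"
    "t \<in> order_complex {G \<in> faces A. face_le G F} face_le" "u = lift_point C t"
proof -
  obtain m where m: "m \<in> vertices A w" "u m \<noteq> 0" "\<And>v. u v \<noteq> 0 \<Longrightarrow> vertex_le A v m"
    using greatest[OF u] by blast
  let ?\<pi> = "\<lambda>v :: (real ^ 'n) \<times> (real ^ 'n). face_at A (fst v)"
  define F C t where "F = ?\<pi> m" and "C = face_at A (snd m)" and "t = push_forward ?\<pi> (vertices A w) u"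
  have uV: "v \<in> vertices A w" if "u v \<noteq> 0" for v using order_complexD(2)[OF u that] .
  have unique: "v = v'" if uv: "u v \<noteq> 0" "u v' \<noteq> 0" and eq: "?\<pi> v = ?\<pi> v'" for v v'
    using order_complexD(3)[OF u uv] vertex_le_fst_eq[OF uV[OF uv(1)] uV[OF uv(2)] _ eq]
      vertex_le_fst_eq[OF uV[OF uv(2)] uV[OF uv(1)] _ eq[symmetric]] by blast
  have t_val: "t (?\<pi> v) = u v" if v: "u v \<noteq> 0" for v
  proof -
    have "t (?\<pi> v) = sum u {v}"
      unfolding t_def push_forward_def
    proof (rule sum.mono_neutral_right)
      show "finite {q \<in> vertices A w. ?\<pi> q = ?\<pi> v}" using finite_vertices by simp
      show "{v} \<subseteq> {q \<in> vertices A w. ?\<pi> q = ?\<pi> v}" using uV[OF v] by simp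
      show "\<forall>q\<in>{q \<in> vertices A w. ?\<pi> q = ?\<pi> v} - {v}. u q = 0"
        using unique[OF v] by blast
    qed
    then show ?thesis by simp
  qed
  have point: "v = (w (?\<pi> v), w (chamber_at A (?\<pi> v) C))" if v: "u v \<noteq> 0" for v
    unfolding C_def chamber_at_vertex[OF uV[OF v] m(1) m(3)[OF v]]
    using vertex_pair(1,2)[OF uV[OF v]] by (simp add: prod_eq_iff)
  have "u v = lift_point C t v" for v
  proof (cases "u v = 0")
    case False
    then show ?thesis
      using point[OF False] t_val[OF False] unfolding lift_point_def by (metis fst_conv snd_conv)
  next
    case True
    show ?thesis
    proof (rule ccontr)
      assume "u v \<noteq> lift_point C t v"
      then have nz: "lift_point C t v \<noteq> 0" using True by simp
      have "t (?\<pi> v) \<noteq> 0" by (rule lift_point_nonzero(2)[OF nz])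
      then obtain v' where v': "?\<pi> v' = ?\<pi> v" "u v' \<noteq> 0"
        unfolding t_def by (rule push_forward_nonzero)
      have "v' = v" using point[OF v'(2)] lift_point_nonzero(1)[OF nz] unfolding v'(1) by simp
      then show False using v'(2) True by simp
    qed
  qed
  then have "u = lift_point C t" by (rule ext)
  moreover have "t \<in> order_complex {G \<in> faces A. face_le G F} face_le"
  proof (rule order_complex_restrict)
    show "t \<in> order_complex (faces A) face_le"
      unfolding t_def
      by (rule push_forward_in_order_complex[OF finite_vertices finite_faces u])
        (auto simp: face_le_iff vertex_le_def)
    fix G assume "t G \<noteq> 0"
    then obtain v where v: "v \<in> vertices A w" "?\<pi> v = G" "u v \<noteq> 0"
      unfolding t_def by (rule push_forward_nonzero)
    have "below A (fst v) (fst m)" using m(3)[OF v(3)] by (simp add: vertex_le_def)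
    then show "G \<in> {G \<in> faces A. face_le G F}"
      unfolding v(2)[symmetric] F_def by (simp add: face_le_iff)
  qed
  moreover have "F \<in> faces A" "C \<in> chambers A" "face_le C F"
    using vertex_pair(3,4)[OF m(1)] by (simp_all add: F_def C_def face_at_in_chambers_iff face_le_iff)
  ultimately show thesis using that by blast
qed

lemma hocolim_Did_homeomorphic: "hocolim_Did A homeomorphic_space top_of_set realization"
proof -
  interpret faces: finite_poset "faces A" face_le by (rule finite_poset_faces)
  let ?lower = "\<lambda>F. order_complex {G \<in> faces A. face_le G F} face_le"
  let ?D = "\<lambda>F. discrete_topology {C \<in> chambers A. face_le C F}"
  let ?T = "top_of_set realization"
  let ?S = "{lift_point C t | F C t. F \<in> faces A \<and> C \<in> topspace (?D F) \<and> t \<in> ?lower F}"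
  have lower: "?lower F \<subseteq> order_complex (faces A) face_le" for F
    by (rule order_complex_mono) blast
  have comp: "chamber_at A G (chamber_at A F C) = chamber_at A G C"
    if "C \<in> chambers A" "F \<in> faces A" "G \<in> faces A" "face_le G F" for C F G
  proof -
    obtain c where c: "C = face_at A c" "regular A c" using chambers_cases[OF \<open>C \<in> chambers A\<close>] by blast
    obtain x y where xy: "F = face_at A y" "G = face_at A x" using \<open>F \<in> faces A\<close> \<open>G \<in> faces A\<close> unfolding faces_eq by blast
    have "below A x y" using \<open>face_le G F\<close> unfolding xy face_le_iff .
    then show ?thesis unfolding c(1) xy by (rule chamber_at_chamber_at[OF c(2)])
  qed
  have self: "chamber_at A F C = C" if "C \<in> chambers A" "F \<in> faces A" "face_le C F" for C F
  proof -
    obtain c where c: "C = face_at A c" "regular A c" using chambers_cases[OF \<open>C \<in> chambers A\<close>] by blast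
    obtain y where y: "F = face_at A y" using \<open>F \<in> faces A\<close> unfolding faces_eq by blast
    have "below A c y" using \<open>face_le C F\<close> unfolding c(1) y face_le_iff .
    then show ?thesis unfolding c(1) y by (rule chamber_at_below[OF c(2)])
  qed
  have "hocolim (faces A) face_le ?D (\<lambda>F1 F2 C. chamber_at A F2 C) homeomorphic_space subtopology ?T ?S"
  proof (rule hocolim_homeomorphic)
    show "finite (faces A)" by (rule finite_faces)
    show "Hausdorff_space ?T" by (rule Hausdorff_top_of_set_fun)
    show "compact_space (?D F)" if "F \<in> faces A" for F
      using finite_faces by (simp add: compact_space_discrete_topology chambers_def)
    show "continuous_map (prod_topology (?D F) (top_of_set (?lower F))) ?T (\<lambda>(C, t). lift_point C t)"
      if "F \<in> faces A" for F
    proof (rule continuous_map_discrete_prod)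
      fix C assume C: "C \<in> {C \<in> chambers A. face_le C F}"
      have "continuous_on (?lower F) (lift_point C)"
      proof (rule continuous_on_coordinatewise_then_product)
        have "continuous_on (?lower F) (\<lambda>t. if b then t K else 0)" for b K
          by (cases b) (simp_all add: continuous_on_coord)
        then show "continuous_on (?lower F) (\<lambda>t. lift_point C t v)" for v
          unfolding lift_point_def .
      qed
      moreover have "lift_point C t \<in> realization" if "t \<in> ?lower F" for t
        using lift_point_in_realization[of C t] C that lower by blast
      ultimately show "continuous_map (top_of_set (?lower F)) ?T (lift_point C)"
        by auto
    qed
    show "lift_point C t = lift_point (chamber_at A G C) t"
      if "F \<in> faces A" "G \<in> faces A" "C \<in> topspace (?D F)" "t \<in> ?lower G" for F G C t
    proof (rule lift_point_cong)
      fix K assume "K \<in> faces A" "t K \<noteq> 0"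
      then have "face_le K G" using order_complexD(2)[OF \<open>t \<in> ?lower G\<close>] by blast
      then show "chamber_at A K C = chamber_at A K (chamber_at A G C)"
        using comp[of C G K] that(2,3) \<open>K \<in> faces A\<close> by simp
    qed
    fix F C t F' C' t'
    assume F: "F \<in> faces A" and C: "C \<in> topspace (?D F)" and t: "t \<in> ?lower F"
      and F': "F' \<in> faces A" and C': "C' \<in> topspace (?D F')" and t': "t' \<in> ?lower F'"
      and eq: "lift_point C t = lift_point C' t'"
    have CC: "C \<in> chambers A" "C' \<in> chambers A" "face_le C F" "face_le C' F'" using C C' by auto
    have tt: "t \<in> order_complex (faces A) face_le" "t' \<in> order_complex (faces A) face_le"
      using t t' lower by blast+
    note inj = lift_point_inj[OF tt eq]
    \<comment> \<open>Both points are pushed to the greatest support face. Its vertex in the common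
      lift carries the restrictions of \<open>C\<close> and of \<open>C'\<close>, which therefore
      coincide.\<close>
    obtain m where m: "m \<in> faces A" "t m \<noteq> 0" "\<And>G. t G \<noteq> 0 \<Longrightarrow> face_le G m"
      using faces.greatest[OF tt(1)] by blast
    have le: "face_le m F" "face_le m F'"
      using order_complexD(2)[OF t m(2)] order_complexD(2)[OF t', of m] inj(1) m(2) by auto
    have low: "t \<in> ?lower m"
      using m(3) order_complexD(2)[OF tt(1)] by (intro order_complex_restrict[OF tt(1)]) auto
    have ch: "chamber_at A m C = chamber_at A m C'"
    proof -
      obtain c where c: "C = face_at A c" "regular A c" by (rule chambers_cases[OF CC(1)])
      obtain c' where c': "C' = face_at A c'" "regular A c'" by (rule chambers_cases[OF CC(2)])
      obtain x where x: "m = face_at A x" using m(1) unfolding faces_eq by blast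
      obtain d where d: "chamber_at A m C = face_at A d"
        unfolding c(1) x by (rule chamber_at_cases[OF c(2), of x])
      obtain d' where d': "chamber_at A m C' = face_at A d'"
        unfolding c'(1) x by (rule chamber_at_cases[OF c'(2), of x])
      show ?thesis using inj(2)[OF m(2)] unfolding d d' w_face_at_eq_iff .
    qed
    \<comment> \<open>At \<open>m = F\<close> no gluing step is taken, but the formula persists
      because \<open>C \<le> F\<close> gives \<open>C\<^sub>F = C\<close>.\<close>
    have s1: "(if m = F then C else chamber_at A m C) = chamber_at A m C"
      using self[OF CC(1) F CC(3)] by auto
    have s2: "(if m = F' then C' else chamber_at A m C') = chamber_at A m C'"
      using self[OF CC(2) F' CC(4)] by auto
    show "t = t' \<and> (\<exists>q\<in>faces A. face_le q F \<and> face_le q F' \<and> t \<in> ?lower q \<and>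
        (if q = F then C else chamber_at A q C) = (if q = F' then C' else chamber_at A q C'))"
    proof (intro conjI bexI[OF _ m(1)])
      show "t = t'" by (rule inj(1))
      show "(if m = F then C else chamber_at A m C) = (if m = F' then C' else chamber_at A m C')"
        unfolding s1 s2 by (rule ch)
    qed (fact le low)+
  qed
  also have "?S = realization"
  proof (intro equalityI subsetI)
    fix u assume "u \<in> ?S"
    then obtain F C t where "C \<in> chambers A" "t \<in> ?lower F" "u = lift_point C t" by auto
    then show "u \<in> realization" using lift_point_in_realization[of C t] lower by blast
  next
    fix u assume "u \<in> realization"
    then obtain F C t where "F \<in> faces A" "C \<in> chambers A" "face_le C F" "t \<in> ?lower F" "u = lift_point C t"
      by (rule lift_point_surj)
    then show "u \<in> ?S" by auto
  qed
  finally show ?thesis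
    by (simp add: hocolim_Did_def subtopology_subtopology)
qed

end

theorem theorem4p3:
  fixes A :: "(real ^ 'n) set set" and w :: "(real ^ 'n) set \<Rightarrow> real ^ 'n"
  assumes "arrangement A"
    and "\<forall>F \<in> faces A. w F \<in> F"
  shows "hocolim_E A w homotopy_equivalent_space hocolim_Did A \<and>
         hocolim_Did A homotopy_equivalent_space top_of_set (complexified_complement A)"
proof -
  interpret pointed_arrangement A w
    by unfold_locales (use assms in auto)
  have Did: "hocolim_Did A homotopy_equivalent_space top_of_set realization"
    by (rule homeomorphic_imp_homotopy_equivalent_space[OF hocolim_Did_homeomorphic])
  have "hocolim_E A w homotopy_equivalent_space hocolim_Did A"
    by (rule homotopy_eqv_trans[OF hocolim_E_homotopy_equivalent Did[THEN homotopy_equivalent_space_sym[THEN iffD1]]])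
  moreover have "hocolim_Did A homotopy_equivalent_space top_of_set (complexified_complement A)"
    by (rule homotopy_eqv_trans[OF Did homotopy_eqv_realization[THEN homotopy_equivalent_space_sym[THEN iffD1]]])
  ultimately show ?thesis ..
qed

end
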